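(* Let $E$ be a complex separable Hilbert space carrying a unitary representation of the dihedral group $D_n$ with generators $\mathcal R,\mathcal S$, let $\mathcal A\in C^0([0,1];\mathcal F^{\mathrm{sa}}(E))$ commute pointwise with $\mathcal R$ and $\mathcal S$, and let $h\in\{0,\dots,n-1\}$. Then $$\operatorname{sf}(\mathcal A;[0,1])=\operatorname{sf}(\mathcal A|_{E_h^+};[0,1])+\operatorname{sf}(\mathcal A|_{E_h^-};[0,1])$$ and, for each choice of sign, $$\operatorname{sf}(\mathcal A|_{E_h^\pm};[0,1])=\sum_{k=0}^{\bar n}\operatorname{sf}(\mathcal A|_{F_{k,h}^\pm};[0,1]).$$
   Context: $n\ge 1$ is an integer. The unitary representation of $D_n$ in $E$ is given by unitary operators $\mathcal R,\mathcal S$ on $E$ with $\mathcal R^n=\mathcal S^2=(\mathcal S\mathcal R)^2=\mathrm{Id}_E$. Let $\zeta_n=e^{2\pi i/n}$ and $E_k=\ker(\mathcal R-\zeta_n^k\mathrm{Id}_E)$ for $k\in\mathbb Z$. Let $\bar n=\lfloor n/2\rfloor$. Define $F_0=E_0$; $F_k=E_k\oplus E_{-k}$ for $1\le k\le\lfloor (n-1)/2\rfloor$; and, if $n$ is even, $F_{n/2}=E_{n/2}$. For $h\in\{0,\dots,n-1\}$ put $E_h^\pm=\{x\in E: \mathcal S\mathcal R^h x=\pm x\}$ and $F_{k,h}^\pm=\{u\in F_k:\mathcal S\mathcal R^h u=\pm u\}$. $\mathcal F^{\mathrm{sa}}(E)$ is the space of bounded selfadjoint Fredholm operators on $E$ with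 the norm topology. Spectral flow: for a continuous path $\mathcal A:[a,b]\to\mathcal F^{\mathrm{sa}}(E)$ there are a partition $a=t_0<\dots<t_N=b$ and numbers $a_i>0$ such that, for $t\in[t_{i-1},t_i]$, $\pm a_i\notin\sigma(\mathcal A_t)$ and the spectral subspace $E_{[-a_i,a_i]}(\mathcal A_t)$ has finite dimension independent of $t$. Then $\operatorname{sf}(\mathcal A;[a,b])=\sum_{i=1}^N\big(\dim E_{[0,a_i]}(\mathcal A_{t_i})-\dim E_{[0,a_i]}(\mathcal A_{t_{i-1}})\big)$, where $E_{[c,d]}(T)$ is the spectral subspace of $T$ for $[c,d]$; this is independent of the choices. *)

theory Defs
  imports "HOL-Analysis.Analysis"
begin

section \<open>Complex Hilbert spaces\<close>

text \<open>
  The inner product is conjugate-linear in the first argument. Building the class on top of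
  \<^class>\<open>real_normed_vector\<close> makes the library's topology and bounded operators available;
  the underlying real scalar multiplication is the restriction of the complex one.
\<close>

class complex_inner = real_normed_vector +
  fixes scaleC :: "complex \<Rightarrow> 'a \<Rightarrow> 'a" (infixr \<open>*\<^sub>C\<close> 75)
    and cinner :: "'a \<Rightarrow> 'a \<Rightarrow> complex"
  assumes scaleC_add_right: "a *\<^sub>C (x + y) = a *\<^sub>C x + a *\<^sub>C y"
    and scaleC_add_left: "(a + b) *\<^sub>C x = a *\<^sub>C x + b *\<^sub>C x"
    and scaleC_scaleC: "a *\<^sub>C b *\<^sub>C x = (a * b) *\<^sub>C x"
    and scaleR_scaleC: "r *\<^sub>R x = complex_of_real r *\<^sub>C x"
    and cinner_commute: "cinner x y = cnj (cinner y x)"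
    and cinner_add_right: "cinner x (y + z) = cinner x y + cinner x z"
    and cinner_scaleC_right: "cinner x (a *\<^sub>C y) = a * cinner x y"
    and norm_eq_sqrt_cinner: "norm x = sqrt (Re (cinner x x))"

class chilbert_space = complex_inner + complete_space

instantiation complex :: chilbert_space
begin

definition "scaleC_complex = ((*) :: complex \<Rightarrow> complex \<Rightarrow> complex)"
definition "cinner_complex x y = cnj x * y" for x y :: complex

instance
  by standard
    (auto simp: scaleC_complex_def cinner_complex_def algebra_simps scaleR_conv_of_real
       cmod_def power2_eq_square)

end

global_interpretation complex_vector: vector_space "scaleC :: complex \<Rightarrow> 'a \<Rightarrow> 'a :: complex_inner"
  defines csubspace = complex_vector.subspace
    and cspan = complex_vector.span
    and cdim = complex_vector.dim
proof unfold_locales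
  show "1 *\<^sub>C x = x" for x :: 'a
    using scaleR_scaleC[of 1 x] by simp
qed (auto simp: scaleC_add_right scaleC_add_left scaleC_scaleC)

abbreviation clinear :: "('a::complex_inner \<Rightarrow> 'a) \<Rightarrow> bool" where
  "clinear \<equiv> Vector_Spaces.linear scaleC scaleC"

text \<open>\<^term>\<open>cdim V\<close> is \<^term>\<open>0::nat\<close> if \<^term>\<open>V\<close> is infinite-dimensional,
  so finiteness has to be required separately.\<close>

definition finite_cdim :: "'a::complex_inner set \<Rightarrow> bool" where
  "finite_cdim V \<longleftrightarrow> (\<exists>B. finite B \<and> cspan B = V)"


section \<open>Bounded selfadjoint Fredholm operators\<close>

definition selfadjoint :: "('a::complex_inner \<Rightarrow> 'a) \<Rightarrow> bool" where
  "selfadjoint T \<longleftrightarrow> (\<forall>x y. cinner (T x) y = cinner x (T y))"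

definition fredholm :: "('a::complex_inner \<Rightarrow> 'a) \<Rightarrow> bool" where
  "fredholm T \<longleftrightarrow>
     finite_cdim {x. T x = 0} \<and> closed (range T) \<and>
     (\<exists>B. finite B \<and> (\<forall>y. \<exists>x. y - T x \<in> cspan B))"

text \<open>Elements of type \<open>'a \<Rightarrow>\<^sub>L 'a\<close> are only real-linear, so complex linearity is demanded
  here. The topology of that type is the one of the operator norm.\<close>

definition Fsa :: "('a::chilbert_space \<Rightarrow>\<^sub>L 'a) set" where
  "Fsa = {T. clinear (blinfun_apply T) \<and> selfadjoint (blinfun_apply T) \<and>
             fredholm (blinfun_apply T)}"


section \<open>Spectrum and spectral subspaces on a closed subspace\<close>

text \<open>
  In this section and the next, an operator on the Hilbert space \<open>V\<close>, a closed complex subspace of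
  the ambient space, is a function \<open>T\<close> mapping \<open>V\<close> into \<open>V\<close>; only its values on \<open>V\<close> matter.
  Thus an operator \<open>T\<close> of the ambient space leaving \<open>V\<close> invariant, taken together with \<open>V\<close>,
  is the restriction of \<open>T\<close> to \<open>V\<close>.
\<close>

definition op_spectrum :: "'a::chilbert_space set \<Rightarrow> ('a \<Rightarrow> 'a) \<Rightarrow> complex set" where
  "op_spectrum V T =
     {z. \<not> (\<exists>S K. \<forall>x\<in>V. S x \<in> V \<and> norm (S x) \<le> K * norm x \<and>
                        S (T x - z *\<^sub>C x) = x \<and> T (S x) - z *\<^sub>C S x = x)}"

text \<open>Linearity of the projection on \<open>V\<close> follows from its symmetry.\<close>

definition orthogonal_projection_on :: "'a::chilbert_space set \<Rightarrow> ('a \<Rightarrow> 'a) \<Rightarrow> bool" where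
  "orthogonal_projection_on V P \<longleftrightarrow>
     (\<forall>x\<in>V. P x \<in> V \<and> P (P x) = P x) \<and>
     (\<forall>x\<in>V. \<forall>y\<in>V. cinner (P x) y = cinner x (P y))"

text \<open>
  \<open>E\<close> is the spectral family (resolution of the identity) of the selfadjoint operator \<open>T\<close> on \<open>V\<close>:
  it is increasing and strongly right-continuous, tends strongly to \<open>0\<close> and to the identity at
  the two ends, and represents \<open>T\<close> as the integral of \<open>\<lambda> dE(\<lambda>)\<close>, i.e. \<open>\<langle>x, T x\<rangle>\<close> is the
  Lebesgue-Stieltjes integral of \<open>\<lambda>\<close> with respect to \<open>d\<langle>x, E(\<lambda>) x\<rangle>\<close>.
\<close>

definition spectral_family ::
  "'a::chilbert_space set \<Rightarrow> ('a \<Rightarrow> 'a) \<Rightarrow> (real \<Rightarrow> 'a \<Rightarrow> 'a) \<Rightarrow> bool" where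
  "spectral_family V T E \<longleftrightarrow>
     (\<forall>l. orthogonal_projection_on V (E l)) \<and>
     (\<forall>x\<in>V.
        (\<forall>l m. l \<le> m \<longrightarrow> E l (E m x) = E l x \<and> E m (E l x) = E l x) \<and>
        (\<forall>l. ((\<lambda>m. E m x) \<longlongrightarrow> E l x) (at_right l)) \<and>
        ((\<lambda>m. E m x) \<longlongrightarrow> 0) at_bot \<and>
        ((\<lambda>m. E m x) \<longlongrightarrow> x) at_top \<and>
        integrable (interval_measure (\<lambda>l. Re (cinner x (E l x)))) (\<lambda>l. l) \<and>
        cinner x (T x) =
          complex_of_real (\<integral>l. l \<partial>interval_measure (\<lambda>l. Re (cinner x (E l x)))))"

text \<open>
  The spectral projection of \<open>T\<close> for \<open>[c, d]\<close> is \<open>E(d) - E(c-)\<close>, where \<open>E(c-)\<close> is the strong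
  limit from the left; the spectral subspace, its range, is its set of fixed points.
  By the spectral theorem \<open>E\<close> exists and is unique on \<open>V\<close>; its values outside \<open>V\<close> are arbitrary,
  which is why it is introduced by an existential quantifier.
\<close>

definition spectral_subspace ::
  "'a::chilbert_space set \<Rightarrow> ('a \<Rightarrow> 'a) \<Rightarrow> real \<Rightarrow> real \<Rightarrow> 'a set" where
  "spectral_subspace V T c d =
     {x\<in>V. \<exists>E. spectral_family V T E \<and> ((\<lambda>l. E d x - E l x) \<longlongrightarrow> x) (at_left c)}"


section \<open>Spectral flow\<close>

text \<open>\<^term>\<open>t\<close> is a partition of the interval \<open>[a, b]\<close> into \<open>N\<close> pieces, and \<open>w i\<close> is the spectral
  bound used on \<open>[t (i - 1), t i]\<close>.\<close>

definition sf_partition ::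
  "'a::chilbert_space set \<Rightarrow> (real \<Rightarrow> 'a \<Rightarrow> 'a) \<Rightarrow> real \<Rightarrow> real \<Rightarrow>
     nat \<Rightarrow> (nat \<Rightarrow> real) \<Rightarrow> (nat \<Rightarrow> real) \<Rightarrow> bool" where
  "sf_partition V A a b N t w \<longleftrightarrow>
     t 0 = a \<and> t N = b \<and>
     (\<forall>i\<in>{1..N}.
        t (i - 1) < t i \<and> w i > 0 \<and>
        (\<forall>s\<in>{t (i - 1)..t i}.
           complex_of_real (w i) \<notin> op_spectrum V (A s) \<and>
           complex_of_real (- w i) \<notin> op_spectrum V (A s) \<and>
           finite_cdim (spectral_subspace V (A s) (- w i) (w i))) \<and>
        (\<exists>d. \<forall>s\<in>{t (i - 1)..t i}. cdim (spectral_subspace V (A s) (- w i) (w i)) = d))"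

text \<open>The description is proper for continuous paths of bounded selfadjoint Fredholm operators on
  \<open>V\<close>: partitions as above exist and all of them give the same sum.\<close>

definition sf :: "'a::chilbert_space set \<Rightarrow> (real \<Rightarrow> 'a \<Rightarrow> 'a) \<Rightarrow> real \<Rightarrow> real \<Rightarrow> int" where
  "sf V A a b = (THE s. \<exists>N t w. sf_partition V A a b N t w \<and>
     s = (\<Sum>i=1..N. int (cdim (spectral_subspace V (A (t i)) 0 (w i)))
                    - int (cdim (spectral_subspace V (A (t (i - 1))) 0 (w i)))))"


section \<open>Unitary representations of the dihedral group\<close>

definition unitary :: "('a::complex_inner \<Rightarrow> 'a) \<Rightarrow> bool" where
  "unitary U \<longleftrightarrow> clinear U \<and> surj U \<and> (\<forall>x y. cinner (U x) (U y) = cinner x y)"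

definition unitary_dihedral_rep ::
  "nat \<Rightarrow> ('a::complex_inner \<Rightarrow> 'a) \<Rightarrow> ('a \<Rightarrow> 'a) \<Rightarrow> bool" where
  "unitary_dihedral_rep n R S \<longleftrightarrow>
     unitary R \<and> unitary S \<and> R ^^ n = id \<and> S ^^ 2 = id \<and> (S \<circ> R) ^^ 2 = id"

definition zeta :: "nat \<Rightarrow> complex" where
  "zeta n = exp (2 * of_real pi * \<i> / of_nat n)"

definition rot_eigenspace :: "nat \<Rightarrow> ('a::complex_inner \<Rightarrow> 'a) \<Rightarrow> int \<Rightarrow> 'a set" where
  "rot_eigenspace n R k = {x. R x - (zeta n powi k) *\<^sub>C x = 0}"

text \<open>\<open>F\<^sub>k\<close> for \<open>0 \<le> k \<le> \<lfloor>n/2\<rfloor>\<close>; the last branch is never reached for such \<open>k\<close>.\<close>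

definition isotypic_space :: "nat \<Rightarrow> ('a::complex_inner \<Rightarrow> 'a) \<Rightarrow> nat \<Rightarrow> 'a set" where
  "isotypic_space n R k =
     (if k = 0 then rot_eigenspace n R 0
      else if k \<le> (n - 1) div 2
        then {x + y | x y. x \<in> rot_eigenspace n R (int k) \<and> y \<in> rot_eigenspace n R (- int k)}
      else if even n \<and> k = n div 2 then rot_eigenspace n R (int k)
      else undefined)"

text \<open>\<open>E\<^sub>h\<close> and \<open>F\<^sub>k\<^sub>,\<^sub>h\<close> with superscript \<open>\<plusminus>\<close>, the sign being the number \<open>\<epsilon> \<in> {1, -1}\<close>.\<close>

definition E_refl :: "('a::complex_inner \<Rightarrow> 'a) \<Rightarrow> ('a \<Rightarrow> 'a) \<Rightarrow> nat \<Rightarrow> real \<Rightarrow> 'a set" where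
  "E_refl R S h \<epsilon> = {x. S ((R ^^ h) x) = \<epsilon> *\<^sub>R x}"

definition F_refl ::
  "nat \<Rightarrow> ('a::complex_inner \<Rightarrow> 'a) \<Rightarrow> ('a \<Rightarrow> 'a) \<Rightarrow> nat \<Rightarrow> nat \<Rightarrow> real \<Rightarrow> 'a set" where
  "F_refl n R S k h \<epsilon> = {u \<in> isotypic_space n R k. S ((R ^^ h) u) = \<epsilon> *\<^sub>R u}"

end

theory Submission
  imports Defs "HOL-Probability.Distribution_Functions"
begin

text \<open>
  The reason for both formulas is that a selfadjoint operator \<open>T\<close> which commutes with the
  representation has spectral projections \<open>spec_proj T l\<close> (for the half-lines up to \<open>l\<close>) that
  commute with it too. Hence every spectral subspace of \<open>T\<close> is the direct sum of its
  intersections with the reflection eigenspaces \<open>E_refl\<close>, and the intersection with such an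
  eigenspace is the direct sum of those with the spaces \<open>F_refl\<close>. The dimensions that define the
  spectral flow are therefore additive, provided that one partition serves the whole space and all
  these subspaces at once (\<open>sf_additive\<close>).

  Three things have to be established before this argument applies.

  First, spectral subspaces are defined through spectral families, so the spectral theorem is
  needed. For \<open>A = T - l\<close> the operator \<open>\<bar>A\<bar>\<close>, the square root of \<open>A\<^sup>2\<close>, is the norm limit of an
  iteration and commutes with everything that commutes with \<open>T\<close>; \<open>spec_proj T l\<close> is the
  projection onto the kernel of \<open>\<bar>A\<bar> + A\<close>. These projections form a spectral family
  (\<open>spectral_family_spec_proj\<close>), and on a closed invariant subspace \<open>V\<close> every spectral family
  of the restriction agrees with them (\<open>spectral_family_unique\<close>), by a comparison of the growth
  of powers of \<open>T\<close> on two spectral subspaces (\<open>splits_at_range_mono\<close>). So all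
  spectral subspaces on \<open>V\<close> are cut out of \<open>V\<close> by the projections of the ambient operator
  (\<open>spectral_subspace_eq\<close>).

  Second, the number given by a partition must not depend on the partition. If \<open>c\<close> and \<open>d\<close> are not
  in the spectrum of \<open>T\<close>, and the spectral subspace for \<open>[c, d]\<close> is finite-dimensional, its
  dimension is the same for all operators near \<open>T\<close> (\<open>slab_dimension_stable\<close>); the proof compares
  \<open>norm (T x - m x)\<close>, where \<open>m\<close> is the centre of \<open>[c, d]\<close>, on this subspace and on its complement,
  and uses no continuity of the projections. It follows that two admissible widths give the same
  change of dimension on an interval where both are admissible, and two partitions are compared
  on their common refinement (\<open>partition_sum_unique\<close>).

  Third, partitions exist: a selfadjoint Fredholm operator has a gap around \<open>0\<close> in its spectrum,
  apart from an eigenvalue \<open>0\<close> of finite multiplicity (\<open>Fsa_gap\<close>), and gaps persist under small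
  perturbations. A partition for the whole space is one for each invariant subspace
  (\<open>admissible_restrict\<close>), because lower bounds and finite dimension are inherited.

  On the side of the group, the projections onto the spaces \<open>F\<^sub>k\<close> are sums of discrete Fourier
  averages of the powers of \<open>R\<close>; they commute with the reflections because a reflection
  exchanges the eigenvalues \<open>\<zeta>\<^sup>k\<close> and \<open>\<zeta>\<^sup>-\<^sup>k\<close> of the rotation (\<open>Iso_U\<close>).
\<close>

section \<open>The real inner product of a complex Hilbert space\<close>

subclass (in chilbert_space) banach ..

lemma cinner_scaleC_left: "cinner (a *\<^sub>C x) y = cnj a * cinner x y"
  by (metis cinner_commute cinner_scaleC_right complex_cnj_mult)

lemma cinner_scaleR_right: "cinner x (r *\<^sub>R y) = of_real r * cinner x y"
  by (simp add: scaleR_scaleC cinner_scaleC_right)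

text \<open>Positivity, symmetry and orthogonality to a complex subspace are visible in the real part of
  the inner product, so that most arguments take place in a real Hilbert space.\<close>

definition rip :: "'a::complex_inner \<Rightarrow> 'a \<Rightarrow> real" where
  "rip x y = Re (cinner x y)"

lemma rip_commute: "rip x y = rip y x"
  unfolding rip_def by (subst cinner_commute) simp

lemma rip_add_right: "rip x (y + z) = rip x y + rip x z"
  by (simp add: rip_def cinner_add_right)

lemma rip_scaleR_right: "rip x (r *\<^sub>R y) = r * rip x y"
  by (simp add: rip_def cinner_scaleR_right)

lemma rip_add_left: "rip (x + y) z = rip x z + rip y z"
  by (metis rip_add_right rip_commute)

lemma rip_scaleR_left: "rip (r *\<^sub>R x) y = r * rip x y"
  by (metis rip_scaleR_right rip_commute)

lemma rip_minus_right: "rip x (- y) = - rip x y"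
  using rip_scaleR_right[of x "-1" y] by simp

lemma rip_minus_left: "rip (- x) y = - rip x y"
  using rip_scaleR_left[of "-1" x y] by simp

lemma rip_diff_right: "rip x (y - z) = rip x y - rip x z"
  using rip_add_right[of x y "- z"] by (simp add: rip_minus_right)

lemma rip_diff_left: "rip (x - y) z = rip x z - rip y z"
  by (metis rip_diff_right rip_commute)

lemma rip_zero_right [simp]: "rip x 0 = 0"
  using rip_scaleR_right[of x 0 x] by simp

lemma rip_zero_left [simp]: "rip 0 x = 0"
  by (metis rip_commute rip_zero_right)

lemma rip_self: "rip x x = (norm x)\<^sup>2"
  unfolding rip_def norm_eq_sqrt_cinner
  by (metis norm_eq_sqrt_cinner norm_ge_zero real_sqrt_ge_0_iff real_sqrt_pow2)

lemmas rip_simps = rip_add_left rip_add_right rip_diff_left rip_diff_right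
  rip_minus_left rip_minus_right rip_scaleR_left rip_scaleR_right

lemma norm_add_sq: "(norm (x + y))\<^sup>2 = (norm x)\<^sup>2 + 2 * rip x y + (norm y)\<^sup>2"
  unfolding rip_self[symmetric] by (simp add: rip_simps rip_commute)

lemma norm_diff_sq: "(norm (x - y))\<^sup>2 = (norm x)\<^sup>2 - 2 * rip x y + (norm y)\<^sup>2"
  unfolding rip_self[symmetric] by (simp add: rip_simps rip_commute)

lemma norm_add_orthogonal: "rip x y = 0 \<Longrightarrow> (norm (x + y))\<^sup>2 = (norm x)\<^sup>2 + (norm y)\<^sup>2"
  by (simp add: norm_add_sq)

lemma rip_le_norm: "rip x y \<le> norm x * norm y"
proof -
  have "(norm (x + y))\<^sup>2 \<le> (norm x + norm y)\<^sup>2"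
    by (intro power_mono norm_triangle_ineq) auto
  then show ?thesis
    unfolding norm_add_sq by (simp add: power2_sum)
qed

lemma abs_rip_le_norm: "\<bar>rip x y\<bar> \<le> norm x * norm y"
  using rip_le_norm[of x y] rip_le_norm[of "- x" y] by (simp add: rip_minus_left)

lemma bounded_linear_rip_left: "bounded_linear (\<lambda>x. rip x y)"
  by (rule bounded_linear_intro[where K = "norm y"])
     (use abs_rip_le_norm in \<open>auto simp: rip_simps\<close>)

lemma bounded_linear_rip_right: "bounded_linear (\<lambda>y. rip x y)"
  unfolding rip_commute[of x] by (rule bounded_linear_rip_left)

lemmas tendsto_rip_left = bounded_linear.tendsto[OF bounded_linear_rip_left]
lemmas tendsto_rip_right = bounded_linear.tendsto[OF bounded_linear_rip_right]

lemmas continuous_on_rip_right = bounded_linear.continuous_on[OF bounded_linear_rip_right]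

text \<open>The real part determines the complex inner product, because \<open>Im\<close> is obtained from it by
  multiplying an argument by \<open>\<i>\<close>.\<close>

lemma Im_cinner: "Im (cinner x y) = rip (\<i> *\<^sub>C x) y"
  by (simp add: rip_def cinner_scaleC_left)

lemma cinner_eq_iff_rip: "cinner x y = cinner u v \<longleftrightarrow>
    rip x y = rip u v \<and> rip (\<i> *\<^sub>C x) y = rip (\<i> *\<^sub>C u) v"
  by (simp add: complex_eq_iff[of "cinner x y"] Im_cinner) (simp add: rip_def)

lemma cinner_self: "cinner x x = complex_of_real ((norm x)\<^sup>2)"
proof -
  have "Im (cinner x x) = 0"
    by (metis cinner_commute complex_cnj_cancel_iff complex_is_Real_iff Reals_cnj_iff)
  then show ?thesis
    by (simp add: complex_eq_iff rip_self[symmetric] rip_def)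
qed

lemma norm_scaleC: "norm (a *\<^sub>C x) = cmod a * norm x"
proof -
  have "cinner (a *\<^sub>C x) (a *\<^sub>C x) = a * cnj a * cinner x x"
    by (simp only: cinner_scaleC_left cinner_scaleC_right mult_ac)
  then have "complex_of_real ((norm (a *\<^sub>C x))\<^sup>2) = complex_of_real ((cmod a * norm x)\<^sup>2)"
    unfolding cinner_self complex_norm_square[symmetric] by (simp add: power_mult_distrib)
  then show ?thesis
    by (metis norm_ge_zero of_real_eq_iff power2_eq_imp_eq mult_nonneg_nonneg)
qed

lemma bounded_linear_scaleC: "bounded_linear (\<lambda>x. a *\<^sub>C x)"
  by (rule bounded_linear_intro[where K = "cmod a"])
     (auto simp: scaleC_add_right scaleR_scaleC scaleC_scaleC norm_scaleC mult_ac)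

lemma csubspace_imp_subspace: "csubspace V \<Longrightarrow> subspace V"
  unfolding subspace_def complex_vector.subspace_def by (simp add: scaleR_scaleC)

lemma clinear_iff:
  "clinear T \<longleftrightarrow> (\<forall>x y. T (x + y) = T x + T y) \<and> (\<forall>a x. T (a *\<^sub>C x) = a *\<^sub>C T x)"
  unfolding Vector_Spaces.linear_iff by (simp add: complex_vector.vector_space_axioms)


section \<open>Orthogonal projections\<close>

text \<open>A minimising sequence for the distance to \<open>V\<close> is Cauchy by the parallelogram law, and its
  limit satisfies the first-order condition of the minimum, which is orthogonality.\<close>

lemma projection_exists:
  fixes V :: "'a::chilbert_space set"
  assumes V: "subspace V" "closed V"
  shows "\<exists>u\<in>V. \<forall>v\<in>V. rip v (x - u) = 0"
proof -
  define d where "d = (INF v\<in>V. (norm (x - v))\<^sup>2)"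
  have ne: "V \<noteq> {}" using V(1) subspace_0 by auto
  have bdd: "bdd_below ((\<lambda>v. (norm (x - v))\<^sup>2) ` V)"
    by (rule bdd_belowI[of _ 0]) auto
  have dle: "d \<le> (norm (x - v))\<^sup>2" if "v \<in> V" for v
    unfolding d_def by (rule cINF_lower[OF bdd that])
  have "\<exists>v\<in>V. (norm (x - v))\<^sup>2 < d + inverse (real (Suc n))" for n
  proof -
    have "d < d + inverse (real (Suc n))" by simp
    then show ?thesis
      unfolding cINF_less_iff[OF ne bdd, of "d + inverse (real (Suc n))", folded d_def] .
  qed
  then obtain u where uV: "\<And>n. u n \<in> V"
    and u: "\<And>n. (norm (x - u n))\<^sup>2 < d + inverse (real (Suc n))"
    by metis
  have close: "(norm (u n - u m))\<^sup>2 \<le> 2 * inverse (real (Suc n)) + 2 * inverse (real (Suc m))"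
    for n m
  proof -
    have "(1/2) *\<^sub>R (u n + u m) \<in> V"
      using uV V(1) by (simp add: subspace_add subspace_scale)
    then have "d \<le> (norm (x - (1/2) *\<^sub>R (u n + u m)))\<^sup>2" by (rule dle)
    moreover have "(norm (u n - u m))\<^sup>2 =
        2 * (norm (x - u n))\<^sup>2 + 2 * (norm (x - u m))\<^sup>2 - 4 * (norm (x - (1/2) *\<^sub>R (u n + u m)))\<^sup>2"
      unfolding rip_self[symmetric]
      by (simp add: rip_simps rip_commute[of "u n" x] rip_commute[of "u m" x]
          rip_commute[of "u m" "u n"] field_simps)
    ultimately show ?thesis using u[of n] u[of m] by simp
  qed
  have "Cauchy u"
  proof (rule metric_CauchyI)
    fix e :: real assume "e > 0"
    then obtain M where M: "inverse (real (Suc M)) < e\<^sup>2 / 4"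
      using reals_Archimedean[of "e\<^sup>2 / 4"] by auto
    have "dist (u m) (u n) < e" if "m \<ge> M" "n \<ge> M" for m n
    proof -
      have "inverse (real (Suc m)) \<le> inverse (real (Suc M))"
           "inverse (real (Suc n)) \<le> inverse (real (Suc M))"
        using that by (auto intro!: le_imp_inverse_le)
      then have "(norm (u m - u n))\<^sup>2 < e\<^sup>2"
        using close[of m n] M by linarith
      then show ?thesis using \<open>e > 0\<close> by (simp add: dist_norm power_less_imp_less_base)
    qed
    then show "\<exists>M. \<forall>m\<ge>M. \<forall>n\<ge>M. dist (u m) (u n) < e" by blast
  qed
  then obtain l where l: "u \<longlonglongrightarrow> l" using convergent_eq_Cauchy by blast
  have lV: "l \<in> V" using closed_sequentially[OF V(2) _ l] uV by blast
  have "(\<lambda>n. (norm (x - u n))\<^sup>2) \<longlonglongrightarrow> (norm (x - l))\<^sup>2"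
    by (intro tendsto_intros l)
  moreover have "(\<lambda>n. d + inverse (real (Suc n))) \<longlonglongrightarrow> d + 0"
    by (intro tendsto_intros LIMSEQ_inverse_real_of_nat)
  ultimately have ld: "(norm (x - l))\<^sup>2 \<le> d"
    using LIMSEQ_le[of _ "(norm (x - l))\<^sup>2" _ d] u by (metis (no_types, lifting) add_0_right less_imp_le)
  have "rip v (x - l) = 0" if v: "v \<in> V" for v
  proof (cases "v = 0")
    case False
    \<comment> \<open>\<open>s *\<^sub>R v\<close> is the projection of \<open>x - l\<close> to the line through \<open>v\<close>, the most profitable
      change of \<open>l\<close> in this direction.\<close>
    define s where "s = rip v (x - l) / (norm v)\<^sup>2"
    have "l + s *\<^sub>R v \<in> V" using lV v V(1) by (simp add: subspace_add subspace_scale)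
    then have "(norm (x - l))\<^sup>2 \<le> (norm ((x - l) - s *\<^sub>R v))\<^sup>2"
      using order_trans[OF ld dle[of "l + s *\<^sub>R v"]] by (simp only: diff_diff_eq)
    also have "\<dots> = (norm (x - l))\<^sup>2 - s * rip v (x - l)"
      unfolding norm_diff_sq using False
      by (simp add: rip_scaleR_right s_def power2_eq_square rip_commute[of "x - l" v] field_simps)
    finally have "s * rip v (x - l) \<le> 0" by simp
    then have "(rip v (x - l))\<^sup>2 \<le> 0" using False
      by (simp add: s_def power2_eq_square divide_le_0_iff mult_le_0_iff)
    then show ?thesis by simp
  qed simp
  then show ?thesis using lV by blast
qed

definition rproj :: "'a::chilbert_space set \<Rightarrow> 'a \<Rightarrow> 'a" where
  "rproj V x = (SOME u. u \<in> V \<and> (\<forall>v\<in>V. rip v (x - u) = 0))"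

locale closed_csubspace =
  fixes V :: "'a::chilbert_space set"
  assumes csubspace: "csubspace V" and closed: "closed V"
begin

lemma subspace: "subspace V"
  by (rule csubspace_imp_subspace[OF csubspace])

lemma add_mem: "x \<in> V \<Longrightarrow> y \<in> V \<Longrightarrow> x + y \<in> V"
  and diff_mem: "x \<in> V \<Longrightarrow> y \<in> V \<Longrightarrow> x - y \<in> V"
  and scaleC_mem: "x \<in> V \<Longrightarrow> a *\<^sub>C x \<in> V"
  and scaleR_mem: "x \<in> V \<Longrightarrow> r *\<^sub>R x \<in> V"
  and zero_mem: "0 \<in> V"
  using csubspace subspace
  by (auto simp: complex_vector.subspace_def subspace_def subspace_diff)

lemma proj_mem: "rproj V x \<in> V"
  and proj_orth: "v \<in> V \<Longrightarrow> rip v (x - rproj V x) = 0"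
  using someI_ex[of "\<lambda>u. u \<in> V \<and> (\<forall>v\<in>V. rip v (x - u) = 0)"]
    projection_exists[OF subspace closed, of x]
  unfolding rproj_def by blast+

lemma proj_unique:
  assumes "u \<in> V" "\<And>v. v \<in> V \<Longrightarrow> rip v (x - u) = 0"
  shows "rproj V x = u"
proof -
  have m: "rproj V x - u \<in> V" using assms(1) proj_mem diff_mem by blast
  have "rip (rproj V x - u) ((x - u) - (x - rproj V x)) = 0"
    using assms(2)[OF m] proj_orth[OF m, of x] by (simp add: rip_diff_right)
  then show ?thesis by (simp add: rip_self)
qed

lemma proj_eq_self_iff: "rproj V x = x \<longleftrightarrow> x \<in> V"
  using proj_mem[of x] proj_unique[of x x] by fastforce

lemma proj_self: "x \<in> V \<Longrightarrow> rproj V x = x"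
  by (simp add: proj_eq_self_iff)

lemma proj_eq_zero_iff: "rproj V x = 0 \<longleftrightarrow> (\<forall>v\<in>V. rip v x = 0)"
  using proj_orth[of _ x] proj_unique[of 0 x] zero_mem by auto

lemma proj_add: "rproj V (x + y) = rproj V x + rproj V y"
proof (rule proj_unique)
  fix v assume "v \<in> V"
  then show "rip v (x + y - (rproj V x + rproj V y)) = 0"
    using proj_orth[of v x] proj_orth[of v y] by (simp add: rip_simps)
qed (simp add: add_mem proj_mem)

lemma proj_scaleC: "rproj V (a *\<^sub>C x) = a *\<^sub>C rproj V x"
proof (rule proj_unique)
  fix v assume "v \<in> V"
  then have "rip (cnj a *\<^sub>C v) (x - rproj V x) = 0"
    by (intro proj_orth scaleC_mem)
  moreover have "a *\<^sub>C x - a *\<^sub>C rproj V x = a *\<^sub>C (x - rproj V x)"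
    by (simp add: complex_vector.scale_right_diff_distrib)
  ultimately show "rip v (a *\<^sub>C x - a *\<^sub>C rproj V x) = 0"
    by (simp add: rip_def cinner_scaleC_left cinner_scaleC_right)
qed (simp add: scaleC_mem proj_mem)

lemma proj_sym: "rip (rproj V x) y = rip x (rproj V y)"
  using proj_orth[OF proj_mem[of x], of y] proj_orth[OF proj_mem[of y], of x]
  by (simp add: rip_diff_right rip_commute)

lemma proj_norm_le: "norm (rproj V x) \<le> norm x"
proof -
  have "(norm x)\<^sup>2 = (norm (rproj V x))\<^sup>2 + (norm (x - rproj V x))\<^sup>2"
    using norm_add_orthogonal[OF proj_orth[OF proj_mem[of x], of x]] by simp
  then have "(norm (rproj V x))\<^sup>2 \<le> (norm x)\<^sup>2" by simp
  then show ?thesis by (rule power2_le_imp_le) simp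
qed

lemma proj_bounded_linear: "bounded_linear (rproj V)"
  by (rule bounded_linear_intro[where K = 1])
     (auto simp: proj_add proj_scaleC scaleR_scaleC proj_norm_le)

lemma proj_cinner_sym: "cinner (rproj V x) y = cinner x (rproj V y)"
  unfolding cinner_eq_iff_rip by (simp add: proj_sym flip: proj_scaleC)

end

text \<open>If \<open>B\<close> and its adjoint \<open>B'\<close> leave \<open>V\<close> invariant, then \<open>B\<close> also leaves the orthogonal
  complement invariant, so it commutes with the projection.\<close>

lemma (in closed_csubspace) proj_commute:
  assumes B: "\<And>x y. B (x - y) = B x - B y" "\<And>x y. rip (B x) y = rip x (B' y)"
    and inv: "\<And>x. x \<in> V \<Longrightarrow> B x \<in> V" "\<And>x. x \<in> V \<Longrightarrow> B' x \<in> V"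
  shows "rproj V (B x) = B (rproj V x)"
proof (rule proj_unique)
  fix v assume "v \<in> V"
  have "rip v (B x - B (rproj V x)) = rip (B (x - rproj V x)) v"
    by (simp add: B(1) rip_commute)
  also have "\<dots> = rip (B' v) (x - rproj V x)"
    by (metis B(2) rip_commute)
  also have "\<dots> = 0" using inv(2)[OF \<open>v \<in> V\<close>] by (rule proj_orth)
  finally show "rip v (B x - B (rproj V x)) = 0" .
qed (simp add: inv(1) proj_mem)


section \<open>Uniform boundedness\<close>

text \<open>By Baire's theorem the vectors on which the functionals \<open>rip g\<close> are bounded by some fixed
  \<open>k\<close> contain a ball; differences of its points show that they are bounded on a ball around \<open>0\<close>.\<close>

lemma pointwise_bounded_imp_bounded:
  fixes G :: "'a::chilbert_space set"
  assumes "\<And>y. \<exists>K. \<forall>g\<in>G. \<bar>rip g y\<bar> \<le> K"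
  shows "\<exists>M. \<forall>g\<in>G. norm g \<le> M"
proof -
  define C where "C k = {y. \<forall>g\<in>G. \<bar>rip g y\<bar> \<le> real k}" for k :: nat
  have closedC: "closed (C k)" for k
  proof -
    have "C k = (\<Inter>g\<in>G. {y. \<bar>rip g y\<bar> \<le> real k})" by (auto simp: C_def)
    moreover have "closed {y. \<bar>rip g y\<bar> \<le> real k}" for g
      by (intro closed_Collect_le continuous_intros continuous_on_rip_right)
    ultimately show ?thesis by auto
  qed
  have "(\<Union>k. C k) = UNIV"
  proof -
    have "\<exists>k. y \<in> C k" for y
    proof -
      obtain K where "\<forall>g\<in>G. \<bar>rip g y\<bar> \<le> K" using assms by blast
      moreover obtain k where "K \<le> real k" using real_arch_simple by blast
      ultimately have "y \<in> C k" unfolding C_def by (auto intro: order_trans)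
      then show ?thesis ..
    qed
    then show ?thesis by auto
  qed
  moreover have "completely_metrizable_space (euclidean :: 'a topology)"
    by (rule completely_metrizable_space_euclidean)
  ultimately have "\<exists>T\<in>range C. \<not> (closedin euclidean T \<and> euclidean interior_of T = {})"
    using Baire_category_alt[of "euclidean :: 'a topology" "range C"] by auto
  then have "\<exists>k. interior (C k) \<noteq> {}" using closedC by auto
  then obtain k y where "y \<in> interior (C k)" by auto
  then obtain r where r: "r > 0" "ball y r \<subseteq> C k"
    by (meson interior_subset mem_interior subset_trans)
  have bnd: "\<bar>rip g z\<bar> \<le> 2 * real k" if "g \<in> G" "norm z < r" for g z
  proof -
    have "y \<in> C k" "y + z \<in> C k" using r that(2) by (auto simp: dist_norm)
    then have "\<bar>rip g y\<bar> \<le> real k" "\<bar>rip g (y + z)\<bar> \<le> real k"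
      using that(1) by (auto simp: C_def)
    then show ?thesis by (simp add: rip_add_right)
  qed
  have "norm g \<le> 4 * real k / r" if "g \<in> G" for g
  proof (cases "g = 0")
    case False
    have "\<bar>rip g ((r / (2 * norm g)) *\<^sub>R g)\<bar> \<le> 2 * real k"
      using r(1) False by (intro bnd that) (simp add: field_simps)
    then show ?thesis using r(1) False
      by (simp add: rip_scaleR_right rip_self power2_eq_square field_simps abs_mult)
  qed (use r(1) in simp)
  then show ?thesis by blast
qed


section \<open>Positive operators and square roots\<close>

text \<open>The form of \<open>B\<close> is nonnegative at \<open>b z - B z\<close>; expanding this and estimating the form at
  \<open>B z\<close> from above gives the claim. It serves three purposes: \<open>B\<close> has norm at most \<open>b\<close> on \<open>X\<close>,
  \<open>B z = 0\<close> as soon as the form vanishes at \<open>z\<close>, and a lower bound for \<open>norm (B z)\<close> yields a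
  lower bound for the form.\<close>

lemma norm_sq_le_form:
  fixes B :: "'a::chilbert_space \<Rightarrow> 'a"
  assumes X: "subspace X" and BX: "\<And>z. z \<in> X \<Longrightarrow> B z \<in> X" and lin: "linear B"
    and sym: "\<And>x y. rip (B x) y = rip x (B y)"
    and pos: "\<And>z. z \<in> X \<Longrightarrow> 0 \<le> rip z (B z)"
    and bnd: "\<And>z. z \<in> X \<Longrightarrow> rip z (B z) \<le> b * (norm z)\<^sup>2"
    and b: "b > 0" and z: "z \<in> X"
  shows "(norm (B z))\<^sup>2 \<le> b * rip z (B z)"
proof -
  define w where "w = b *\<^sub>R z - B z"
  have "w \<in> X" unfolding w_def by (intro subspace_diff subspace_scale X z BX)
  then have "0 \<le> rip w (B w)" by (rule pos)
  also have "B w = b *\<^sub>R B z - B (B z)"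
    unfolding w_def by (simp add: linear_diff[OF lin] linear_scale[OF lin])
  also have "rip w \<dots> = b * (b * rip z (B z) - 2 * (norm (B z))\<^sup>2) + rip (B z) (B (B z))"
    unfolding w_def by (simp add: rip_simps sym[of z, symmetric] rip_self algebra_simps)
  also have "\<dots> \<le> b * (b * rip z (B z) - 2 * (norm (B z))\<^sup>2) + b * (norm (B z))\<^sup>2"
    using bnd[OF BX[OF z]] by simp
  also have "\<dots> = b * (b * rip z (B z) - (norm (B z))\<^sup>2)"
    by (simp add: algebra_simps)
  finally show ?thesis using b by (simp add: zero_le_mult_iff)
qed

text \<open>With \<open>Z = 1 - C\<close> the fixed point equation \<open>Y = (Z + Y\<^sup>2) / 2\<close> says that \<open>1 - Y\<close> is a square
  root of \<open>C\<close>. Its iteration is dominated by the same iteration for the number \<open>1\<close>.\<close>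

primrec sqrt_iter :: "('a::real_normed_vector \<Rightarrow>\<^sub>L 'a) \<Rightarrow> nat \<Rightarrow> 'a \<Rightarrow>\<^sub>L 'a" where
  "sqrt_iter Z 0 = 0"
| "sqrt_iter Z (Suc n) = (1/2) *\<^sub>R (Z + (sqrt_iter Z n o\<^sub>L sqrt_iter Z n))"

primrec sqrt_majorant :: "nat \<Rightarrow> real" where
  "sqrt_majorant 0 = 0"
| "sqrt_majorant (Suc n) = (1 + (sqrt_majorant n)\<^sup>2) / 2"

lemma sqrt_majorant_bounds: "0 \<le> sqrt_majorant n \<and> sqrt_majorant n \<le> 1"
  by (induction n) (auto simp: power_le_one)

lemma norm_sqrt_iter_le:
  assumes "norm Z \<le> 1"
  shows "norm (sqrt_iter Z n) \<le> sqrt_majorant n"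
proof (induction n)
  case (Suc n)
  have "norm (sqrt_iter Z n o\<^sub>L sqrt_iter Z n) \<le> (sqrt_majorant n)\<^sup>2"
    unfolding power2_eq_square
    by (rule order_trans[OF norm_blinfun_compose]) (intro mult_mono Suc, use sqrt_majorant_bounds in auto)
  then have "norm (Z + (sqrt_iter Z n o\<^sub>L sqrt_iter Z n)) \<le> 1 + (sqrt_majorant n)\<^sup>2"
    using assms norm_triangle_le by (smt (verit) add_mono)
  then show ?case by simp
qed simp

lemma norm_sqrt_iter_step_le:
  assumes "norm Z \<le> 1"
  shows "norm (sqrt_iter Z (Suc n) - sqrt_iter Z n) \<le> sqrt_majorant (Suc n) - sqrt_majorant n"
proof (induction n)
  case 0
  then show ?case using assms by simp
next
  case (Suc n)
  let ?Y = "sqrt_iter Z" and ?y = sqrt_majorant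
  define P Q where "P = ?Y (Suc n)" and "Q = ?Y n"
  define p q where "p = ?y (Suc n)" and "q = ?y n"
  have PQ: "norm (P - Q) \<le> p - q" using Suc by (simp only: P_def Q_def p_def q_def)
  have P: "norm P \<le> p" "norm Q \<le> q" "0 \<le> p" "0 \<le> q"
    unfolding P_def Q_def p_def q_def
    using norm_sqrt_iter_le[OF assms] sqrt_majorant_bounds by blast+
  have "(P o\<^sub>L P) - (Q o\<^sub>L Q) = (P o\<^sub>L (P - Q)) + ((P - Q) o\<^sub>L Q)"
    by (intro blinfun_eqI) (simp add: blinfun.bilinear_simps)
  then have "norm ((P o\<^sub>L P) - (Q o\<^sub>L Q)) \<le> norm (P o\<^sub>L (P - Q)) + norm ((P - Q) o\<^sub>L Q)"
    using norm_triangle_ineq by simp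
  also have "\<dots> \<le> norm P * norm (P - Q) + norm (P - Q) * norm Q"
    by (intro add_mono norm_blinfun_compose)
  also have "\<dots> \<le> p * (p - q) + (p - q) * q"
    by (intro add_mono mult_mono P PQ) (use P order_trans[OF norm_ge_zero PQ] in auto)
  also have "\<dots> = p\<^sup>2 - q\<^sup>2" by (simp add: power2_eq_square algebra_simps)
  finally have "norm ((P o\<^sub>L P) - (Q o\<^sub>L Q)) \<le> p\<^sup>2 - q\<^sup>2" .
  moreover have "?Y (Suc (Suc n)) - ?Y (Suc n) = (1/2) *\<^sub>R ((P o\<^sub>L P) - (Q o\<^sub>L Q))"
    unfolding sqrt_iter.simps(2)[of Z "Suc n"] P_def[symmetric]
    by (simp add: P_def[unfolded sqrt_iter.simps] Q_def[symmetric] flip: scaleR_diff_right)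
  moreover have "?y (Suc (Suc n)) - ?y (Suc n) = (p\<^sup>2 - q\<^sup>2) / 2"
    by (simp add: p_def q_def field_simps)
  ultimately show ?case by simp
qed

lemma norm_sqrt_iter_diff_le:
  assumes "norm Z \<le> 1" "n \<le> m"
  shows "norm (sqrt_iter Z m - sqrt_iter Z n) \<le> sqrt_majorant m - sqrt_majorant n"
  using assms(2)
proof (induction m rule: dec_induct)
  case (step m)
  have "norm (sqrt_iter Z (Suc m) - sqrt_iter Z n) \<le>
      norm (sqrt_iter Z (Suc m) - sqrt_iter Z m) + norm (sqrt_iter Z m - sqrt_iter Z n)"
    by (metis add_diff_eq diff_add_cancel norm_triangle_ineq)
  then show ?case using step norm_sqrt_iter_step_le[OF assms(1), of m] by linarith
qed simp

lemma Cauchy_if_dominated: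
  fixes u :: "nat \<Rightarrow> 'a::real_normed_vector" and f :: "nat \<Rightarrow> 'b::metric_space"
  assumes f: "Cauchy f" and "c > 0"
    and le: "\<And>m n. m \<le> n \<Longrightarrow> c * norm (u n - u m) ^ p \<le> dist (f m) (f n)"
  shows "Cauchy u"
proof (rule metric_CauchyI)
  fix e :: real assume "e > 0"
  then have "c * e ^ p > 0" using \<open>c > 0\<close> by simp
  then obtain M where M: "\<And>m n. m \<ge> M \<Longrightarrow> n \<ge> M \<Longrightarrow> dist (f m) (f n) < c * e ^ p"
    using metric_CauchyD[OF f] by blast
  have less: "dist (u m) (u n) < e" if "m \<ge> M" "m \<le> n" for m n
  proof -
    have "c * norm (u n - u m) ^ p < c * e ^ p" using le[OF that(2)] M[of m n] that by simp
    then show ?thesis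
      using \<open>c > 0\<close> \<open>e > 0\<close> by (simp add: dist_norm norm_minus_commute power_less_imp_less_base)
  qed
  have "dist (u m) (u n) < e" if "m \<ge> M" "n \<ge> M" for m n
    using less[of m n] less[of n m] that by (cases "m \<le> n") (auto simp: dist_commute)
  then show "\<exists>M. \<forall>m\<ge>M. \<forall>n\<ge>M. dist (u m) (u n) < e" by blast
qed

lemma sqrt_iter_convergent:
  fixes Z :: "'a::chilbert_space \<Rightarrow>\<^sub>L 'a"
  assumes "norm Z \<le> 1"
  shows "convergent (sqrt_iter Z)"
proof -
  have "incseq sqrt_majorant"
  proof (rule incseq_SucI)
    show "sqrt_majorant n \<le> sqrt_majorant (Suc n)" for n
      using zero_le_power2[of "sqrt_majorant n - 1"] by (simp add: power2_diff)
  qed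
  then obtain L where L: "sqrt_majorant \<longlonglongrightarrow> L"
    using incseq_convergent sqrt_majorant_bounds by metis
  have "Cauchy (sqrt_iter Z)"
  proof (rule Cauchy_if_dominated[OF LIMSEQ_imp_Cauchy[OF L], of 1 _ 1])
    show "1 * norm (sqrt_iter Z n - sqrt_iter Z m) ^ 1 \<le> dist (sqrt_majorant m) (sqrt_majorant n)"
      if "m \<le> n" for m n
      using norm_sqrt_iter_diff_le[OF assms that] by (simp add: dist_real_def)
  qed simp
  then show ?thesis by (rule Cauchy_convergent)
qed

lemma operator_sqrt_exists:
  fixes Z :: "'a::chilbert_space \<Rightarrow>\<^sub>L 'a"
  assumes "norm Z \<le> 1" and sym: "\<And>x y. rip (Z x) y = rip x (Z y)"
  obtains Y :: "'a \<Rightarrow>\<^sub>L 'a" where "norm Y \<le> 1" "\<And>x. 2 *\<^sub>R Y x = Z x + Y (Y x)"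
    "\<And>x y. rip (Y x) y = rip x (Y y)"
    "\<And>B x. bounded_linear B \<Longrightarrow> (\<And>x. B (Z x) = Z (B x)) \<Longrightarrow> B (Y x) = Y (B x)"
proof -
  obtain Y where Y: "sqrt_iter Z \<longlonglongrightarrow> Y"
    using sqrt_iter_convergent[OF assms(1)] convergent_def by blast
  have Yx: "(\<lambda>n. sqrt_iter Z n x) \<longlonglongrightarrow> Y x" for x
    by (intro blinfun.tendsto Y tendsto_const)
  have "norm Y \<le> 1"
  proof (rule tendsto_upperbound[OF tendsto_norm[OF Y]])
    have "norm (sqrt_iter Z n) \<le> 1" for n
      using norm_sqrt_iter_le[OF assms(1), of n] sqrt_majorant_bounds[of n] by linarith
    then show "\<forall>\<^sub>F n in sequentially. norm (sqrt_iter Z n) \<le> 1" by simp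
  qed simp
  moreover have "2 *\<^sub>R Y x = Z x + Y (Y x)" for x
  proof (rule LIMSEQ_unique)
    show "(\<lambda>n. 2 *\<^sub>R sqrt_iter Z (Suc n) x) \<longlonglongrightarrow> 2 *\<^sub>R Y x"
      by (intro tendsto_intros LIMSEQ_Suc[OF Yx])
    have "(\<lambda>n. Z x + sqrt_iter Z n (sqrt_iter Z n x)) \<longlonglongrightarrow> Z x + Y (Y x)"
      by (intro tendsto_intros blinfun.tendsto Y Yx)
    then show "(\<lambda>n. 2 *\<^sub>R sqrt_iter Z (Suc n) x) \<longlonglongrightarrow> Z x + Y (Y x)"
      by (simp add: blinfun.bilinear_simps)
  qed
  moreover have "rip (Y x) y = rip x (Y y)" for x y
  proof (rule LIMSEQ_unique)
    have eq: "rip (sqrt_iter Z n x) y = rip x (sqrt_iter Z n y)" for n x y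
      by (induction n arbitrary: x y) (auto simp: blinfun.bilinear_simps rip_simps sym)
    show "(\<lambda>n. rip (sqrt_iter Z n x) y) \<longlonglongrightarrow> rip (Y x) y"
      by (intro tendsto_rip_left Yx)
    show "(\<lambda>n. rip (sqrt_iter Z n x) y) \<longlonglongrightarrow> rip x (Y y)"
      unfolding eq by (intro tendsto_rip_right Yx)
  qed
  moreover have "B (Y x) = Y (B x)"
    if B: "bounded_linear B" and comm: "\<And>x. B (Z x) = Z (B x)" for B x
  proof (rule LIMSEQ_unique)
    interpret B: bounded_linear B by (rule B)
    have eq: "B (sqrt_iter Z n x) = sqrt_iter Z n (B x)" for n x
      by (induction n arbitrary: x) (auto simp: blinfun.bilinear_simps B.add B.scaleR B.zero comm)
    show "(\<lambda>n. B (sqrt_iter Z n x)) \<longlonglongrightarrow> B (Y x)"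
      by (intro B.tendsto Yx)
    show "(\<lambda>n. B (sqrt_iter Z n x)) \<longlonglongrightarrow> Y (B x)"
      unfolding eq by (intro Yx)
  qed
  ultimately show ?thesis by (rule that)
qed

text \<open>The last clause gives the spectral projections all the symmetries of the operator. For a
  complex linear \<open>A\<close> it also yields complex linearity, on taking for \<open>B\<close> the multiplication by a
  complex number.\<close>

definition is_abs_op :: "('a::chilbert_space \<Rightarrow>\<^sub>L 'a) \<Rightarrow> ('a \<Rightarrow>\<^sub>L 'a) \<Rightarrow> bool" where
  "is_abs_op A M \<longleftrightarrow> (\<forall>x. M (M x) = A (A x)) \<and> (\<forall>x. 0 \<le> rip x (M x)) \<and>
    (\<forall>x y. rip (M x) y = rip x (M y)) \<and>
    (\<forall>B. bounded_linear B \<longrightarrow> (\<forall>x. B (A x) = A (B x)) \<longrightarrow> (\<forall>x. B (M x) = M (B x)))"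

text \<open>After scaling to norm at most \<open>1\<close>, \<open>A\<^sup>2 = 1 - Z\<close> with a contraction \<open>Z\<close>, and the fixed
  point \<open>Y\<close> for \<open>Z\<close> yields the square root \<open>1 - Y\<close>, positive since \<open>Y\<close> is a contraction.\<close>

lemma abs_operator_exists:
  fixes A :: "'a::chilbert_space \<Rightarrow>\<^sub>L 'a"
  assumes sym: "\<And>x y. rip (A x) y = rip x (A y)"
  shows "\<exists>M. is_abs_op A M"
proof -
  \<comment> \<open>The summand \<open>1\<close> keeps \<open>k\<close> positive for \<open>A = 0\<close>.\<close>
  define k where "k = norm A + 1"
  have k: "k > 0" by (simp add: k_def add_nonneg_pos)
  define G where "G = (1 / k) *\<^sub>R A"
  have G: "norm (G x) \<le> norm x" for x
  proof -
    have "norm (A x) \<le> norm A * norm x" by (rule norm_blinfun)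
    also have "\<dots> \<le> k * norm x" by (simp add: k_def mult_right_mono)
    finally show ?thesis using k by (simp add: G_def blinfun.bilinear_simps field_simps)
  qed
  have Gsym: "rip (G x) y = rip x (G y)" for x y
    by (simp add: G_def blinfun.bilinear_simps rip_simps sym)
  define Z where "Z = id_blinfun - (G o\<^sub>L G)"
  have Zx: "Z x = x - G (G x)" for x by (simp add: Z_def blinfun.bilinear_simps)
  have "norm (Z x) \<le> 1 * norm x" for x
  proof (rule power2_le_imp_le)
    have "rip x (G (G x)) = (norm (G x))\<^sup>2" by (simp add: Gsym[symmetric] rip_self)
    moreover have "(norm (G (G x)))\<^sup>2 \<le> (norm (G x))\<^sup>2" by (rule power_mono[OF G]) simp
    ultimately have "(norm (Z x))\<^sup>2 \<le> (norm x)\<^sup>2"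
      unfolding Zx norm_diff_sq using zero_le_power2[of "norm (G x)"] by linarith
    then show "(norm (Z x))\<^sup>2 \<le> (1 * norm x)\<^sup>2" by simp
  qed simp
  then have "norm Z \<le> 1" by (rule norm_blinfun_bound[rotated]) simp
  moreover have "rip (Z x) y = rip x (Z y)" for x y
    by (simp add: Zx rip_simps Gsym)
  ultimately obtain Y :: "'a \<Rightarrow>\<^sub>L 'a" where Y: "norm Y \<le> 1" "\<And>x. 2 *\<^sub>R Y x = Z x + Y (Y x)"
    "\<And>x y. rip (Y x) y = rip x (Y y)"
    "\<And>B x. bounded_linear B \<Longrightarrow> (\<And>x. B (Z x) = Z (B x)) \<Longrightarrow> B (Y x) = Y (B x)"
    using operator_sqrt_exists[of Z] by metis
  define M where "M = k *\<^sub>R (id_blinfun - Y)"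
  have Mx: "M x = k *\<^sub>R (x - Y x)" for x by (simp add: M_def blinfun.bilinear_simps)
  have "M (M x) = A (A x)" for x
  proof -
    have "M (M x) = (k * k) *\<^sub>R (x - 2 *\<^sub>R Y x + Y (Y x))"
      unfolding Mx by (simp add: blinfun.bilinear_simps algebra_simps scaleR_2)
    also have "x - 2 *\<^sub>R Y x + Y (Y x) = G (G x)" unfolding Y(2) Zx by simp
    also have "(k * k) *\<^sub>R \<dots> = A (A x)" using k by (simp add: G_def blinfun.bilinear_simps)
    finally show ?thesis .
  qed
  moreover have "0 \<le> rip x (M x)" for x
  proof -
    have "rip x (Y x) \<le> norm x * norm (Y x)" by (rule rip_le_norm)
    also have "norm (Y x) \<le> 1 * norm x"
      by (rule order_trans[OF norm_blinfun]) (intro mult_right_mono Y, simp)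
    finally show ?thesis using k
      by (simp add: Mx rip_simps rip_self power2_eq_square mult_left_mono)
  qed
  moreover have "rip (M x) y = rip x (M y)" for x y
    by (simp add: Mx rip_simps Y(3))
  moreover have "B (M x) = M (B x)"
    if B: "bounded_linear B" and comm: "\<forall>x. B (A x) = A (B x)" for B x
  proof -
    interpret B: bounded_linear B by (rule B)
    have "B (G x) = G (B x)" for x
      using comm by (simp add: G_def blinfun.bilinear_simps B.scaleR)
    then have "B (Z x) = Z (B x)" for x by (simp add: Zx B.diff)
    from Y(4)[OF B this] show ?thesis by (simp add: Mx B.diff B.scaleR)
  qed
  ultimately show ?thesis unfolding is_abs_op_def by blast
qed


section \<open>Spectral projections of a bounded selfadjoint operator\<close>

definition abs_op :: "('a::chilbert_space \<Rightarrow>\<^sub>L 'a) \<Rightarrow> 'a \<Rightarrow>\<^sub>L 'a" where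
  "abs_op A = (SOME M. is_abs_op A M)"

text \<open>The spectral subspace of \<open>T\<close> for the half-line up to \<open>l\<close> is where \<open>\<bar>T - l\<bar> = - (T - l)\<close>.\<close>

definition low_space :: "('a::chilbert_space \<Rightarrow>\<^sub>L 'a) \<Rightarrow> real \<Rightarrow> 'a set" where
  "low_space T l = {x. abs_op (T - l *\<^sub>R id_blinfun) x + (T - l *\<^sub>R id_blinfun) x = 0}"

definition spec_proj :: "('a::chilbert_space \<Rightarrow>\<^sub>L 'a) \<Rightarrow> real \<Rightarrow> 'a \<Rightarrow> 'a" where
  "spec_proj T l = rproj (low_space T l)"

locale sa_op =
  fixes T :: "'a::chilbert_space \<Rightarrow>\<^sub>L 'a"
  assumes clinear: "clinear (blinfun_apply T)"
    and selfadjoint: "selfadjoint (blinfun_apply T)"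
begin

lemma sym: "rip (T x) y = rip x (T y)"
  using selfadjoint by (simp add: selfadjoint_def rip_def)

lemma scaleC: "T (a *\<^sub>C x) = a *\<^sub>C T x"
  using clinear by (simp add: clinear_iff)

lemma form_bound: "\<bar>rip x (T x)\<bar> \<le> norm T * (norm x)\<^sup>2"
proof -
  have "\<bar>rip x (T x)\<bar> \<le> norm x * norm (T x)" by (rule abs_rip_le_norm)
  also have "\<dots> \<le> norm x * (norm T * norm x)" by (intro mult_left_mono norm_blinfun) simp
  finally show ?thesis by (simp add: power2_eq_square mult_ac)
qed

lemma
  fixes l :: real
  defines "A \<equiv> T - l *\<^sub>R id_blinfun"
  shows abs_op_sq: "abs_op A (abs_op A x) = A (A x)"
    and abs_op_pos: "0 \<le> rip x (abs_op A x)"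
    and abs_op_sym: "rip (abs_op A x) y = rip x (abs_op A y)"
    and abs_op_commute: "bounded_linear B \<Longrightarrow> (\<And>x. B (T x) = T (B x)) \<Longrightarrow>
      B (abs_op A x) = abs_op A (B x)"
proof -
  have "rip (A x) y = rip x (A y)" for x y
    by (simp add: A_def blinfun.bilinear_simps rip_simps sym)
  from someI_ex[OF abs_operator_exists[OF this], folded abs_op_def]
  have *: "is_abs_op A (abs_op A)" .
  from * show "abs_op A (abs_op A x) = A (A x)" "0 \<le> rip x (abs_op A x)"
    "rip (abs_op A x) y = rip x (abs_op A y)" unfolding is_abs_op_def by blast+
  show "B (abs_op A x) = abs_op A (B x)"
    if B: "bounded_linear B" and comm: "\<And>x. B (T x) = T (B x)"
  proof -
    have "\<forall>x. B (A x) = A (B x)"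
      unfolding A_def by (simp add: blinfun.bilinear_simps comm linear_simps[OF B])
    then show ?thesis using * B unfolding is_abs_op_def by blast
  qed
qed

lemma low_space_invariant:
  assumes B: "bounded_linear B" and comm: "\<And>x. B (T x) = T (B x)" and x: "x \<in> low_space T l"
  shows "B x \<in> low_space T l"
proof -
  let ?A = "T - l *\<^sub>R id_blinfun"
  have "abs_op ?A (B x) + ?A (B x) = B (abs_op ?A x + ?A x)"
    by (simp add: abs_op_commute[OF B comm] linear_simps[OF B] blinfun.bilinear_simps comm)
  also have "\<dots> = 0" using x linear_simps(3)[OF B] by (simp add: low_space_def)
  finally show ?thesis by (simp add: low_space_def)
qed

lemma closed_csubspace_low_space: "closed_csubspace (low_space T l)"
proof
  define f where "f = abs_op (T - l *\<^sub>R id_blinfun) + (T - l *\<^sub>R id_blinfun)"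
  have *: "low_space T l = {x. f x = 0}" by (simp add: low_space_def f_def blinfun.add_left)
  show "closed (low_space T l)"
    unfolding * by (intro closed_Collect_eq blinfun.continuous_on continuous_intros)
  have "a *\<^sub>C x \<in> low_space T l" if "x \<in> low_space T l" for a x
    by (rule low_space_invariant[OF bounded_linear_scaleC _ that]) (simp only: scaleC)
  moreover have "x + y \<in> low_space T l" if "x \<in> low_space T l" "y \<in> low_space T l" for x y
    using that by (simp add: * blinfun.add_right)
  moreover have "0 \<in> low_space T l" by (simp add: * blinfun.zero_right)
  ultimately show "csubspace (low_space T l)"
    unfolding complex_vector.subspace_def by blast
qed

sublocale low: closed_csubspace "low_space T l" for l
  by (rule closed_csubspace_low_space)

lemma spec_proj_mem: "spec_proj T l x \<in> low_space T l"
  unfolding spec_proj_def by (rule low.proj_mem)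

lemma spec_proj_bounded_linear: "bounded_linear (spec_proj T l)"
  unfolding spec_proj_def by (rule low.proj_bounded_linear)

lemmas spec_proj_linear_simps = linear_simps[OF spec_proj_bounded_linear]

lemma spec_proj_scaleC: "spec_proj T l (a *\<^sub>C x) = a *\<^sub>C spec_proj T l x"
  unfolding spec_proj_def by (rule low.proj_scaleC)

lemma spec_proj_sym: "rip (spec_proj T l x) y = rip x (spec_proj T l y)"
  unfolding spec_proj_def by (rule low.proj_sym)

lemma spec_proj_idem [simp]: "spec_proj T l (spec_proj T l x) = spec_proj T l x"
  unfolding spec_proj_def by (rule low.proj_self[OF low.proj_mem])

lemma spec_proj_norm_le: "norm (spec_proj T l x) \<le> norm x"
  unfolding spec_proj_def by (rule low.proj_norm_le)

lemma spec_proj_commute: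
  assumes B: "bounded_linear B" "bounded_linear B'"
    and comm: "\<And>x. B (T x) = T (B x)" "\<And>x. B' (T x) = T (B' x)"
    and adj: "\<And>x y. rip (B x) y = rip x (B' y)"
  shows "spec_proj T l (B x) = B (spec_proj T l x)"
  unfolding spec_proj_def
  by (rule low.proj_commute[where B' = B'])
     (rule linear_simps(2)[OF B(1)] adj low_space_invariant[OF B(1) comm(1)]
        low_space_invariant[OF B(2) comm(2)], assumption?)+

lemma spec_proj_commute_op: "spec_proj T l (T x) = T (spec_proj T l x)"
  by (rule spec_proj_commute) (auto simp: sym blinfun.bounded_linear_right)

lemma spec_proj_range_form:
  assumes "spec_proj T l x = x"
  shows "rip x (T x) \<le> l * (norm x)\<^sup>2"
proof -
  let ?A = "T - l *\<^sub>R id_blinfun"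
  have "x \<in> low_space T l" using assms spec_proj_mem by metis
  then have "abs_op ?A x + ?A x = 0" by (simp add: low_space_def)
  then have "rip x (abs_op ?A x) + rip x (?A x) = 0"
    by (simp only: rip_add_right[symmetric] rip_zero_right)
  then show ?thesis using abs_op_pos[of x l]
    by (simp add: blinfun.bilinear_simps rip_simps rip_self)
qed

text \<open>\<open>(\<bar>A\<bar> + A) (\<bar>A\<bar> - A) = 0\<close>, so \<open>\<bar>A\<bar> - A\<close> maps into \<open>low_space T l\<close> and, being symmetric,
  vanishes on its orthogonal complement.\<close>

lemma spec_proj_kernel_form:
  assumes "spec_proj T l x = 0"
  shows "rip x (T x) \<ge> l * (norm x)\<^sup>2"
proof -
  let ?A = "T - l *\<^sub>R id_blinfun"
  define M where "M = abs_op ?A"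
  have orth: "rip v x = 0" if "v \<in> low_space T l" for v
    using assms that low.proj_eq_zero_iff unfolding spec_proj_def by blast
  have "M x - ?A x = 0"
  proof -
    have Asym: "rip (?A x) y = rip x (?A y)" for x y
      by (simp add: blinfun.bilinear_simps rip_simps sym)
    have "T (M y) = M (T y)" for y
      unfolding M_def by (rule abs_op_commute) (auto simp: blinfun.bounded_linear_right)
    then have comm: "?A (M y) = M (?A y)" for y
      by (simp add: blinfun.bilinear_simps)
    have "M (M y) = ?A (?A y)" for y unfolding M_def by (rule abs_op_sq)
    then have "M (M y - ?A y) + ?A (M y - ?A y) = 0" for y
      by (simp only: blinfun.diff_right comm) simp
    then have "M y - ?A y \<in> low_space T l" for y
      unfolding low_space_def M_def by simp
    then have "rip (M y - ?A y) x = 0" for y by (rule orth)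
    then have "rip y (M x - ?A x) = 0" for y
      using abs_op_sym[of l y x] Asym[of y x] by (simp add: rip_diff_left rip_diff_right M_def)
    from this[of "M x - ?A x"] show ?thesis by (simp add: rip_self)
  qed
  then have "rip x (?A x) = rip x (M x)" by simp
  then show ?thesis using abs_op_pos[of x l]
    by (simp add: M_def blinfun.bilinear_simps rip_simps rip_self)
qed

lemma spec_proj_eigenvector:
  assumes "T x = l *\<^sub>R x"
  shows "spec_proj T l x = x"
proof -
  let ?A = "T - l *\<^sub>R id_blinfun"
  have "?A x = 0" using assms by (simp add: blinfun.bilinear_simps)
  moreover from this have "abs_op ?A (abs_op ?A x) = 0"
    by (simp add: abs_op_sq blinfun.zero_right)
  then have "(norm (abs_op ?A x))\<^sup>2 = 0"
    by (metis abs_op_sym rip_self rip_zero_right)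
  ultimately have "x \<in> low_space T l" by (simp add: low_space_def)
  then show ?thesis unfolding spec_proj_def by (rule low.proj_self)
qed

end


section \<open>Stieltjes integrals of the identity\<close>

lemma (in finite_measure) AE_mem_if_full_measure:
  assumes "S \<in> sets M" "measure M S = measure M (space M)"
  shows "AE x in M. x \<in> S"
proof (rule AE_I)
  show "{x \<in> space M. \<not> x \<in> S} \<subseteq> space M - S" by blast
  show "emeasure M (space M - S) = 0"
    using finite_measure_compl[OF assms(1)] assms(2) by (simp add: emeasure_eq_measure)
  show "space M - S \<in> sets M" using assms(1) by blast
qed

text \<open>A function whose increments are controlled by \<open>(d - c) (F d - F c)\<close> is constant: subdividing
  \<open>[a, b]\<close> into \<open>n\<close> equal parts shows that its increment is \<open>O(1/n)\<close>.\<close>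

lemma constant_if_increments_small:
  fixes G F :: "real \<Rightarrow> real"
  assumes G: "\<And>c d. c \<le> d \<Longrightarrow> \<bar>G d - G c\<bar> \<le> (d - c) * (F d - F c)" and "a \<le> b"
  shows "G a = G b"
proof -
  have bound: "\<bar>G b - G a\<bar> \<le> (b - a) * (F b - F a) * inverse (real (Suc n))" for n
  proof -
    define h where "h = (b - a) / real (Suc n)"
    define p where "p i = a + real i * h" for i
    have h: "h \<ge> 0" using \<open>a \<le> b\<close> by (simp add: h_def)
    have pS: "p (Suc i) - p i = h" for i by (simp add: p_def algebra_simps)
    have ends: "p 0 = a" "p (Suc n) = b" by (simp_all add: p_def h_def)
    have "\<bar>G b - G a\<bar> = \<bar>\<Sum>i<Suc n. G (p (Suc i)) - G (p i)\<bar>"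
      by (subst sum_lessThan_telescope) (simp add: ends)
    also have "\<dots> \<le> (\<Sum>i<Suc n. \<bar>G (p (Suc i)) - G (p i)\<bar>)" by (rule sum_abs)
    also have "\<dots> \<le> (\<Sum>i<Suc n. h * (F (p (Suc i)) - F (p i)))"
    proof (rule sum_mono)
      fix i
      show "\<bar>G (p (Suc i)) - G (p i)\<bar> \<le> h * (F (p (Suc i)) - F (p i))"
        using G[of "p i" "p (Suc i)"] pS[of i] h by simp
    qed
    also have "\<dots> = h * (F b - F a)"
      using sum_lessThan_telescope[of "\<lambda>i. F (p i)" "Suc n"]
      by (simp only: sum_distrib_left[symmetric] ends)
    finally show ?thesis by (simp add: h_def field_simps)
  qed
  have "(\<lambda>n. (b - a) * (F b - F a) * inverse (real (Suc n))) \<longlonglongrightarrow> (b - a) * (F b - F a) * 0"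
    by (intro tendsto_intros LIMSEQ_inverse_real_of_nat)
  then have "\<bar>G b - G a\<bar> \<le> 0"
    by (intro LIMSEQ_le_const[where X = "\<lambda>n. (b - a) * (F b - F a) * inverse (real (Suc n))"])
       (use bound in auto)
  then show ?thesis by simp
qed

locale stieltjes =
  fixes F :: "real \<Rightarrow> real"
  assumes mono: "\<And>c d. c \<le> d \<Longrightarrow> F c \<le> F d"
    and right_cont: "\<And>c. (F \<longlongrightarrow> F c) (at_right c)"
    and integrable_id: "integrable (interval_measure F) (\<lambda>l. l)"
begin

text \<open>The increments of this function on \<open>[c, d]\<close> lie between \<open>c\<close> and \<open>d\<close> times those of \<open>F\<close>. This
  determines it up to a constant (\<open>integral_eqI\<close>), so the integral can be identified without
  Riemann sums.\<close>

definition partial :: "real \<Rightarrow> real" where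
  "partial c = (\<integral>l. indicator {..c} l * l \<partial>interval_measure F)"

lemma measure_Ioc:
  assumes "c \<le> d"
  shows "measure (interval_measure F) {c<..d} = F d - F c"
    and "emeasure (interval_measure F) {c<..d} < \<infinity>"
proof -
  have rc: "continuous (at_right a) F" for a
    using right_cont by (simp add: continuous_within)
  show "measure (interval_measure F) {c<..d} = F d - F c"
    using measure_interval_measure_Ioc[OF assms mono rc] by blast
  have "emeasure (interval_measure F) {c<..d} = F d - F c"
    using emeasure_interval_measure_Ioc[OF assms mono rc] by blast
  then show "emeasure (interval_measure F) {c<..d} < \<infinity>" by simp
qed

lemma integrable_indicator_id:
  "S \<in> sets borel \<Longrightarrow> integrable (interval_measure F) (\<lambda>l. indicator S l * l)"
  using integrable_mult_indicator[OF _ integrable_id, of S] by simp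

lemma partial_increment:
  assumes "c \<le> d"
  shows "c * (F d - F c) \<le> partial d - partial c"
    and "partial d - partial c \<le> d * (F d - F c)"
proof -
  let ?M = "interval_measure F"
  have "partial d - partial c = (\<integral>l. indicator {..d} l * l - indicator {..c} l * l \<partial>?M)"
    unfolding partial_def by (intro Bochner_Integration.integral_diff[symmetric] integrable_indicator_id) auto
  also have "\<dots> = (\<integral>l. indicator {c<..d} l * l \<partial>?M)"
    using assms by (intro Bochner_Integration.integral_cong) (auto simp: indicator_def)
  finally have eq: "partial d - partial c = (\<integral>l. indicator {c<..d} l * l \<partial>?M)" .
  have int: "integrable ?M (\<lambda>l. indicator {c<..d} l * k)" for k :: real
    using measure_Ioc(2)[OF assms] by (intro integrable_mult_left) (simp add: integrable_indicator_iff)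
  have val: "(\<integral>l. indicator {c<..d} l * k \<partial>?M) = k * (F d - F c)" for k :: real
    using measure_Ioc(1)[OF assms] by simp
  show "c * (F d - F c) \<le> partial d - partial c"
    unfolding eq val[symmetric]
    by (intro integral_mono int integrable_indicator_id) (auto simp: indicator_def)
  show "partial d - partial c \<le> d * (F d - F c)"
    unfolding eq val[symmetric]
    by (intro integral_mono int integrable_indicator_id) (auto simp: indicator_def)
qed

lemma partial_at_top: "(\<lambda>n. partial (real n)) \<longlonglongrightarrow> (\<integral>l. l \<partial>interval_measure F)"
  unfolding partial_def
proof (rule integral_dominated_convergence[where w = "\<lambda>l. \<bar>l\<bar>"])
  show "AE l in interval_measure F. (\<lambda>n. indicator {..real n} l * l) \<longlonglongrightarrow> l"
  proof (rule AE_I2)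
    fix l :: real
    have "eventually (\<lambda>n. indicator {..real n} l * l = l) sequentially"
      using eventually_ge_at_top[of "nat \<lceil>l\<rceil>"] by eventually_elim (auto simp: indicator_def; linarith)
    then show "(\<lambda>n. indicator {..real n} l * l) \<longlonglongrightarrow> l" by (rule tendsto_eventually)
  qed
next
  show "integrable (interval_measure F) (\<lambda>l. \<bar>l\<bar>)"
    using integrable_id by (rule integrable_abs)
  show "AE l in interval_measure F. norm (indicator {..real n} l * l) \<le> \<bar>l\<bar>" for n
    by (rule AE_I2) (simp add: indicator_def)
qed (auto intro: borel_measurable_integrable integrable_indicator_id integrable_id)

lemma partial_at_bot: "(\<lambda>n. partial (- real n)) \<longlonglongrightarrow> 0"
proof -
  have "(\<lambda>n. partial (- real n)) \<longlonglongrightarrow> (\<integral>l. 0 \<partial>interval_measure F)"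
    unfolding partial_def
  proof (rule integral_dominated_convergence[where w = "\<lambda>l. \<bar>l\<bar>"])
    show "AE l in interval_measure F. (\<lambda>n. indicator {..- real n} l * l) \<longlonglongrightarrow> 0"
    proof (rule AE_I2)
      fix l :: real
      have "eventually (\<lambda>n. indicator {..- real n} l * l = 0) sequentially"
        using eventually_gt_at_top[of "nat \<lceil>- l\<rceil>"] by eventually_elim (auto simp: indicator_def; linarith)
      then show "(\<lambda>n. indicator {..- real n} l * l) \<longlonglongrightarrow> 0" by (rule tendsto_eventually)
    qed
  next
    show "integrable (interval_measure F) (\<lambda>l. \<bar>l\<bar>)"
      using integrable_id by (rule integrable_abs)
    show "AE l in interval_measure F. norm (indicator {..- real n} l * l) \<le> \<bar>l\<bar>" for n
      by (rule AE_I2) (simp add: indicator_def)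
  qed (auto intro: borel_measurable_integrable integrable_indicator_id integrable_id)
  then show ?thesis by simp
qed

lemma integral_eqI:
  assumes low: "\<And>c d. c \<le> d \<Longrightarrow> c * (F d - F c) \<le> P d - P c"
    and up: "\<And>c d. c \<le> d \<Longrightarrow> P d - P c \<le> d * (F d - F c)"
    and top: "(\<lambda>n. P (real n)) \<longlonglongrightarrow> L" and bot: "(\<lambda>n. P (- real n)) \<longlonglongrightarrow> 0"
  shows "(\<integral>l. l \<partial>interval_measure F) = L"
proof -
  have "P (- real n) - partial (- real n) = P (real n) - partial (real n)" for n
  proof (rule constant_if_increments_small[where F = F and G = "\<lambda>c. P c - partial c"])
    fix c d :: real assume "c \<le> d"
    with low[OF this] up[OF this] partial_increment[OF this]
    show "\<bar>P d - partial d - (P c - partial c)\<bar> \<le> (d - c) * (F d - F c)"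
      by (simp add: abs_le_iff algebra_simps)
  qed simp
  moreover have "(\<lambda>n. P (- real n) - partial (- real n)) \<longlonglongrightarrow> 0 - 0"
    by (intro tendsto_diff bot partial_at_bot)
  moreover have "(\<lambda>n. P (real n) - partial (real n)) \<longlonglongrightarrow> L - (\<integral>l. l \<partial>interval_measure F)"
    by (intro tendsto_diff top partial_at_top)
  ultimately have "L - (\<integral>l. l \<partial>interval_measure F) = 0 - 0"
    by (metis (no_types, lifting) LIMSEQ_unique ext)
  then show ?thesis by simp
qed

end

text \<open>The sum of the two partial integrals has the increments required for the integral with
  respect to \<open>F + G\<close>; the sum of the two measures itself is not formed.\<close>

lemma stieltjes_integral_add:
  assumes "stieltjes F" "stieltjes G" "stieltjes H" "\<And>c. H c = F c + G c"
  shows "(\<integral>l. l \<partial>interval_measure H) =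
    (\<integral>l. l \<partial>interval_measure F) + (\<integral>l. l \<partial>interval_measure G)"
proof (rule stieltjes.integral_eqI[where P = "\<lambda>c. stieltjes.partial F c + stieltjes.partial G c"])
  fix c d :: real assume "c \<le> d"
  note inc = stieltjes.partial_increment[OF assms(1) this] stieltjes.partial_increment[OF assms(2) this]
  show "c * (H d - H c) \<le> stieltjes.partial F d + stieltjes.partial G d -
      (stieltjes.partial F c + stieltjes.partial G c)"
    using inc by (simp add: assms(4) algebra_simps)
  show "stieltjes.partial F d + stieltjes.partial G d -
      (stieltjes.partial F c + stieltjes.partial G c) \<le> d * (H d - H c)"
    using inc by (simp add: assms(4) algebra_simps)
next
  show "(\<lambda>n. stieltjes.partial F (real n) + stieltjes.partial G (real n)) \<longlonglongrightarrow>
    (\<integral>l. l \<partial>interval_measure F) + (\<integral>l. l \<partial>interval_measure G)"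
    by (intro tendsto_add stieltjes.partial_at_top assms)
  show "(\<lambda>n. stieltjes.partial F (- real n) + stieltjes.partial G (- real n)) \<longlonglongrightarrow> 0"
    using tendsto_add[OF stieltjes.partial_at_bot[OF assms(1)] stieltjes.partial_at_bot[OF assms(2)]]
    by simp
qed (rule assms)


section \<open>Splitting a reduced operator at a real number\<close>

context closed_csubspace
begin

lemma eqI_rip:
  assumes "x \<in> V" "y \<in> V" "\<And>v. v \<in> V \<Longrightarrow> rip x v = rip y v"
  shows "x = y"
proof -
  have "rip (x - y) (x - y) = 0"
    using assms(3)[OF diff_mem[OF assms(1,2)]] by (simp add: rip_diff_left)
  then show ?thesis by (simp add: rip_self)
qed

context
  fixes P :: "'a \<Rightarrow> 'a"
  assumes P: "orthogonal_projection_on V P"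
begin

lemma oproj_mem: "x \<in> V \<Longrightarrow> P x \<in> V"
  and oproj_idem: "x \<in> V \<Longrightarrow> P (P x) = P x"
  and oproj_sym: "x \<in> V \<Longrightarrow> y \<in> V \<Longrightarrow> rip (P x) y = rip x (P y)"
  using P by (auto simp: orthogonal_projection_on_def rip_def)


lemma oproj_add: "x \<in> V \<Longrightarrow> y \<in> V \<Longrightarrow> P (x + y) = P x + P y"
  by (rule eqI_rip) (simp_all add: oproj_mem add_mem oproj_sym rip_add_left)

lemma oproj_diff: "x \<in> V \<Longrightarrow> y \<in> V \<Longrightarrow> P (x - y) = P x - P y"
  by (rule eqI_rip) (simp_all add: oproj_mem diff_mem oproj_sym rip_diff_left)

lemma oproj_scaleR: "x \<in> V \<Longrightarrow> P (r *\<^sub>R x) = r *\<^sub>R P x"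
  by (rule eqI_rip) (simp_all add: oproj_mem scaleR_mem oproj_sym rip_scaleR_left)

lemma oproj_zero: "P 0 = 0"
  using oproj_diff[OF zero_mem zero_mem] by simp

lemma oproj_orth: "x \<in> V \<Longrightarrow> rip (P x) (x - P x) = 0"
  by (simp add: oproj_sym diff_mem oproj_mem oproj_diff oproj_idem)

lemma oproj_pythagoras: "x \<in> V \<Longrightarrow> (norm x)\<^sup>2 = (norm (P x))\<^sup>2 + (norm (x - P x))\<^sup>2"
  using norm_add_orthogonal[OF oproj_orth, of x] by simp

lemma oproj_norm_le:
  assumes "x \<in> V"
  shows "norm (P x) \<le> norm x"
  by (rule power2_le_imp_le) (simp_all add: oproj_pythagoras[OF assms])

lemma oproj_compl_norm_le:
  assumes "x \<in> V"
  shows "norm (x - P x) \<le> norm x"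
  by (rule power2_le_imp_le) (simp_all add: oproj_pythagoras[OF assms])

lemma oproj_form: "x \<in> V \<Longrightarrow> rip x (P x) = (norm (P x))\<^sup>2"
  by (simp add: rip_self[symmetric] oproj_sym oproj_mem oproj_idem)

end

end

text \<open>What the members of a spectral family at \<open>l\<close> have in common. If \<open>l\<close> is an eigenvalue,
  these properties leave open on which side the eigenspace lies.\<close>

definition splits_at ::
  "'a::chilbert_space set \<Rightarrow> ('a \<Rightarrow> 'a) \<Rightarrow> real \<Rightarrow> ('a \<Rightarrow> 'a) \<Rightarrow> bool" where
  "splits_at V T l P \<longleftrightarrow> orthogonal_projection_on V P \<and> (\<forall>x\<in>V. P (T x) = T (P x)) \<and>
    (\<forall>x\<in>V. P x = x \<longrightarrow> rip x (T x) \<le> l * (norm x)\<^sup>2) \<and>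
    (\<forall>x\<in>V. P x = 0 \<longrightarrow> rip x (T x) \<ge> l * (norm x)\<^sup>2)"

locale reduced_op = sa_op T + closed_csubspace V
  for T :: "'a::chilbert_space \<Rightarrow>\<^sub>L 'a" and V +
  assumes invariant: "x \<in> V \<Longrightarrow> T x \<in> V"
begin

text \<open>Shift \<open>T\<close> to a positive operator \<open>B\<close> and let \<open>x\<close> be in the range of \<open>P\<close>. The powers of \<open>B\<close>
  grow on \<open>x\<close> at most like those of \<open>l + K\<close>, but on its component in the kernel of \<open>Q\<close> at least
  like those of \<open>m + K\<close>. Hence this component vanishes.\<close>

lemma splits_at_range_mono:
  assumes P: "splits_at V T l P" and Q: "splits_at V T m Q" and "l < m" and x: "x \<in> V" "P x = x"
  shows "Q x = x"
proof -
  have oP: "orthogonal_projection_on V P" and oQ: "orthogonal_projection_on V Q"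
    using P Q by (auto simp: splits_at_def)
  define K where "K = norm T + \<bar>l\<bar> + \<bar>m\<bar> + 1"
  define B where "B z = T z + K *\<^sub>R z" for z
  define b c where "b = l + K" and "c = m + K"
  have b: "b > 0" and bc: "b < c"
    using \<open>l < m\<close> norm_ge_zero[of T] unfolding b_def c_def K_def by linarith+

  have Bform: "rip z (B z) = rip z (T z) + K * (norm z)\<^sup>2" for z
    by (simp add: B_def rip_simps rip_self)
  have linB: "linear B"
    by (rule linearI) (simp_all add: B_def blinfun.bilinear_simps algebra_simps)
  have Bsym: "rip (B y) z = rip y (B z)" for y z
    by (simp add: B_def rip_simps sym)
  have BV: "B z \<in> V" if "z \<in> V" for z
    unfolding B_def by (intro add_mem scaleR_mem invariant that)
  have PB: "P (B z) = B (P z)" and QB: "Q (B z) = B (Q z)" if "z \<in> V" for z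
    using P Q that invariant[OF that] scaleR_mem[OF that] unfolding B_def
    by (simp_all add: oproj_add[OF oP] oproj_add[OF oQ] oproj_scaleR[OF oP] oproj_scaleR[OF oQ]
        splits_at_def)
  define X where "X = {z \<in> V. P z = z}"
  have subX: "subspace X"
    unfolding X_def subspace_def
    by (auto simp: zero_mem add_mem scaleR_mem oproj_zero[OF oP] oproj_add[OF oP] oproj_scaleR[OF oP])
  have BX: "B z \<in> X" if "z \<in> X" for z
    using that BV PB by (auto simp: X_def)
  have growX: "norm (B z) \<le> b * norm z" if z: "z \<in> X" for z
  proof -
    have pos: "0 \<le> rip y (B y)" for y
      unfolding Bform using form_bound[of y] mult_right_mono[of "norm T" K "(norm y)\<^sup>2"]
      by (simp add: K_def abs_le_iff)
    have up: "rip y (B y) \<le> b * (norm y)\<^sup>2" if "y \<in> X" for y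
      using that P unfolding Bform by (simp add: X_def splits_at_def b_def algebra_simps)
    have "(norm (B z))\<^sup>2 \<le> b * rip z (B z)"
      by (rule norm_sq_le_form[OF subX BX linB Bsym pos up b z])
    also have "\<dots> \<le> b * (b * (norm z)\<^sup>2)" using up[OF z] b by simp
    finally have "(norm (B z))\<^sup>2 \<le> (b * norm z)\<^sup>2" by (simp add: power2_eq_square mult_ac)
    then show ?thesis by (rule power2_le_imp_le) (use b in simp)
  qed
  have growK: "c * norm z \<le> norm (B z)" if z: "z \<in> V" "Q z = 0" for z
  proof (cases "z = 0")
    case False
    have "c * (norm z)\<^sup>2 \<le> rip z (B z)"
      using z Q unfolding Bform by (simp add: splits_at_def c_def algebra_simps)
    also have "\<dots> \<le> norm z * norm (B z)" by (rule rip_le_norm)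
    finally show ?thesis using False by (simp add: power2_eq_square mult_ac)
  qed simp
  define u where "u k = (B ^^ k) x - Q ((B ^^ k) x)" for k
  have xX: "(B ^^ k) x \<in> X" for k
    by (induction k) (use x BX in \<open>auto simp: X_def\<close>)
  then have xV: "(B ^^ k) x \<in> V" for k by (auto simp: X_def)
  have up: "norm ((B ^^ k) x) \<le> b ^ k * norm x" for k
  proof (induction k)
    case (Suc k)
    have "norm ((B ^^ Suc k) x) \<le> b * norm ((B ^^ k) x)" using growX[OF xX] by simp
    also have "\<dots> \<le> b * (b ^ k * norm x)" using Suc b by (intro mult_left_mono) auto
    finally show ?case by (simp add: mult_ac)
  qed simp
  have low: "c ^ k * norm (u 0) \<le> norm (u k)" for k
  proof (induction k)
    case (Suc k)
    have uk: "u k \<in> V" "Q (u k) = 0"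
      by (simp_all add: u_def diff_mem xV oproj_mem[OF oQ] oproj_diff[OF oQ] oproj_idem[OF oQ])
    have "c * (c ^ k * norm (u 0)) \<le> c * norm (u k)" using Suc b bc by (intro mult_left_mono) auto
    also have "\<dots> \<le> norm (B (u k))" by (rule growK[OF uk])
    also have "B (u k) = u (Suc k)"
      using xV[of k] by (simp add: u_def QB linear_diff[OF linB])
    finally show ?case by (simp add: mult_ac)
  qed simp
  have ineq: "c ^ k * norm (u 0) \<le> b ^ k * norm x" for k
    using low[of k] oproj_compl_norm_le[OF oQ xV[of k]] up[of k] by (simp add: u_def)
  have "u 0 = 0"
  proof (rule ccontr)
    assume "u 0 \<noteq> 0"
    then have nz: "norm (u 0) > 0" by simp
    have "1 < c / b" using b bc by simp
    then obtain k where "norm x / norm (u 0) < (c / b) ^ k"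
      using real_arch_pow by blast
    then show False using ineq[of k] nz b by (simp add: power_divide field_simps)
  qed
  then show ?thesis by (simp add: u_def)
qed

end


section \<open>The spectral theorem\<close>

context sa_op
begin

lemma reduced_op_UNIV: "reduced_op T UNIV"
  by unfold_locales (auto simp: complex_vector.subspace_UNIV)


lemma orthogonal_projection_on_spec_proj:
  assumes "\<And>x. x \<in> V \<Longrightarrow> spec_proj T l x \<in> V"
  shows "orthogonal_projection_on V (spec_proj T l)"
  unfolding orthogonal_projection_on_def
  using assms low.proj_cinner_sym by (auto simp: spec_proj_def low.proj_self low.proj_mem)

lemma splits_at_spec_proj:
  assumes "\<And>x. x \<in> V \<Longrightarrow> spec_proj T l x \<in> V"
  shows "splits_at V T l (spec_proj T l)"
  using orthogonal_projection_on_spec_proj[OF assms] spec_proj_commute_op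
    spec_proj_range_form spec_proj_kernel_form by (auto simp: splits_at_def)

lemma spec_proj_mono1: "l \<le> m \<Longrightarrow> spec_proj T m (spec_proj T l x) = spec_proj T l x"
  using reduced_op.splits_at_range_mono[OF reduced_op_UNIV splits_at_spec_proj splits_at_spec_proj,
      of l m "spec_proj T l x"] by (cases "l = m") auto

lemma spec_proj_mono2: "l \<le> m \<Longrightarrow> spec_proj T l (spec_proj T m x) = spec_proj T l x"
proof -
  assume lm: "l \<le> m"
  have "rip (spec_proj T l (spec_proj T m x) - spec_proj T l x) y = 0" for y
    by (simp add: rip_diff_left spec_proj_sym spec_proj_mono1[OF lm])
  from this[of "spec_proj T l (spec_proj T m x) - spec_proj T l x"] show ?thesis
    by (simp add: rip_self)
qed

lemma spec_proj_eq_zero: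
  assumes "l < - norm T"
  shows "spec_proj T l x = 0"
proof (rule ccontr)
  assume nz: "spec_proj T l x \<noteq> 0"
  have "- norm T * (norm (spec_proj T l x))\<^sup>2 \<le> l * (norm (spec_proj T l x))\<^sup>2"
    using spec_proj_range_form[of l "spec_proj T l x"] form_bound[of "spec_proj T l x"]
    by (simp add: abs_le_iff)
  moreover have "l * (norm (spec_proj T l x))\<^sup>2 < - norm T * (norm (spec_proj T l x))\<^sup>2"
    using assms nz by (intro mult_strict_right_mono) auto
  ultimately show False by simp
qed

lemma spec_proj_eq_self:
  assumes "l > norm T"
  shows "spec_proj T l x = x"
proof (rule ccontr)
  assume nz: "spec_proj T l x \<noteq> x"
  let ?y = "x - spec_proj T l x"
  have "l * (norm ?y)\<^sup>2 \<le> norm T * (norm ?y)\<^sup>2"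
    using spec_proj_kernel_form[of l ?y] form_bound[of ?y]
    by (simp add: abs_le_iff spec_proj_linear_simps)
  then show False using assms nz by (simp add: mult_le_cancel_right)
qed

text \<open>The range of \<open>spec_proj T l\<close> is the intersection of the ranges for \<open>m > l\<close>: on the difference
  the form of \<open>T - l\<close> vanishes, so \<open>T = l\<close> there, and eigenvectors belong to \<open>low_space T l\<close>.\<close>

lemma spec_proj_inf:
  assumes "\<And>m. m > l \<Longrightarrow> spec_proj T m z = z" and "spec_proj T l z = 0"
  shows "z = 0"
proof -
  define B where "B x = T x - l *\<^sub>R x" for x
  define X where "X = {x. spec_proj T l x = 0}"
  have Bform: "rip x (B x) = rip x (T x) - l * (norm x)\<^sup>2" for x
    by (simp add: B_def rip_simps rip_self)
  have form0: "rip z (B z) = 0"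
  proof -
    have "rip z (T z) \<le> m * (norm z)\<^sup>2" if "m > l" for m
      using spec_proj_range_form assms(1)[OF that] .
    moreover have "((\<lambda>m. m * (norm z)\<^sup>2) \<longlongrightarrow> l * (norm z)\<^sup>2) (at_right l)"
      by (intro tendsto_intros)
    ultimately have "rip z (T z) \<le> l * (norm z)\<^sup>2"
      by (intro tendsto_lowerbound[of _ _ "at_right l"]) (auto simp: eventually_at_filter)
    then show ?thesis using spec_proj_kernel_form[OF assms(2)] by (simp add: Bform)
  qed
  have "(norm (B z))\<^sup>2 \<le> (norm T + \<bar>l\<bar> + 1) * rip z (B z)"
  proof (rule norm_sq_le_form)
    show "subspace X" unfolding X_def subspace_def by (simp add: spec_proj_linear_simps)
    show "B x \<in> X" if "x \<in> X" for x
      using that by (simp add: X_def B_def spec_proj_linear_simps spec_proj_commute_op blinfun.zero_right)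
    show "linear B" by (rule linearI) (simp_all add: B_def blinfun.bilinear_simps algebra_simps)
    show "rip (B x) y = rip x (B y)" for x y by (simp add: B_def rip_simps sym)
    show "0 \<le> rip x (B x)" if "x \<in> X" for x
      using spec_proj_kernel_form[of l x] that by (simp add: X_def Bform)
    show "rip x (B x) \<le> (norm T + \<bar>l\<bar> + 1) * (norm x)\<^sup>2" for x
    proof -
      have "- l * (norm x)\<^sup>2 \<le> \<bar>l\<bar> * (norm x)\<^sup>2" by (intro mult_right_mono) auto
      then show ?thesis
        using abs_le_D1[OF form_bound[of x]] zero_le_power2[of "norm x"]
        unfolding Bform distrib_right by linarith
    qed
    show "norm T + \<bar>l\<bar> + 1 > 0" by (simp add: add_nonneg_pos)
    show "z \<in> X" using assms(2) by (simp add: X_def)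
  qed
  then have "(norm (B z))\<^sup>2 \<le> 0" by (simp only: form0 mult_zero_right)
  then have "T z = l *\<^sub>R z" by (simp add: B_def)
  then show ?thesis using spec_proj_eigenvector assms(2) by metis
qed

text \<open>Along \<open>l + 1 / (k + 1)\<close> the squared norms decrease, so the vectors form a Cauchy sequence,
  whose limit is \<open>spec_proj T l x\<close> by the preceding lemma. Monotonicity carries the
  convergence over to the right-sided limit.\<close>

lemma spec_proj_right_continuous: "((\<lambda>m. spec_proj T m x) \<longlongrightarrow> spec_proj T l x) (at_right l)"
proof -
  define r where "r k = l + inverse (real (Suc k))" for k
  define u where "u k = spec_proj T (r k) x" for k
  have r: "r k > l" for k by (simp add: r_def)
  have rmono: "r j \<le> r i" if "i \<le> j" for i j
    using that by (auto simp: r_def intro!: le_imp_inverse_le)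
  have rlim: "r \<longlonglongrightarrow> l"
    unfolding r_def using tendsto_add[OF tendsto_const LIMSEQ_inverse_real_of_nat, of l] by simp
  have diff: "(norm (u i - u j))\<^sup>2 = (norm (u i))\<^sup>2 - (norm (u j))\<^sup>2" if "i \<le> j" for i j
  proof -
    have "rip (u i) (u j) = (norm (u j))\<^sup>2"
      unfolding u_def rip_self[symmetric]
      by (simp add: spec_proj_sym spec_proj_mono1[OF rmono[OF that]])
    then show ?thesis by (simp add: norm_diff_sq)
  qed
  have "decseq (\<lambda>i. (norm (u i))\<^sup>2)"
    unfolding decseq_def using diff by (metis diff_ge_0_iff_ge zero_le_power2)
  then obtain L where "(\<lambda>i. (norm (u i))\<^sup>2) \<longlonglongrightarrow> L"
    using decseq_convergent[of "\<lambda>i. (norm (u i))\<^sup>2" 0] by auto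
  then have C: "Cauchy (\<lambda>i. (norm (u i))\<^sup>2)" by (rule LIMSEQ_imp_Cauchy)
  have "Cauchy u"
  proof (rule Cauchy_if_dominated[OF C, of 1 _ 2])
    show "1 * (norm (u n - u m))\<^sup>2 \<le> dist ((norm (u m))\<^sup>2) ((norm (u n))\<^sup>2)" if "m \<le> n" for m n
      using diff[OF that] by (simp add: dist_real_def norm_minus_commute)
  qed simp
  then obtain y where y: "u \<longlonglongrightarrow> y" using convergent_eq_Cauchy by blast
  have lim: "(\<lambda>k. spec_proj T m (u k)) \<longlonglongrightarrow> spec_proj T m y" for m
    by (rule bounded_linear.tendsto[OF spec_proj_bounded_linear y])
  have "y - spec_proj T l x = 0"
  proof (rule spec_proj_inf)
    have "spec_proj T l (u k) = spec_proj T l x" for k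
      unfolding u_def using spec_proj_mono2 r less_imp_le by blast
    with lim[of l] have "spec_proj T l y = spec_proj T l x"
      by (simp add: LIMSEQ_const_iff)
    then show "spec_proj T l (y - spec_proj T l x) = 0" by (simp add: spec_proj_linear_simps)
    fix m assume m: "m > l"
    have "eventually (\<lambda>k. r k < m) sequentially" using order_tendstoD(2)[OF rlim m] .
    then have "eventually (\<lambda>k. spec_proj T m (u k) = u k) sequentially"
      by eventually_elim (simp add: u_def spec_proj_mono1)
    then have "(\<lambda>k. spec_proj T m (u k)) \<longlonglongrightarrow> y" using y by (simp cong: tendsto_cong)
    with lim[of m] have "spec_proj T m y = y" by (rule LIMSEQ_unique)
    then show "spec_proj T m (y - spec_proj T l x) = y - spec_proj T l x"
      using m by (simp add: spec_proj_linear_simps spec_proj_mono1)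
  qed
  then have ulim: "u \<longlonglongrightarrow> spec_proj T l x" using y by simp
  show ?thesis
  proof (rule tendstoI)
    fix e :: real assume "e > 0"
    then obtain k where k: "dist (u k) (spec_proj T l x) < e"
      using tendstoD[OF ulim] eventually_happens by (metis (no_types, lifting) sequentially_bot)
    have "eventually (\<lambda>m. m \<in> {l<..<r k}) (at_right l)"
      by (rule eventually_at_right_real[OF r])
    then show "eventually (\<lambda>m. dist (spec_proj T m x) (spec_proj T l x) < e) (at_right l)"
    proof eventually_elim
      case (elim m)
      have "spec_proj T m x - spec_proj T l x = spec_proj T m (u k - spec_proj T l x)"
        using elim by (simp add: u_def spec_proj_linear_simps spec_proj_mono1 spec_proj_mono2)
      then show ?case
        using spec_proj_norm_le[of m "u k - spec_proj T l x"] k by (simp add: dist_norm)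
    qed
  qed
qed

text \<open>The form of \<open>T\<close> at \<open>spec_proj T c x\<close>, as a function of \<open>c\<close>, has increments of the size that
  characterises the integral.\<close>

lemma stieltjes_spec_proj:
  fixes x
  defines "F \<equiv> \<lambda>l. rip x (spec_proj T l x)"
  shows "stieltjes F" and "(\<integral>l. l \<partial>interval_measure F) = rip x (T x)"
proof -
  have Fnorm: "F l = (norm (spec_proj T l x))\<^sup>2" for l
    unfolding F_def rip_self[symmetric] by (simp add: spec_proj_sym)
  have w: "(norm (spec_proj T d x - spec_proj T c x))\<^sup>2 = F d - F c" if "c \<le> d" for c d
  proof -
    have "rip (spec_proj T d x) (spec_proj T c x) = F c"
      by (simp add: F_def spec_proj_sym spec_proj_mono1[OF that])
    then show ?thesis by (simp add: norm_diff_sq Fnorm)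
  qed
  have mono: "F c \<le> F d" if "c \<le> d" for c d
    using w[OF that] by (metis diff_ge_0_iff_ge zero_le_power2)
  have rc: "(F \<longlongrightarrow> F c) (at_right c)" for c
    unfolding F_def by (intro tendsto_rip_right spec_proj_right_continuous)
  define K where "K = norm T + 1"
  have high: "spec_proj T l x = x" if "l \<ge> K" for l
    using that by (intro spec_proj_eq_self) (simp add: K_def)
  have low: "spec_proj T l x = 0" if "l \<le> - K" for l
    using that by (intro spec_proj_eq_zero) (simp add: K_def)
  have bot: "(F \<longlongrightarrow> 0) at_bot"
    by (rule tendsto_eventually) (use eventually_le_at_bot[of "- K"] in eventually_elim, simp add: F_def low)
  have top: "(F \<longlongrightarrow> (norm x)\<^sup>2) at_top"
    by (rule tendsto_eventually)
       (use eventually_ge_at_top[of K] in eventually_elim, simp add: F_def high rip_self)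
  have rc': "continuous (at_right a) F" for a
    using rc by (simp add: continuous_within)
  interpret finite_borel_measure "interval_measure F"
    using finite_borel_measure_interval_measure[OF mono rc' bot top] by simp
  have "AE l in interval_measure F. l \<in> {- K<..K}"
  proof -
    have "measure (interval_measure F) {- K<..K} = F K - F (- K)"
      using measure_interval_measure_Ioc[OF _ mono rc'] by (simp add: K_def)
    also have "\<dots> = measure (interval_measure F) UNIV"
      using interval_measure_UNIV[OF mono rc' bot top]
      by (simp add: F_def high low rip_self measure_def)
    finally show ?thesis by (intro AE_mem_if_full_measure) simp_all
  qed
  then have "integrable (interval_measure F) (\<lambda>l. l)"
    by (intro integrable_const_bound[where B = K]) auto
  then show "stieltjes F" by (intro stieltjes.intro mono rc)
  then interpret stieltjes F .
  define P where "P c = rip (spec_proj T c x) (T (spec_proj T c x))" for c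
  show "(\<integral>l. l \<partial>interval_measure F) = rip x (T x)"
  proof (rule integral_eqI[where P = P])
    fix c d :: real assume cd: "c \<le> d"
    define z where "z = spec_proj T d x - spec_proj T c x"
    have "spec_proj T c z = 0" "spec_proj T d z = z"
      using cd by (simp_all add: z_def spec_proj_linear_simps spec_proj_mono1 spec_proj_mono2)
    note bounds = spec_proj_kernel_form[OF this(1)] spec_proj_range_form[OF this(2)]
    have "rip z (T (spec_proj T c x)) = rip (spec_proj T c z) (T x)"
      by (simp add: spec_proj_sym spec_proj_commute_op)
    then have 0: "rip z (T (spec_proj T c x)) = 0" using \<open>spec_proj T c z = 0\<close> by simp
    have "spec_proj T d x = z + spec_proj T c x" by (simp add: z_def)
    moreover have "rip (spec_proj T c x) (T z) = rip z (T (spec_proj T c x))"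
      by (metis sym rip_commute)
    ultimately have "P d - P c = rip z (T z) + 2 * rip z (T (spec_proj T c x))"
      unfolding P_def by (simp add: blinfun.add_right rip_add_left rip_add_right)
    then have "P d - P c = rip z (T z)" using 0 by simp
    moreover have "(norm z)\<^sup>2 = F d - F c" unfolding z_def by (rule w[OF cd])
    ultimately show "c * (F d - F c) \<le> P d - P c" "P d - P c \<le> d * (F d - F c)"
      using bounds by simp_all
  next
    obtain n0 :: nat where n0: "K \<le> real n0" using real_arch_simple by blast
    have "eventually (\<lambda>n. P (real n) = rip x (T x)) sequentially"
      using eventually_ge_at_top[of n0]
      by eventually_elim (use n0 in \<open>auto simp: P_def high\<close>)
    then show "(\<lambda>n. P (real n)) \<longlonglongrightarrow> rip x (T x)" by (rule tendsto_eventually)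
    have "eventually (\<lambda>n. P (- real n) = 0) sequentially"
      using eventually_ge_at_top[of n0]
      by eventually_elim (use n0 in \<open>auto simp: P_def low\<close>)
    then show "(\<lambda>n. P (- real n)) \<longlonglongrightarrow> 0" by (rule tendsto_eventually)
  qed
qed

end


section \<open>Uniqueness of the spectral family\<close>

context reduced_op
begin

text \<open>An invariant subspace of a selfadjoint operator is reducing, that is, its projection commutes
  with \<open>T\<close> and hence with the spectral projections.\<close>

lemma spec_proj_mem_V:
  assumes "x \<in> V"
  shows "spec_proj T l x \<in> V"
proof -
  have "rproj V (T y) = T (rproj V y)" for y
    by (rule proj_commute[where B' = T]) (auto simp: blinfun.diff_right sym invariant)
  then have "spec_proj T l (rproj V x) = rproj V (spec_proj T l x)"
    by (intro spec_proj_commute[where B' = "rproj V"]) (auto simp: proj_bounded_linear proj_sym)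
  then show ?thesis using assms by (metis proj_mem proj_self)
qed

lemma spectral_family_spec_proj: "spectral_family V T (spec_proj T)"
  unfolding spectral_family_def
proof (intro conjI ballI allI impI)
  show "orthogonal_projection_on V (spec_proj T l)" for l
    by (rule orthogonal_projection_on_spec_proj) (rule spec_proj_mem_V)
  fix x assume "x \<in> V"
  show "spec_proj T l (spec_proj T m x) = spec_proj T l x" "spec_proj T m (spec_proj T l x) = spec_proj T l x"
    if "l \<le> m" for l m
    using spec_proj_mono1[OF that] spec_proj_mono2[OF that] by auto
  show "((\<lambda>m. spec_proj T m x) \<longlongrightarrow> spec_proj T l x) (at_right l)" for l
    by (rule spec_proj_right_continuous)
  show "((\<lambda>m. spec_proj T m x) \<longlongrightarrow> 0) at_bot"
    by (rule tendsto_eventually)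
       (use eventually_gt_at_bot[of "- norm T"] in eventually_elim, simp add: spec_proj_eq_zero)
  show "((\<lambda>m. spec_proj T m x) \<longlongrightarrow> x) at_top"
    by (rule tendsto_eventually)
       (use eventually_gt_at_top[of "norm T"] in eventually_elim, simp add: spec_proj_eq_self)
  interpret stieltjes "\<lambda>l. rip x (spec_proj T l x)" by (rule stieltjes_spec_proj)
  show "integrable (interval_measure (\<lambda>l. Re (cinner x (spec_proj T l x)))) (\<lambda>l. l)"
    using integrable_id by (simp add: rip_def)
  have "cinner x (T x) = complex_of_real (rip x (T x))"
  proof (rule complex_eqI)
    have "cinner x (T x) = cnj (cinner x (T x))"
      using selfadjoint cinner_commute[of x "T x"] by (metis selfadjoint_def)
    then have "Im (cinner x (T x)) = Im (cnj (cinner x (T x)))" by (rule arg_cong)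
    then show "Im (cinner x (T x)) = Im (complex_of_real (rip x (T x)))" by simp
  qed (simp add: rip_def)
  then show "cinner x (T x) = complex_of_real
      (\<integral>l. l \<partial>interval_measure (\<lambda>l. Re (cinner x (spec_proj T l x))))"
    using stieltjes_spec_proj(2)[of x] by (simp add: rip_def)
qed

context
  fixes E :: "real \<Rightarrow> 'a \<Rightarrow> 'a"
  assumes E: "spectral_family V T E"
begin

lemma family_oproj: "orthogonal_projection_on V (E l)"
  using E by (simp add: spectral_family_def)

lemma family_mono: "x \<in> V \<Longrightarrow> l \<le> m \<Longrightarrow> E l (E m x) = E l x \<and> E m (E l x) = E l x"
  using E by (simp add: spectral_family_def)

lemma family_stieltjes:
  fixes x
  assumes x: "x \<in> V"
  defines "F \<equiv> \<lambda>l. rip x (E l x)"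
  shows "stieltjes F" and "(\<integral>l. l \<partial>interval_measure F) = rip x (T x)"
    and "finite_measure (interval_measure F)"
    and "measure (interval_measure F) UNIV = (norm x)\<^sup>2"
    and "measure (interval_measure F) {..l} = F l"
proof -
  have mono: "F l \<le> F m" if "l \<le> m" for l m
  proof -
    have "norm (E l (E m x)) \<le> norm (E m x)"
      by (rule oproj_norm_le[OF family_oproj oproj_mem[OF family_oproj x]])
    then show ?thesis
      unfolding F_def oproj_form[OF family_oproj x] using family_mono[OF x that]
      by (simp add: power_mono)
  qed
  have rc: "(F \<longlongrightarrow> F c) (at_right c)" for c
    unfolding F_def using E x by (intro tendsto_rip_right) (simp add: spectral_family_def)
  have int: "integrable (interval_measure F) (\<lambda>l. l)"
    using E x by (simp add: spectral_family_def F_def rip_def)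
  show "stieltjes F" by (intro stieltjes.intro mono rc int)
  have "cinner x (T x) = complex_of_real (\<integral>l. l \<partial>interval_measure F)"
    using E x by (simp add: spectral_family_def F_def rip_def)
  then show "(\<integral>l. l \<partial>interval_measure F) = rip x (T x)" by (simp add: rip_def)
  have rc': "continuous (at_right a) F" for a
    using rc by (simp add: continuous_within)
  have bot: "(F \<longlongrightarrow> 0) at_bot"
    using tendsto_rip_right[of "\<lambda>m. E m x" 0 at_bot x] E x by (simp add: F_def spectral_family_def)
  have top: "(F \<longlongrightarrow> (norm x)\<^sup>2) at_top"
    using tendsto_rip_right[of "\<lambda>m. E m x" x at_top x] E x
    by (simp add: F_def spectral_family_def rip_self)
  interpret finite_borel_measure "interval_measure F"
    using finite_borel_measure_interval_measure[OF mono rc' bot top] by simp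
  show "finite_measure (interval_measure F)" by unfold_locales
  show "measure (interval_measure F) UNIV = (norm x)\<^sup>2"
    using interval_measure_UNIV[OF mono rc' bot top] by (simp add: measure_def)
  show "measure (interval_measure F) {..l} = F l"
    by (rule measure_interval_measure_Iic[OF mono rc' bot])
qed

lemma family_range_form:
  assumes x: "x \<in> V" and "E l x = x"
  shows "rip x (T x) \<le> l * (norm x)\<^sup>2"
proof -
  define M where "M = interval_measure (\<lambda>l. rip x (E l x))"
  note st = family_stieltjes[OF x, folded M_def]
  interpret finite_measure M by (rule st)
  have [simp]: "sets M = sets borel" "space M = UNIV" by (simp_all add: M_def)
  have "AE s in M. s \<in> {..l}"
    by (rule AE_mem_if_full_measure) (simp_all add: st(4,5) assms(2) rip_self)
  then have "(\<integral>s. s \<partial>M) \<le> (\<integral>s. l \<partial>M)"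
    using stieltjes.integrable_id[OF st(1)] by (intro integral_mono_AE) (auto simp: M_def[symmetric])
  then show ?thesis by (simp add: st(2,4) mult.commute)
qed

lemma family_kernel_form:
  assumes x: "x \<in> V" and "E l x = 0"
  shows "rip x (T x) \<ge> l * (norm x)\<^sup>2"
proof -
  define M where "M = interval_measure (\<lambda>l. rip x (E l x))"
  note st = family_stieltjes[OF x, folded M_def]
  interpret finite_measure M by (rule st)
  have [simp]: "sets M = sets borel" "space M = UNIV" by (simp_all add: M_def)
  have "AE s in M. s \<in> {l<..}"
  proof (rule AE_mem_if_full_measure)
    have "measure M (UNIV - {..l}) = measure M UNIV - measure M {..l}"
      using finite_measure_compl[of "{..l}"] by simp
    then show "measure M {l<..} = measure M (space M)"
      by (simp add: st(5) assms(2) Compl_eq_Diff_UNIV[symmetric] Compl_atMost)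
  qed simp
  then have "(\<integral>s. l \<partial>M) \<le> (\<integral>s. s \<partial>M)"
    using stieltjes.integrable_id[OF st(1)] by (intro integral_mono_AE) (auto simp: M_def[symmetric])
  then show ?thesis by (simp add: st(2,4) mult.commute)
qed

text \<open>If \<open>x\<close> is in the range and \<open>y\<close> in the kernel of \<open>E l\<close>, the distribution function of
  \<open>x + y\<close> is the sum of those of \<open>x\<close> and \<open>y\<close>, hence so is the form of \<open>T\<close>; the mixed
  terms must therefore cancel. This is how \<open>E l\<close> is seen to commute with \<open>T\<close>.\<close>

lemma family_cross_term:
  assumes x: "x \<in> V" "E l x = x" and y: "y \<in> V" "E l y = 0"
  shows "rip x (T y) = 0"
proof -
  have mixed: "rip x (E m y) = 0" for m
  proof (cases "m \<le> l")
    case True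
    then have "E m y = 0"
      using family_mono[OF y(1) True] y(2) oproj_zero[OF family_oproj] by simp
    then show ?thesis by simp
  next
    case False
    then have "E m x = x" using family_mono[OF x(1), of l m] x(2) by simp
    then have "rip x (E m y) = rip (E l x) y"
      using oproj_sym[OF family_oproj x(1) y(1), of m] x(2) by simp
    then show ?thesis using oproj_sym[OF family_oproj x(1) y(1)] y(2) by simp
  qed
  have xy: "x + y \<in> V" by (rule add_mem[OF x(1) y(1)])
  have "rip (x + y) (E m (x + y)) = rip x (E m x) + rip y (E m y)" for m
  proof -
    have "rip y (E m x) = 0"
      using mixed[of m] oproj_sym[OF family_oproj x(1) y(1), of m] by (simp add: rip_commute)
    then show ?thesis
      using mixed[of m] by (simp add: oproj_add[OF family_oproj x(1) y(1)] rip_add_left rip_add_right)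
  qed
  then have "(\<integral>l. l \<partial>interval_measure (\<lambda>m. rip (x + y) (E m (x + y)))) =
      (\<integral>l. l \<partial>interval_measure (\<lambda>m. rip x (E m x))) + (\<integral>l. l \<partial>interval_measure (\<lambda>m. rip y (E m y)))"
    by (intro stieltjes_integral_add family_stieltjes x y xy)
  then have "rip (x + y) (T (x + y)) = rip x (T x) + rip y (T y)"
    by (simp only: family_stieltjes(2)[OF xy] family_stieltjes(2)[OF x(1)] family_stieltjes(2)[OF y(1)])
  moreover have "rip y (T x) = rip x (T y)" by (metis sym rip_commute)
  ultimately show ?thesis by (simp add: blinfun.add_right rip_add_left rip_add_right)
qed

lemma splits_at_family: "splits_at V T l (E l)"
proof -
  have "E l (T x) = T (E l x)" if x: "x \<in> V" for x
  proof -
    let ?P = "E l"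
    define u v where "u = ?P x" and "v = x - ?P x"
    have u: "u \<in> V" "?P u = u" and v: "v \<in> V" "?P v = 0"
      unfolding u_def v_def using x
      by (simp_all add: oproj_mem[OF family_oproj] oproj_idem[OF family_oproj] diff_mem
          oproj_diff[OF family_oproj])
    have Pu: "?P (T u) = T u"
    proof -
      define w where "w = T u - ?P (T u)"
      have Tu: "T u \<in> V" by (rule invariant[OF u(1)])
      have w: "w \<in> V" "?P w = 0"
        unfolding w_def using Tu
        by (simp_all add: oproj_mem[OF family_oproj] oproj_idem[OF family_oproj] diff_mem
            oproj_diff[OF family_oproj])
      have "rip w (T u) = 0"
        using family_cross_term[OF u w] by (metis sym rip_commute)
      moreover have "rip w (?P (T u)) = 0"
        using oproj_sym[OF family_oproj w(1) Tu, of l] w(2) by simp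
      ultimately have "rip w w = 0" by (subst (2) w_def) (simp add: rip_diff_right)
      then show ?thesis by (simp add: rip_self w_def)
    qed
    have Pv: "?P (T v) = 0"
    proof -
      have Tv: "T v \<in> V" by (rule invariant[OF v(1)])
      have w: "?P (T v) \<in> V" "?P (?P (T v)) = ?P (T v)"
        using Tv by (simp_all add: oproj_mem[OF family_oproj] oproj_idem[OF family_oproj])
      have "rip (?P (T v)) (?P (T v)) = rip (?P (T v)) (T v)"
        using oproj_sym[OF family_oproj w(1) Tv, of l] w(2) by simp
      also have "\<dots> = 0" by (rule family_cross_term[OF w v])
      finally show ?thesis by (simp add: rip_self)
    qed
    have "T x = T u + T v" by (simp add: u_def v_def blinfun.diff_right)
    then have "?P (T x) = T u"
      using oproj_add[OF family_oproj invariant[OF u(1)] invariant[OF v(1)]] Pu Pv by simp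
    then show ?thesis by (simp add: u_def)
  qed
  then show ?thesis
    unfolding splits_at_def using family_oproj family_range_form family_kernel_form by blast
qed

end

text \<open>\<open>splits_at_range_mono\<close> places the range of \<open>E l\<close> inside that of \<open>E' m\<close> for every \<open>m > l\<close>, and
  right-continuity lets \<open>m\<close> decrease to \<open>l\<close>.\<close>

lemma family_range_subset:
  assumes E: "spectral_family V T E" and E': "spectral_family V T E'" and x: "x \<in> V"
  shows "E' l (E l x) = E l x"
proof -
  have mem: "E l x \<in> V" by (rule oproj_mem[OF family_oproj[OF E] x])
  have "E' m (E l x) = E l x" if "m > l" for m
    by (rule splits_at_range_mono[OF splits_at_family[OF E] splits_at_family[OF E'] that mem
          oproj_idem[OF family_oproj[OF E] x]])
  then have "eventually (\<lambda>m. E' m (E l x) = E l x) (at_right l)"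
    by (auto simp: eventually_at_filter)
  then have "((\<lambda>m. E' m (E l x)) \<longlongrightarrow> E l x) (at_right l)" by (rule tendsto_eventually)
  moreover have "((\<lambda>m. E' m (E l x)) \<longlongrightarrow> E' l (E l x)) (at_right l)"
    using E' mem by (simp add: spectral_family_def)
  ultimately show ?thesis by (intro tendsto_unique) auto
qed

lemma spectral_family_unique:
  assumes E: "spectral_family V T E" and E': "spectral_family V T E'" and x: "x \<in> V"
  shows "E l x = E' l x"
proof (rule eqI_rip)
  note o = family_oproj[OF E] and o' = family_oproj[OF E']
  show "E l x \<in> V" "E' l x \<in> V" using oproj_mem[OF o x] oproj_mem[OF o' x] .
  fix v assume v: "v \<in> V"
  have "rip (E l x) v = rip (E' l (E l x)) v"
    by (simp add: family_range_subset[OF E E' x])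
  also have "\<dots> = rip x (E l (E' l v))"
    by (simp add: oproj_sym[OF o'] oproj_sym[OF o] oproj_mem[OF o'] oproj_mem[OF o] x v)
  also have "\<dots> = rip (E' l x) v"
    by (simp add: family_range_subset[OF E' E v] oproj_sym[OF o' x v])
  finally show "rip (E l x) v = rip (E' l x) v" .
qed

text \<open>Applying \<open>E l\<close> for some \<open>l < c\<close> to the limit that defines the spectral subspace shows that
  its elements are annihilated by \<open>E l\<close>; no limit is left in the description.\<close>

lemma spectral_subspace_eq:
  assumes "c \<le> d"
  shows "spectral_subspace V T c d =
    {x\<in>V. spec_proj T d x = x \<and> (\<forall>l<c. spec_proj T l x = 0)}" (is "_ = ?D")
proof
  show "spectral_subspace V T c d \<subseteq> ?D"
  proof
    fix x assume "x \<in> spectral_subspace V T c d"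
    then obtain E where x: "x \<in> V" and E: "spectral_family V T E"
      and "((\<lambda>l. E d x - E l x) \<longlongrightarrow> x) (at_left c)"
      by (auto simp: spectral_subspace_def)
    then have lim: "((\<lambda>l. spec_proj T d x - spec_proj T l x) \<longlongrightarrow> x) (at_left c)"
      by (simp add: spectral_family_unique[OF E spectral_family_spec_proj x])
    have zero: "spec_proj T k x = 0" if "k < c" for k
    proof -
      have "((\<lambda>l. spec_proj T k (spec_proj T d x - spec_proj T l x)) \<longlongrightarrow> spec_proj T k x) (at_left c)"
        by (rule bounded_linear.tendsto[OF spec_proj_bounded_linear lim])
      moreover have "eventually (\<lambda>l. spec_proj T k (spec_proj T d x - spec_proj T l x) = 0) (at_left c)"
        using eventually_at_left_real[OF that]
        by eventually_elim (use that assms in \<open>simp add: spec_proj_linear_simps spec_proj_mono2\<close>)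
      then have "((\<lambda>l. spec_proj T k (spec_proj T d x - spec_proj T l x)) \<longlongrightarrow> 0) (at_left c)"
        by (rule tendsto_eventually)
      ultimately show ?thesis by (intro tendsto_unique) auto
    qed
    have "eventually (\<lambda>l. spec_proj T d x - spec_proj T l x = spec_proj T d x) (at_left c)"
      by (simp add: eventually_at_filter zero)
    then have "((\<lambda>l. spec_proj T d x - spec_proj T l x) \<longlongrightarrow> spec_proj T d x) (at_left c)"
      by (rule tendsto_eventually)
    with lim have "spec_proj T d x = x" by (intro tendsto_unique) auto
    with x zero show "x \<in> ?D" by simp
  qed
  show "?D \<subseteq> spectral_subspace V T c d"
  proof
    fix x assume x: "x \<in> ?D"
    then have "eventually (\<lambda>l. spec_proj T d x - spec_proj T l x = x) (at_left c)"
      by (simp add: eventually_at_filter)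
    then have "((\<lambda>l. spec_proj T d x - spec_proj T l x) \<longlongrightarrow> x) (at_left c)"
      by (rule tendsto_eventually)
    then show "x \<in> spectral_subspace V T c d"
      using x spectral_family_spec_proj by (auto simp: spectral_subspace_def)
  qed
qed

end


section \<open>Real points of the resolvent set\<close>

definition bounded_below_at :: "'a::chilbert_space set \<Rightarrow> ('a \<Rightarrow>\<^sub>L 'a) \<Rightarrow> real \<Rightarrow> bool" where
  "bounded_below_at V T c \<longleftrightarrow> (\<exists>\<delta>>0. \<forall>x\<in>V. \<delta> * norm x \<le> norm (T x - c *\<^sub>R x))"

context reduced_op
begin

text \<open>A lower bound makes the range of \<open>T - c\<close> in \<open>V\<close> closed; a vector orthogonal to it is an
  eigenvector for \<open>c\<close>, so it is zero.\<close>

lemma bounded_below_at_imp_surj: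
  assumes \<delta>: "\<delta> > 0" "\<And>x. x \<in> V \<Longrightarrow> \<delta> * norm x \<le> norm (T x - c *\<^sub>R x)" and y: "y \<in> V"
  shows "\<exists>x\<in>V. T x - c *\<^sub>R x = y"
proof -
  define B where "B x = T x - c *\<^sub>R x" for x
  have B_diff: "B (x - z) = B x - B z" for x z
    by (simp add: B_def blinfun.diff_right algebra_simps)
  have B_scaleC: "B (a *\<^sub>C x) = a *\<^sub>C B x" for a x
    by (simp add: B_def scaleC scaleR_scaleC scaleC_scaleC complex_vector.scale_right_diff_distrib mult.commute)
  have B_add: "B (x + z) = B x + B z" for x z
    by (simp add: B_def blinfun.add_right algebra_simps)
  have BV: "B x \<in> V" if "x \<in> V" for x
    unfolding B_def by (intro diff_mem scaleR_mem invariant that)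
  have Bsym: "rip (B x) z = rip x (B z)" for x z
    by (simp add: B_def rip_simps sym)
  have Bcont: "(\<lambda>n. B (u n)) \<longlonglongrightarrow> B l" if "u \<longlonglongrightarrow> l" for u l
    unfolding B_def by (intro tendsto_intros that)
  have "closed (B ` V)"
    unfolding closed_sequential_limits
  proof (intro allI impI, elim conjE)
    fix f l assume "\<forall>n. f n \<in> B ` V" and f: "f \<longlonglongrightarrow> l"
    then have "\<forall>n. \<exists>x. x \<in> V \<and> f n = B x" by blast
    from choice[OF this] obtain g where g: "\<And>n. g n \<in> V" "\<And>n. f n = B (g n)" by blast
    have "Cauchy g"
    proof (rule Cauchy_if_dominated[OF LIMSEQ_imp_Cauchy[OF f] \<delta>(1), of _ 1])
      have "\<delta> * norm (g n - g m) \<le> norm (B (g n - g m))" for m n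
        unfolding B_def by (rule \<delta>(2)[OF diff_mem[OF g(1) g(1)]])
      then show "\<delta> * norm (g n - g m) ^ 1 \<le> dist (f m) (f n)" for m n
        by (simp add: B_diff g(2) dist_norm norm_minus_commute)
    qed
    then obtain k where k: "g \<longlonglongrightarrow> k" using convergent_eq_Cauchy by blast
    have "k \<in> V" using closed_sequentially[OF closed _ k] g(1) by blast
    moreover have "l = B k"
      using LIMSEQ_unique[OF f, of "B k"] Bcont[OF k] by (simp add: g(2)[symmetric])
    ultimately show "l \<in> B ` V" by blast
  qed
  moreover have "csubspace (B ` V)"
    unfolding complex_vector.subspace_def
  proof (intro conjI ballI allI)
    show "0 \<in> B ` V" using zero_mem by (rule rev_image_eqI) (simp add: B_def blinfun.zero_right)
    fix a b c assume "a \<in> B ` V"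
    then obtain x where x: "x \<in> V" "a = B x" by blast
    show "c *\<^sub>C a \<in> B ` V"
      unfolding x(2) B_scaleC[symmetric] by (intro imageI scaleC_mem x)
    assume "b \<in> B ` V"
    then obtain z where z: "z \<in> V" "b = B z" by blast
    show "a + b \<in> B ` V"
      unfolding x(2) z(2) B_add[symmetric] by (intro imageI add_mem x z)
  qed
  ultimately interpret R: closed_csubspace "B ` V" by (intro closed_csubspace.intro)
  define z where "z = y - rproj (B ` V) y"
  obtain x where x: "x \<in> V" "rproj (B ` V) y = B x" using R.proj_mem[of y] by (rule imageE)
  have zV: "z \<in> V"
    unfolding z_def x(2) by (intro diff_mem y BV x(1))
  have "rip (B (B z)) z = 0"
    unfolding z_def by (rule R.proj_orth) (use BV[OF zV] in \<open>simp add: z_def\<close>)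
  then have "rip (B z) (B z) = 0" using Bsym[of "B z" z] by simp
  then have "norm (B z) = 0" by (simp add: rip_self)
  then have "\<delta> * norm z \<le> 0" using \<delta>(2)[OF zV] by (simp only: B_def)
  then have "z = 0" using \<delta>(1) by (simp add: mult_le_0_iff)
  then have "y = rproj (B ` V) y" by (simp add: z_def)
  then have "y \<in> B ` V" using R.proj_mem[of y] by metis
  then show ?thesis by (auto simp: B_def)
qed

text \<open>For real \<open>c\<close> and selfadjoint \<open>T\<close> the lower bound alone is thus enough for a bounded
  inverse, and unlike invertibility it passes to subspaces and to nearby operators at sight.\<close>

lemma not_in_op_spectrum_iff:
  "complex_of_real c \<notin> op_spectrum V T \<longleftrightarrow> bounded_below_at V T c"
proof
  assume "complex_of_real c \<notin> op_spectrum V T"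
  then obtain S K where SK: "\<And>x. x \<in> V \<Longrightarrow> norm (S x) \<le> K * norm x"
      "\<And>x. x \<in> V \<Longrightarrow> S (T x - c *\<^sub>R x) = x"
    unfolding op_spectrum_def by (auto simp: scaleR_scaleC)
  have "1 / max K 1 * norm x \<le> norm (T x - c *\<^sub>R x)" if x: "x \<in> V" for x
  proof -
    have "norm x \<le> K * norm (T x - c *\<^sub>R x)"
      using SK(1)[of "T x - c *\<^sub>R x"] SK(2)[OF x] diff_mem invariant scaleR_mem x by simp
    also have "\<dots> \<le> max K 1 * norm (T x - c *\<^sub>R x)" by (intro mult_right_mono) auto
    finally show ?thesis by (simp add: pos_divide_le_eq mult.commute)
  qed
  then show "bounded_below_at V T c"
    unfolding bounded_below_at_def by (intro exI[of _ "1 / max K 1"]) auto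
next
  assume "bounded_below_at V T c"
  then obtain \<delta> where \<delta>: "\<delta> > 0" "\<And>x. x \<in> V \<Longrightarrow> \<delta> * norm x \<le> norm (T x - c *\<^sub>R x)"
    unfolding bounded_below_at_def by blast
  define S where "S y = (SOME x. x \<in> V \<and> T x - c *\<^sub>R x = y)" for y
  have S: "S y \<in> V" "T (S y) - c *\<^sub>R S y = y" if "y \<in> V" for y
    using someI_ex[of "\<lambda>x. x \<in> V \<and> T x - c *\<^sub>R x = y"] bounded_below_at_imp_surj[OF \<delta> that]
    unfolding S_def by blast+
  have inj: "x = z" if "x \<in> V" "z \<in> V" "T x - c *\<^sub>R x = T z - c *\<^sub>R z" for x z
  proof -
    have "T (x - z) - c *\<^sub>R (x - z) = 0"
      using that(3) by (simp add: blinfun.diff_right algebra_simps)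
    then have "\<delta> * norm (x - z) \<le> 0" using \<delta>(2)[OF diff_mem[OF that(1,2)]] by simp
    then show ?thesis using \<delta>(1) by (simp add: mult_le_0_iff)
  qed
  have "\<forall>x\<in>V. S x \<in> V \<and> norm (S x) \<le> 1 / \<delta> * norm x \<and>
      S (T x - complex_of_real c *\<^sub>C x) = x \<and> T (S x) - complex_of_real c *\<^sub>C S x = x"
  proof (intro ballI conjI)
    fix x assume x: "x \<in> V"
    show "S x \<in> V" "T (S x) - complex_of_real c *\<^sub>C S x = x"
      using S[OF x] by (simp_all flip: scaleR_scaleC)
    have "\<delta> * norm (S x) \<le> norm x" using \<delta>(2)[OF S(1)[OF x]] S(2)[OF x] by simp
    then show "norm (S x) \<le> 1 / \<delta> * norm x" using \<delta>(1) by (simp add: field_simps)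
    have "T x - c *\<^sub>R x \<in> V" by (intro diff_mem scaleR_mem invariant x)
    then show "S (T x - complex_of_real c *\<^sub>C x) = x"
      using inj[OF S(1) x] S(2) by (simp flip: scaleR_scaleC)
  qed
  then show "complex_of_real c \<notin> op_spectrum V T"
    unfolding op_spectrum_def by blast
qed

end


section \<open>Complex dimensions\<close>

text \<open>The image of a basis is independent in a space spanned by finitely many vectors, which bounds
  its size; \<open>D\<close> is not known to be finite-dimensional beforehand.\<close>

lemma cdim_le_if_injective_on:
  fixes f :: "'a::complex_inner \<Rightarrow> 'a"
  assumes f: "clinear f" and D: "csubspace D" and fin: "finite_cdim D'"
    and maps: "\<And>x. x \<in> D \<Longrightarrow> f x \<in> D'" and inj: "\<And>x. x \<in> D \<Longrightarrow> f x = 0 \<Longrightarrow> x = 0"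
  shows "finite_cdim D" and "cdim D \<le> cdim D'"
proof -
  interpret f: Vector_Spaces.linear scaleC scaleC f by (rule f)
  interpret vector_space_pair "scaleC :: complex \<Rightarrow> 'a \<Rightarrow> 'a" "scaleC :: complex \<Rightarrow> 'a \<Rightarrow> 'a"
    by unfold_locales
  obtain C where C: "finite C" "cspan C = D'" using fin by (auto simp: finite_cdim_def)
  obtain C' where C': "C' \<subseteq> D'" "complex_vector.independent C'" "D' \<subseteq> cspan C'" "card C' = cdim D'"
    by (rule complex_vector.basis_exists)
  have finC': "finite C'"
    using complex_vector.independent_span_bound[OF C(1) C'(2)] C'(1) C(2) by simp
  obtain B where B: "B \<subseteq> D" "complex_vector.independent B" "D \<subseteq> cspan B" "card B = cdim D"
    by (rule complex_vector.basis_exists)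
  have span: "cspan B = D"
    using B(1,3) D complex_vector.span_minimal by blast
  have injD: "inj_on f D"
  proof (rule inj_onI)
    fix x y assume xy: "x \<in> D" "y \<in> D" "f x = f y"
    have "x - y \<in> D" by (rule complex_vector.subspace_diff[OF D xy(1,2)])
    moreover have "f (x - y) = 0" using xy(3) by (simp add: f.diff)
    ultimately show "x = y" using inj by fastforce
  qed
  have "complex_vector.independent (f ` B)"
    by (rule linear_independent_injective_image[OF f B(2)]) (simp add: span[unfolded cspan_def] injD)
  moreover have "f ` B \<subseteq> cspan C'" using maps B(1) C'(3) by blast
  ultimately have im: "finite (f ` B)" "card (f ` B) \<le> card C'"
    using complex_vector.independent_span_bound[OF finC'] by blast+
  have injB: "inj_on f B" by (rule inj_on_subset[OF injD B(1)])
  have "finite B" using im(1) injB by (rule finite_imageD)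
  then show "finite_cdim D" using span by (auto simp: finite_cdim_def)
  show "cdim D \<le> cdim D'" using im(2) card_image[OF injB] B(4) C'(4) by simp
qed

lemma finite_cdim_subset:
  assumes "csubspace D" "D \<subseteq> D'" "finite_cdim D'"
  shows "finite_cdim D"
  by (rule cdim_le_if_injective_on(1)[of "\<lambda>x. x", OF _ assms(1,3)])
     (use assms(2) in \<open>auto simp: clinear_iff\<close>)

lemma cdim_direct_sum:
  assumes A: "csubspace A" "finite_cdim A" and B: "csubspace B" "finite_cdim B"
    and disjoint: "\<And>x. x \<in> A \<Longrightarrow> x \<in> B \<Longrightarrow> x = 0"
  shows "cdim {a + b | a b. a \<in> A \<and> b \<in> B} = cdim A + cdim B"
proof -
  have basis: "\<exists>b. finite b \<and> complex_vector.independent b \<and> cspan b = D \<and> card b = cdim D"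
    if D: "csubspace D" "finite_cdim D" for D :: "'a set"
  proof -
    obtain C where C: "finite C" "cspan C = D" using D(2) by (auto simp: finite_cdim_def)
    obtain b where b: "b \<subseteq> D" "complex_vector.independent b" "D \<subseteq> cspan b" "card b = cdim D"
      by (rule complex_vector.basis_exists)
    have "finite b" using complex_vector.independent_span_bound[OF C(1) b(2)] b(1) C(2) by simp
    moreover have "cspan b = D" using b(1,3) D(1) complex_vector.span_minimal by blast
    ultimately show ?thesis using b by blast
  qed
  obtain a where a: "finite a" "complex_vector.independent a" "cspan a = A" "card a = cdim A"
    using basis[OF A] by blast
  obtain b where b: "finite b" "complex_vector.independent b" "cspan b = B" "card b = cdim B"
    using basis[OF B] by blast
  have key: "x \<notin> cspan (p \<union> q - {x})"
    if p: "complex_vector.independent p" and x: "x \<in> p"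
      and pq: "\<And>y. y \<in> cspan p \<Longrightarrow> y \<in> cspan q \<Longrightarrow> y = 0" for x p and q :: "'a set"
  proof
    assume "x \<in> cspan (p \<union> q - {x})"
    then have "x \<in> cspan ((p - {x}) \<union> q)"
      using complex_vector.span_mono[of "p \<union> q - {x}" "(p - {x}) \<union> q"] by blast
    then obtain y z where yz: "x = y + z" "y \<in> cspan (p - {x})" "z \<in> cspan q"
      unfolding complex_vector.span_Un by blast
    have "y \<in> cspan p" using yz(2) complex_vector.span_mono[of "p - {x}" p] by blast
    moreover have "x \<in> cspan p" using x by (rule complex_vector.span_base)
    ultimately have "x - y \<in> cspan p" by (intro complex_vector.span_diff)
    then have "z = 0" using pq yz(1,3) by simp
    then have "x \<in> cspan (p - {x})" using yz(1,2) by simp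
    then show False using p x complex_vector.dependent_def by blast
  qed
  have ab: "y = 0" if "y \<in> cspan a" "y \<in> cspan b" for y
    using that disjoint a(3) b(3) by blast
  have "complex_vector.independent (a \<union> b)"
    unfolding complex_vector.dependent_def
  proof (intro notI, elim bexE)
    fix x assume "x \<in> a \<union> b" and mem: "x \<in> cspan (a \<union> b - {x})"
    then consider "x \<in> a" | "x \<in> b" by blast
    then show False
    proof cases
      case 1 show ?thesis using key[OF a(2) 1 ab] mem by blast
    next
      case 2 show ?thesis using key[OF b(2) 2 ab] mem by (simp add: Un_commute)
    qed
  qed
  moreover have "a \<inter> b = {}"
  proof -
    have "x = 0" if "x \<in> a" "x \<in> b" for x
      using that ab complex_vector.span_base by blast
    moreover have "0 \<notin> a" using a(2) complex_vector.dependent_zero by blast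
    ultimately show ?thesis by blast
  qed
  moreover have "cspan (a \<union> b) = {x + y | x y. x \<in> A \<and> y \<in> B}"
    unfolding complex_vector.span_Un a(3) b(3) ..
  ultimately show ?thesis
    using complex_vector.dim_span_eq_card_independent[of "a \<union> b"] a b
    by (simp add: card_Un_disjoint)
qed

text \<open>The subspaces \<open>S J\<close> on which the projections outside \<open>J\<close> vanish grow from \<open>{0}\<close> to \<open>X\<close>
  by one direct summand at a time.\<close>

lemma cdim_projections:
  fixes Q :: "'i \<Rightarrow> 'a::complex_inner \<Rightarrow> 'a"
  assumes I: "finite I" and X: "csubspace X" "finite_cdim X"
    and Q: "\<And>i. i \<in> I \<Longrightarrow> clinear (Q i)" "\<And>i x. i \<in> I \<Longrightarrow> x \<in> X \<Longrightarrow> Q i x \<in> X"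
    and QQ: "\<And>i j x. i \<in> I \<Longrightarrow> j \<in> I \<Longrightarrow> x \<in> X \<Longrightarrow> Q i (Q j x) = (if i = j then Q j x else 0)"
    and sum: "\<And>x. x \<in> X \<Longrightarrow> (\<Sum>i\<in>I. Q i x) = x"
  shows "cdim X = (\<Sum>i\<in>I. cdim {x\<in>X. Q i x = x})"
proof -
  have Q_add: "Q i (x + y) = Q i x + Q i y" and Q_scaleC: "Q i (a *\<^sub>C x) = a *\<^sub>C Q i x"
    if "i \<in> I" for i x y a
    using Q(1)[OF that] by (simp_all add: clinear_iff)
  have Q_zero: "Q i 0 = 0" if "i \<in> I" for i using Q_scaleC[OF that, of 0 0] by simp
  have Q_diff: "Q i (x - y) = Q i x - Q i y" if "i \<in> I" for i x y
    using Q_add[OF that, of "x - y" y] by (simp add: algebra_simps)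
  define S where "S J = {x\<in>X. \<forall>i\<in>I - J. Q i x = 0}" for J
  define Y where "Y i = {x\<in>X. Q i x = x}" for i
  have subS: "csubspace (S J)" for J
    using X(1) unfolding S_def complex_vector.subspace_def by (auto simp: Q_add Q_scaleC Q_zero)
  have subY: "csubspace (Y i)" if "i \<in> I" for i
    using X(1) that unfolding Y_def complex_vector.subspace_def by (auto simp: Q_add Q_scaleC Q_zero)
  have finS: "finite_cdim (S J)" for J
    by (rule finite_cdim_subset[OF subS _ X(2)]) (auto simp: S_def)
  have finY: "finite_cdim (Y i)" if "i \<in> I" for i
    by (rule finite_cdim_subset[OF subY[OF that] _ X(2)]) (auto simp: Y_def)
  have "cdim (S J) = (\<Sum>i\<in>J. cdim (Y i))" if "J \<subseteq> I" for J
    using finite_subset[OF that I] that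
  proof (induction J rule: finite_induct)
    case empty
    have "x = 0" if "x \<in> S {}" for x
      using that sum[of x] by (simp add: S_def)
    then have "S {} \<subseteq> cspan {}" by auto
    then show ?case using complex_vector.dim_le_card[of "S {}" "{}"] by simp
  next
    case (insert j J)
    have j: "j \<in> I" using insert.prems by simp
    have "S (insert j J) = {a + b | a b. a \<in> Y j \<and> b \<in> S J}"
    proof (intro set_eqI iffI)
      fix x assume x: "x \<in> S (insert j J)"
      have "Q j x \<in> Y j" using x j Q(2) QQ by (simp add: S_def Y_def)
      moreover have "x - Q j x \<in> S J"
        using x j Q(2) QQ insert.prems complex_vector.subspace_diff[OF X(1)]
        by (auto simp: S_def Q_diff)
      moreover have "x = Q j x + (x - Q j x)" by simp
      ultimately show "x \<in> {a + b | a b. a \<in> Y j \<and> b \<in> S J}" by blast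
    next
      fix x assume "x \<in> {a + b | a b. a \<in> Y j \<and> b \<in> S J}"
      then obtain a b where ab: "x = a + b" "a \<in> Y j" "b \<in> S J" by blast
      have "Q i a = 0" if "i \<in> I" "i \<noteq> j" for i
        using QQ[OF that(1) j, of a] that(2) ab(2) by (simp add: Y_def)
      then show "x \<in> S (insert j J)"
        using ab complex_vector.subspace_add[OF X(1)] by (auto simp: S_def Y_def Q_add)
    qed
    moreover have "x = 0" if "x \<in> Y j" "x \<in> S J" for x
      using that j insert.hyps by (simp add: S_def Y_def)
    ultimately have "cdim (S (insert j J)) = cdim (Y j) + cdim (S J)"
      using cdim_direct_sum[OF subY[OF j] finY[OF j] subS finS] by simp
    then show ?case using insert by simp
  qed
  from this[of I] show ?thesis by (simp add: S_def Y_def)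
qed


section \<open>Stability of spectral subspaces\<close>

text \<open>The spectral subspace for the half-open interval from \<open>c\<close>, excluded, to \<open>d\<close>. It has an
  orthogonal projection given by the spectral family without a one-sided limit, and it
  coincides with the spectral subspace for \<open>[c, d]\<close> if \<open>c\<close> is not in the spectrum.\<close>

definition slab :: "'a::chilbert_space set \<Rightarrow> ('a \<Rightarrow>\<^sub>L 'a) \<Rightarrow> real \<Rightarrow> real \<Rightarrow> 'a set" where
  "slab V T c d = {x\<in>V. spec_proj T d x = x \<and> spec_proj T c x = 0}"

context sa_op
begin

lemma norm_le_if_form_between:
  assumes X: "subspace X" "\<And>z. z \<in> X \<Longrightarrow> T z \<in> X" and "r > 0"
    and low: "\<And>z. z \<in> X \<Longrightarrow> (m - r) * (norm z)\<^sup>2 \<le> rip z (T z)"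
    and up: "\<And>z. z \<in> X \<Longrightarrow> rip z (T z) \<le> (m + r) * (norm z)\<^sup>2" and z: "z \<in> X"
  shows "norm (T z - m *\<^sub>R z) \<le> r * norm z"
proof -
  define B where "B x = T x - (m - r) *\<^sub>R x" for x
  have form: "rip x (B x) = rip x (T x) - (m - r) * (norm x)\<^sup>2" for x
    by (simp add: B_def rip_simps rip_self)
  have "(norm (B z))\<^sup>2 \<le> (2 * r) * rip z (B z)"
  proof (rule norm_sq_le_form[OF X(1)])
    show "B x \<in> X" if "x \<in> X" for x
      unfolding B_def by (intro subspace_diff subspace_scale X that)
    show "linear B" by (rule linearI) (simp_all add: B_def blinfun.bilinear_simps algebra_simps)
    show "rip (B x) y = rip x (B y)" for x y by (simp add: B_def rip_simps sym)
    show "0 \<le> rip x (B x)" if "x \<in> X" for x using low[OF that] by (simp add: form)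
    show "rip x (B x) \<le> 2 * r * (norm x)\<^sup>2" if "x \<in> X" for x
      using up[OF that] by (simp add: form algebra_simps)
  qed (use \<open>r > 0\<close> z in auto)
  then have "(norm (B z - r *\<^sub>R z))\<^sup>2 \<le> (r * norm z)\<^sup>2"
    unfolding norm_diff_sq by (simp add: rip_simps power_mult_distrib rip_commute[of "B z" z])
  moreover have "B z - r *\<^sub>R z = T z - m *\<^sub>R z" by (simp add: B_def algebra_simps)
  ultimately have "(norm (T z - m *\<^sub>R z))\<^sup>2 \<le> (r * norm z)\<^sup>2" by simp
  then show ?thesis by (rule power2_le_imp_le) (use \<open>r > 0\<close> in simp)
qed

text \<open>\<open>x = u + v\<close> with a part below \<open>m - r\<close> and a part above \<open>m + r\<close>. On each of them the form of
  \<open>T - m\<close> has a sign, so Cauchy-Schwarz bounds the norm from below, and the images of the two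
  parts are orthogonal.\<close>

lemma norm_ge_if_form_outside:
  assumes "c \<le> d" and split: "spec_proj T d x = spec_proj T c x" and "r \<ge> 0"
    and low: "rip u (T u) \<le> (m - r) * (norm u)\<^sup>2" and u: "u = spec_proj T c x"
    and up: "(m + r) * (norm v)\<^sup>2 \<le> rip v (T v)" and v: "v = x - u"
  shows "r * norm x \<le> norm (T x - m *\<^sub>R x)"
proof -
  define B where "B y = T y - m *\<^sub>R y" for y
  have Pu: "spec_proj T c u = u" by (simp add: u)
  have Pv: "spec_proj T c v = 0" by (simp add: u v spec_proj_linear_simps)
  have "rip (B u) (B v) = rip (spec_proj T c (B u)) (B v)"
    by (simp add: B_def spec_proj_linear_simps spec_proj_commute_op Pu)
  also have "\<dots> = rip (B u) (spec_proj T c (B v))" by (rule spec_proj_sym)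
  also have "\<dots> = 0"
    by (simp add: B_def spec_proj_linear_simps spec_proj_commute_op Pv blinfun.zero_right)
  finally have orthB: "rip (B u) (B v) = 0" .
  have orth: "rip u v = 0" using spec_proj_sym[of c u v] Pu Pv by simp
  have x: "x = u + v" by (simp add: v)
  have Bx: "B x = B u + B v" unfolding x B_def by (simp add: blinfun.add_right algebra_simps)
  have bound: "(r * norm w)\<^sup>2 \<le> (norm (B w))\<^sup>2" if "r * (norm w)\<^sup>2 \<le> \<bar>rip w (B w)\<bar>" for w
  proof (cases "w = 0")
    case False
    have "r * norm w * norm w \<le> norm (B w) * norm w"
      using that abs_rip_le_norm[of w "B w"] by (simp add: power2_eq_square mult_ac)
    then have "r * norm w \<le> norm (B w)" using False by simp
    then show ?thesis using \<open>r \<ge> 0\<close> by (intro power_mono) auto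
  qed simp
  have form: "rip w (B w) = rip w (T w) - m * (norm w)\<^sup>2" for w
    by (simp add: B_def rip_simps rip_self)
  have "(r * norm u)\<^sup>2 \<le> (norm (B u))\<^sup>2"
    using low by (intro bound) (simp add: form algebra_simps)
  moreover have "(r * norm v)\<^sup>2 \<le> (norm (B v))\<^sup>2"
    using up by (intro bound) (simp add: form algebra_simps)
  moreover have "(norm (B x))\<^sup>2 = (norm (B u))\<^sup>2 + (norm (B v))\<^sup>2"
    unfolding Bx by (rule norm_add_orthogonal[OF orthB])
  moreover have "(norm x)\<^sup>2 = (norm u)\<^sup>2 + (norm v)\<^sup>2"
    using norm_add_orthogonal[OF orth] x by simp
  ultimately have "(r * norm x)\<^sup>2 \<le> (norm (B x))\<^sup>2"
    by (simp add: power_mult_distrib distrib_left)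
  then show ?thesis unfolding B_def by (rule power2_le_imp_le) simp
qed

end

context reduced_op
begin

lemma csubspace_slab: "csubspace (slab V T c d)"
  unfolding slab_def complex_vector.subspace_def
  by (auto simp: zero_mem add_mem scaleC_mem spec_proj_linear_simps spec_proj_scaleC)

lemma slab_invariant: "x \<in> slab V T c d \<Longrightarrow> T x \<in> slab V T c d"
  by (simp add: slab_def invariant spec_proj_commute_op blinfun.zero_right)

lemma slab_projection:
  assumes "c \<le> d" "x \<in> V"
  shows "spec_proj T d x - spec_proj T c x \<in> slab V T c d"
  using assms
  by (simp add: slab_def diff_mem spec_proj_mem_V spec_proj_linear_simps spec_proj_mono1 spec_proj_mono2)

lemma slab_norm_le:
  assumes "c < d" "x \<in> slab V T c d"
  shows "norm (T x - ((c + d) / 2) *\<^sub>R x) \<le> (d - c) / 2 * norm x"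
proof (rule norm_le_if_form_between[OF csubspace_imp_subspace[OF csubspace_slab] slab_invariant])
  fix z assume "z \<in> slab V T c d"
  then show "((c + d) / 2 - (d - c) / 2) * (norm z)\<^sup>2 \<le> rip z (T z)"
    "rip z (T z) \<le> ((c + d) / 2 + (d - c) / 2) * (norm z)\<^sup>2"
    using spec_proj_kernel_form[of c z] spec_proj_range_form[of d z]
    by (simp_all add: slab_def field_simps)
qed (use assms in auto)

lemma slab_compl_norm_ge:
  assumes "c < d" "spec_proj T d x = spec_proj T c x"
  shows "(d - c) / 2 * norm x \<le> norm (T x - ((c + d) / 2) *\<^sub>R x)"
proof (rule norm_ge_if_form_outside[OF _ assms(2) _ _ refl _ refl])
  have "spec_proj T d (x - spec_proj T c x) = 0"
    using assms by (simp add: spec_proj_linear_simps spec_proj_mono1)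
  from spec_proj_kernel_form[OF this]
  show "((c + d) / 2 + (d - c) / 2) * (norm (x - spec_proj T c x))\<^sup>2
      \<le> rip (x - spec_proj T c x) (T (x - spec_proj T c x))"
    by (simp add: field_simps)
  show "rip (spec_proj T c x) (T (spec_proj T c x))
      \<le> ((c + d) / 2 - (d - c) / 2) * (norm (spec_proj T c x))\<^sup>2"
    using spec_proj_range_form[of c "spec_proj T c x"] by (simp add: field_simps)
qed (use assms in auto)

text \<open>A lower bound \<open>\<gamma>\<close> for the norm of \<open>T - c\<close> becomes the bound \<open>\<gamma>\<^sup>2 / b\<close> for its form on each of
  the two parts where this form has a sign, by \<open>norm_sq_le_form\<close>.\<close>

lemma form_gap:
  assumes "bounded_below_at V T c"
  obtains \<delta> where "\<delta> > 0"
    "\<And>x. x \<in> V \<Longrightarrow> spec_proj T c x = x \<Longrightarrow> rip x (T x) \<le> (c - \<delta>) * (norm x)\<^sup>2"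
    "\<And>x. x \<in> V \<Longrightarrow> spec_proj T c x = 0 \<Longrightarrow> rip x (T x) \<ge> (c + \<delta>) * (norm x)\<^sup>2"
proof -
  obtain \<gamma> where \<gamma>: "\<gamma> > 0" "\<And>x. x \<in> V \<Longrightarrow> \<gamma> * norm x \<le> norm (T x - c *\<^sub>R x)"
    using assms unfolding bounded_below_at_def by blast
  define b where "b = norm T + \<bar>c\<bar> + 1"
  have b: "b > 0" by (simp add: b_def add_nonneg_pos)
  define \<delta> where "\<delta> = \<gamma>\<^sup>2 / b"
  have bnd: "\<bar>rip x (T x) - c * (norm x)\<^sup>2\<bar> \<le> b * (norm x)\<^sup>2" for x
  proof -
    have "\<bar>rip x (T x) - c * (norm x)\<^sup>2\<bar> \<le> \<bar>rip x (T x)\<bar> + \<bar>c\<bar> * (norm x)\<^sup>2"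
      using abs_triangle_ineq4[of "rip x (T x)" "c * (norm x)\<^sup>2"] by (simp add: abs_mult)
    then show ?thesis
      using form_bound[of x] zero_le_power2[of "norm x"] unfolding b_def distrib_right by linarith
  qed
  \<comment> \<open>Both parts at once: the range of the projection is \<open>k = 1\<close>, \<open>\<sigma> = -1\<close>, and the kernel is
    \<open>k = 0\<close>, \<open>\<sigma> = 1\<close>.\<close>
  have gap: "\<delta> * (norm x)\<^sup>2 \<le> \<sigma> * (rip x (T x) - c * (norm x)\<^sup>2)"
    if x: "x \<in> V" "spec_proj T c x = k *\<^sub>R x" and \<sigma>: "\<bar>\<sigma>\<bar> = 1"
      and pos: "\<And>y. y \<in> V \<Longrightarrow> spec_proj T c y = k *\<^sub>R y \<Longrightarrow>
        0 \<le> \<sigma> * (rip y (T y) - c * (norm y)\<^sup>2)" for x k \<sigma>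
  proof -
    define X where "X = {y\<in>V. spec_proj T c y = k *\<^sub>R y}"
    define B where "B y = \<sigma> *\<^sub>R (T y - c *\<^sub>R y)" for y
    have form: "rip y (B y) = \<sigma> * (rip y (T y) - c * (norm y)\<^sup>2)" for y
      by (simp add: B_def rip_simps rip_self)
    have "(norm (B x))\<^sup>2 \<le> b * rip x (B x)"
    proof (rule norm_sq_le_form)
      show "subspace X"
        unfolding X_def subspace_def
        by (auto simp: zero_mem add_mem scaleR_mem spec_proj_linear_simps algebra_simps)
      show "B y \<in> X" if "y \<in> X" for y
        using that unfolding X_def B_def
        by (simp add: scaleR_mem diff_mem invariant spec_proj_linear_simps spec_proj_commute_op
            blinfun.scaleR_right scaleR_diff_right mult_ac)
      show "linear B" by (rule linearI) (simp_all add: B_def blinfun.bilinear_simps algebra_simps)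
      show "rip (B y) z = rip y (B z)" for y z by (simp add: B_def rip_simps sym)
      show "0 \<le> rip y (B y)" if "y \<in> X" for y
        unfolding form using that by (intro pos) (auto simp: X_def)
      show "rip y (B y) \<le> b * (norm y)\<^sup>2" for y
      proof -
        have "rip y (B y) \<le> \<bar>\<sigma>\<bar> * \<bar>rip y (T y) - c * (norm y)\<^sup>2\<bar>"
          unfolding form abs_mult[symmetric] by (rule abs_ge_self)
        then show ?thesis using bnd[of y] \<sigma> by simp
      qed
      show "x \<in> X" using x by (simp add: X_def)
    qed (rule b)
    moreover have "(\<gamma> * norm x)\<^sup>2 \<le> (norm (B x))\<^sup>2"
      using \<gamma>(2)[OF x(1)] \<gamma>(1) \<sigma> by (intro power_mono) (auto simp: B_def)
    ultimately show ?thesis using b by (simp add: \<delta>_def form power_mult_distrib field_simps)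
  qed
  show ?thesis
  proof
    show "\<delta> > 0" using \<gamma>(1) b by (simp add: \<delta>_def)
    show "rip x (T x) \<le> (c - \<delta>) * (norm x)\<^sup>2" if "x \<in> V" "spec_proj T c x = x" for x
      using gap[of x 1 "-1"] that spec_proj_range_form[of c] by (simp add: algebra_simps)
    show "rip x (T x) \<ge> (c + \<delta>) * (norm x)\<^sup>2" if "x \<in> V" "spec_proj T c x = 0" for x
      using gap[of x 0 1] that spec_proj_kernel_form[of c] by (simp add: algebra_simps)
  qed
qed

text \<open>The component in the range of \<open>spec_proj T c\<close> of a vector annihilated by all \<open>spec_proj T l\<close>
  with \<open>l < c\<close> would live at the point \<open>c\<close> of the spectrum, where there is a gap.\<close>

lemma spectral_subspace_eq_slab:
  assumes gap: "bounded_below_at V T c" and "c < d"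
  shows "spectral_subspace V T c d = slab V T c d"
proof -
  have "spec_proj T c x = 0" if x: "x \<in> V" and zero: "\<And>l. l < c \<Longrightarrow> spec_proj T l x = 0" for x
  proof -
    obtain \<delta> where \<delta>: "\<delta> > 0"
      "\<And>x. x \<in> V \<Longrightarrow> spec_proj T c x = x \<Longrightarrow> rip x (T x) \<le> (c - \<delta>) * (norm x)\<^sup>2"
      using form_gap[OF gap] by metis
    define y where "y = spec_proj T c x"
    have "rip y (T y) \<le> (c - \<delta>) * (norm y)\<^sup>2"
      unfolding y_def by (intro \<delta>(2) spec_proj_mem_V x) simp
    moreover have "rip y (T y) \<ge> (c - \<delta> / 2) * (norm y)\<^sup>2"
      using \<delta>(1) by (intro spec_proj_kernel_form) (simp add: y_def spec_proj_mono2 zero)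
    ultimately have "(c - \<delta> / 2) * (norm y)\<^sup>2 \<le> (c - \<delta>) * (norm y)\<^sup>2" by linarith
    then have "\<delta> / 2 * (norm y)\<^sup>2 \<le> 0" by (simp add: algebra_simps)
    then have "(norm y)\<^sup>2 \<le> 0" using \<delta>(1) by (simp add: mult_le_0_iff)
    then show ?thesis by (simp add: y_def)
  qed
  moreover have "spec_proj T l x = 0" if "spec_proj T c x = 0" "l < c" for l x
    using spec_proj_mono2[of l c x] that by (simp add: spec_proj_linear_simps)
  ultimately show ?thesis
    unfolding spectral_subspace_eq[OF less_imp_le[OF \<open>c < d\<close>]] slab_def by blast
qed

text \<open>Write \<open>m\<close> for the centre and \<open>r\<close> for half the length of \<open>[c, d]\<close>. By the gaps, \<open>T - m\<close> is
  smaller than \<open>r - \<delta>\<close> on the slab and larger than \<open>r + \<delta>\<close> on its complement, while for \<open>T'\<close>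
  these hold with \<open>\<delta> = 0\<close>. So for \<open>T'\<close> close to \<open>T\<close> neither slab meets the complement of the
  other one, and the projections inject each slab into the other.\<close>

lemma slab_dimension_stable:
  assumes gap: "bounded_below_at V T c" "bounded_below_at V T d" and "c < d"
    and fin: "finite_cdim (slab V T c d)"
  obtains \<epsilon> where "\<epsilon> > 0" "\<And>T'. reduced_op T' V \<Longrightarrow> norm (T' - T) < \<epsilon> \<Longrightarrow>
    finite_cdim (slab V T' c d) \<and> cdim (slab V T' c d) = cdim (slab V T c d)"
proof -
  obtain \<delta>1 where \<delta>1: "\<delta>1 > 0"
    "\<And>x. x \<in> V \<Longrightarrow> spec_proj T c x = x \<Longrightarrow> rip x (T x) \<le> (c - \<delta>1) * (norm x)\<^sup>2"
    "\<And>x. x \<in> V \<Longrightarrow> spec_proj T c x = 0 \<Longrightarrow> rip x (T x) \<ge> (c + \<delta>1) * (norm x)\<^sup>2"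
    using form_gap[OF gap(1)] by blast
  obtain \<delta>2 where \<delta>2: "\<delta>2 > 0"
    "\<And>x. x \<in> V \<Longrightarrow> spec_proj T d x = x \<Longrightarrow> rip x (T x) \<le> (d - \<delta>2) * (norm x)\<^sup>2"
    "\<And>x. x \<in> V \<Longrightarrow> spec_proj T d x = 0 \<Longrightarrow> rip x (T x) \<ge> (d + \<delta>2) * (norm x)\<^sup>2"
    using form_gap[OF gap(2)] by blast
  define m r where "m = (c + d) / 2" and "r = (d - c) / 2"
  have cd: "c = m - r" "d = m + r" by (simp_all add: m_def r_def field_simps)
  have r: "r > 0" using \<open>c < d\<close> by (simp add: r_def)
  define \<delta> where "\<delta> = min (r / 2) (min \<delta>1 \<delta>2)"
  have \<delta>: "\<delta> > 0" "\<delta> < r" "\<delta> \<le> \<delta>1" "\<delta> \<le> \<delta>2"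
    using r \<delta>1(1) \<delta>2(1) by (auto simp: \<delta>_def)
  have weaken: "k * (norm x)\<^sup>2 \<le> k' * (norm x)\<^sup>2" if "k \<le> k'" for k k' and x :: 'a
    using that by (intro mult_right_mono) auto
  have inside: "norm (T x - m *\<^sub>R x) \<le> (r - \<delta>) * norm x" if "x \<in> slab V T c d" for x
  proof (rule norm_le_if_form_between[OF csubspace_imp_subspace[OF csubspace_slab] slab_invariant _ _ _ that])
    fix z assume z: "z \<in> slab V T c d"
    have "spec_proj T c z = 0" "spec_proj T d z = z" "z \<in> V" using z by (auto simp: slab_def)
    then show "(m - (r - \<delta>)) * (norm z)\<^sup>2 \<le> rip z (T z)"
      "rip z (T z) \<le> (m + (r - \<delta>)) * (norm z)\<^sup>2"
      using \<delta>1(3)[of z] \<delta>2(2)[of z] weaken[of "m - (r - \<delta>)" "c + \<delta>1" z]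
        weaken[of "d - \<delta>2" "m + (r - \<delta>)" z] \<delta> cd by linarith+
  qed (use \<delta> in auto)
  have outside: "(r + \<delta>) * norm x \<le> norm (T x - m *\<^sub>R x)"
    if x: "x \<in> V" "spec_proj T d x = spec_proj T c x" for x
  proof (rule norm_ge_if_form_outside[OF less_imp_le[OF \<open>c < d\<close>] x(2) _ _ refl _ refl])
    let ?u = "spec_proj T c x"
    have u: "?u \<in> V" "spec_proj T c ?u = ?u" by (simp_all add: spec_proj_mem_V x(1))
    show "rip ?u (T ?u) \<le> (m - (r + \<delta>)) * (norm ?u)\<^sup>2"
      using \<delta>1(2)[OF u] weaken[of "c - \<delta>1" "m - (r + \<delta>)" ?u] \<delta> cd by linarith
    have v: "x - ?u \<in> V" "spec_proj T d (x - ?u) = 0"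
      using \<open>c < d\<close> x u(1) by (simp_all add: diff_mem spec_proj_linear_simps spec_proj_mono1)
    show "(m + (r + \<delta>)) * (norm (x - ?u))\<^sup>2 \<le> rip (x - ?u) (T (x - ?u))"
      using \<delta>2(3)[OF v] weaken[of "m + (r + \<delta>)" "d + \<delta>2" "x - ?u"] \<delta> cd by linarith
  qed (use \<delta> r in simp)
  have "finite_cdim (slab V T' c d) \<and> cdim (slab V T' c d) = cdim (slab V T c d)"
    if red: "reduced_op T' V" and near: "norm (T' - T) < \<delta>" for T'
  proof -
    interpret T': reduced_op T' V by (rule red)
    have diff: "norm (T' x - T x) \<le> norm (T' - T) * norm x" for x
      using norm_blinfun[of "T' - T" x] by (simp add: blinfun.diff_left)
    have strict: "x = 0" if "\<delta> * norm x \<le> norm (T' x - T x)" for x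
    proof (rule ccontr)
      assume "x \<noteq> 0"
      then have "norm (T' - T) * norm x < \<delta> * norm x" using near by simp
      then show False using diff[of x] that by linarith
    qed
    have tri: "norm (T x - m *\<^sub>R x) \<le> norm (T' x - m *\<^sub>R x) + norm (T' x - T x)"
      "norm (T' x - m *\<^sub>R x) \<le> norm (T x - m *\<^sub>R x) + norm (T' x - T x)" for x
      using norm_triangle_ineq4[of "T' x - m *\<^sub>R x" "T' x - T x"]
        norm_triangle_ineq[of "T x - m *\<^sub>R x" "T' x - T x"] by (simp_all add: algebra_simps)
    have lin: "clinear (\<lambda>x. spec_proj T d x - spec_proj T c x)"
      "clinear (\<lambda>x. spec_proj T' d x - spec_proj T' c x)"
      unfolding clinear_iff
      by (simp_all add: spec_proj_linear_simps spec_proj_scaleC T'.spec_proj_linear_simps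
          T'.spec_proj_scaleC complex_vector.scale_right_diff_distrib)
    have 1: "finite_cdim (slab V T' c d) \<and> cdim (slab V T' c d) \<le> cdim (slab V T c d)"
    proof (intro conjI cdim_le_if_injective_on[OF lin(1) T'.csubspace_slab fin])
      fix x assume x: "x \<in> slab V T' c d"
      then have xV: "x \<in> V" by (simp add: slab_def)
      show "spec_proj T d x - spec_proj T c x \<in> slab V T c d"
        "spec_proj T d x - spec_proj T c x \<in> slab V T c d"
        using slab_projection[OF _ xV] \<open>c < d\<close> by auto
      assume "spec_proj T d x - spec_proj T c x = 0"
      then have "(r + \<delta>) * norm x \<le> norm (T x - m *\<^sub>R x)" by (intro outside xV) simp
      moreover have "norm (T' x - m *\<^sub>R x) \<le> r * norm x"
        using T'.slab_norm_le[OF \<open>c < d\<close> x] by (simp add: m_def r_def)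
      ultimately show "x = 0" "x = 0"
        using tri(1)[of x] by (intro strict, simp add: algebra_simps)+
    qed
    then have fin': "finite_cdim (slab V T' c d)" ..
    have "cdim (slab V T c d) \<le> cdim (slab V T' c d)"
    proof (rule cdim_le_if_injective_on(2)[OF lin(2) csubspace_slab fin'])
      fix x assume x: "x \<in> slab V T c d"
      then have xV: "x \<in> V" by (simp add: slab_def)
      show "spec_proj T' d x - spec_proj T' c x \<in> slab V T' c d"
        using T'.slab_projection[OF _ xV] \<open>c < d\<close> by simp
      assume "spec_proj T' d x - spec_proj T' c x = 0"
      then have "r * norm x \<le> norm (T' x - m *\<^sub>R x)"
        using T'.slab_compl_norm_ge[OF \<open>c < d\<close>, of x] by (simp add: m_def r_def)
      then show "x = 0"
        using tri(2)[of x] inside[OF x] by (intro strict) (simp add: algebra_simps)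
    qed
    with 1 show ?thesis by simp
  qed
  then show ?thesis using that \<delta>(1) by blast
qed

end

lemma bounded_below_at_stable:
  assumes "bounded_below_at V T c"
  obtains \<epsilon> where "\<epsilon> > 0" "\<And>T'. norm (T' - T) < \<epsilon> \<Longrightarrow> bounded_below_at V T' c"
proof -
  obtain \<delta> where \<delta>: "\<delta> > 0" "\<And>x. x \<in> V \<Longrightarrow> \<delta> * norm x \<le> norm (T x - c *\<^sub>R x)"
    using assms unfolding bounded_below_at_def by blast
  have "bounded_below_at V T' c" if "norm (T' - T) < \<delta> / 2" for T'
    unfolding bounded_below_at_def
  proof (intro exI[of _ "\<delta> / 2"] conjI ballI)
    fix x assume x: "x \<in> V"
    have "norm (T' x - T x) \<le> norm (T' - T) * norm x"
      using norm_blinfun[of "T' - T" x] by (simp add: blinfun.diff_left)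
    also have "\<dots> \<le> \<delta> / 2 * norm x" using that by (intro mult_right_mono) auto
    finally have "norm (T' x - T x) \<le> \<delta> / 2 * norm x" .
    moreover have "norm (T x - c *\<^sub>R x) \<le> norm (T' x - c *\<^sub>R x) + norm (T' x - T x)"
      using norm_triangle_ineq4[of "T' x - c *\<^sub>R x" "T' x - T x"] by simp
    ultimately show "\<delta> / 2 * norm x \<le> norm (T' x - c *\<^sub>R x)"
      using \<delta>(2)[OF x] by linarith
  qed (use \<delta>(1) in simp)
  then show ?thesis using that[of "\<delta> / 2"] \<delta>(1) by simp
qed


section \<open>The spectral gap of a Fredholm operator\<close>

lemma Fsa_imp_sa_op: "T \<in> Fsa \<Longrightarrow> sa_op T"
  by (intro sa_op.intro) (simp_all add: Fsa_def)

lemma Fsa_range: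
  assumes "T \<in> Fsa"
  shows "closed_csubspace (range (blinfun_apply T))"
    and "T (y - rproj (range (blinfun_apply T)) y) = 0"
proof -
  interpret sa_op T by (rule Fsa_imp_sa_op[OF assms])
  define R where "R = range (blinfun_apply T)"
  have "closed R" using assms by (simp add: Fsa_def fredholm_def R_def)
  moreover have "csubspace R"
    unfolding R_def complex_vector.subspace_def
    by (auto simp: image_iff blinfun.add_right[symmetric] scaleC[symmetric])
       (metis blinfun.zero_right)
  ultimately interpret R: closed_csubspace R by (intro closed_csubspace.intro)
  show "closed_csubspace (range (blinfun_apply T))"
    unfolding R_def[symmetric] by (rule R.closed_csubspace_axioms)
  have "T (y - rproj R y) = 0"
  proof -
    have "rip (T (T (y - rproj R y))) (y - rproj R y) = 0"
      by (rule R.proj_orth) (simp add: R_def)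
    then have "rip (T (y - rproj R y)) (T (y - rproj R y)) = 0"
      using sym[of "T (y - rproj R y)" "y - rproj R y"] by simp
    then show ?thesis by (simp add: rip_self)
  qed
  then show "T (y - rproj (range (blinfun_apply T)) y) = 0" by (simp add: R_def)
qed

text \<open>The space is the orthogonal sum of the closed range of \<open>T\<close> and its kernel. For \<open>y = T z + y0\<close>
  with \<open>T y0 = 0\<close> and \<open>u\<close> in the range, \<open>rip u y = rip (T u) z\<close>; so the vectors \<open>u\<close> with
  \<open>norm (T u) \<le> 1\<close> are bounded by the principle of uniform boundedness.\<close>

lemma Fsa_bounded_below_on_range:
  assumes "T \<in> Fsa"
  obtains \<delta> where "\<delta> > 0" "\<And>u. u \<in> range (blinfun_apply T) \<Longrightarrow> \<delta> * norm u \<le> norm (T u)"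
proof -
  interpret sa_op T by (rule Fsa_imp_sa_op[OF assms])
  define R where "R = range (blinfun_apply T)"
  interpret R: closed_csubspace R unfolding R_def by (rule Fsa_range[OF assms])
  have ker: "T (y - rproj R y) = 0" for y unfolding R_def by (rule Fsa_range[OF assms])
  define G where "G = {u\<in>R. norm (T u) \<le> 1}"
  have "\<exists>M. \<forall>g\<in>G. norm g \<le> M"
  proof (rule pointwise_bounded_imp_bounded)
    fix y
    obtain z where z: "rproj R y = T z" using R.proj_mem[of y] by (auto simp: R_def)
    have "\<bar>rip g y\<bar> \<le> norm z" if g: "g \<in> G" for g
    proof -
      have "rip g (y - rproj R y) = 0" using g by (intro R.proj_orth) (simp add: G_def)
      then have "rip g y = rip g (T z)" by (simp add: rip_diff_right z)
      also have "\<dots> = rip (T g) z" by (simp add: sym)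
      finally have "\<bar>rip g y\<bar> \<le> norm (T g) * norm z" using abs_rip_le_norm by simp
      also have "\<dots> \<le> 1 * norm z" using g by (intro mult_right_mono) (auto simp: G_def)
      finally show ?thesis by simp
    qed
    then show "\<exists>K. \<forall>g\<in>G. \<bar>rip g y\<bar> \<le> K" by blast
  qed
  then obtain M where M: "\<And>g. g \<in> G \<Longrightarrow> norm g \<le> M" by blast
  define K where "K = \<bar>M\<bar> + 1"
  have K: "K > 0" "\<And>g. g \<in> G \<Longrightarrow> norm g \<le> K" using M by (fastforce simp: K_def)+
  have "norm u \<le> K * norm (T u)" if u: "u \<in> R" for u
  proof (cases "T u = 0")
    case False
    have "(1 / norm (T u)) *\<^sub>R u \<in> G"
      using False u by (simp add: G_def R.scaleR_mem blinfun.scaleR_right)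
    from K(2)[OF this] show ?thesis using False by (simp add: field_simps)
  next
    case True
    have "u = 0"
    proof (rule ccontr)
      assume nz: "u \<noteq> 0"
      have "((K + 1) / norm u) *\<^sub>R u \<in> G"
        using True u by (simp add: G_def R.scaleR_mem blinfun.scaleR_right)
      from K(2)[OF this] show False using nz K(1) by simp
    qed
    then show ?thesis by (simp add: blinfun.zero_right)
  qed
  then have "1 / K * norm u \<le> norm (T u)" if "u \<in> R" for u
    using that K(1) by (simp add: field_simps)
  then show ?thesis using that[of "1 / K"] K(1) by (simp add: R_def)
qed

text \<open>On the kernel of \<open>T\<close> the operator \<open>T - a\<close> is multiplication by \<open>-a\<close>, on the range it is bounded
  below by \<open>\<delta> - \<bar>a\<bar>\<close>. A vector \<open>x\<close> of the spectral subspace for \<open>[-a, a]\<close> has an image that is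
  contracted too strongly to be a nonzero element of the range, so \<open>T x = 0\<close>.\<close>

lemma Fsa_gap:
  assumes "T \<in> Fsa"
  obtains a where "a > 0" "bounded_below_at UNIV T a" "bounded_below_at UNIV T (- a)"
    "finite_cdim (slab UNIV T (- a) a)"
proof -
  obtain \<delta> where \<delta>: "\<delta> > 0" "\<And>u. u \<in> range (blinfun_apply T) \<Longrightarrow> \<delta> * norm u \<le> norm (T u)"
    using Fsa_bounded_below_on_range[OF assms] by blast
  interpret sa_op T by (rule Fsa_imp_sa_op[OF assms])
  interpret U: reduced_op T UNIV by (rule reduced_op_UNIV)
  define R where "R = range (blinfun_apply T)"
  interpret R: closed_csubspace R unfolding R_def by (rule Fsa_range[OF assms])
  have ker: "T (y - rproj R y) = 0" for y unfolding R_def by (rule Fsa_range[OF assms])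
  have gap: "bounded_below_at UNIV T a" if a: "a \<noteq> 0" "\<bar>a\<bar> < \<delta>" for a
    unfolding bounded_below_at_def
  proof (intro exI[of _ "min \<bar>a\<bar> (\<delta> - \<bar>a\<bar>)"] conjI ballI)
    let ?\<mu> = "min \<bar>a\<bar> (\<delta> - \<bar>a\<bar>)"
    show "?\<mu> > 0" using a by simp
    fix x
    define p q where "p = x - rproj R x" and "q = rproj R x"
    have q: "q \<in> R" unfolding q_def by (rule R.proj_mem)
    have Tp: "T p = 0" unfolding p_def by (rule ker)
    have x: "x = p + q" by (simp add: p_def q_def)
    have w: "T q - a *\<^sub>R q \<in> R" by (intro R.diff_mem R.scaleR_mem q) (simp add: R_def)
    have 1: "rip p q = 0" using R.proj_orth[OF q, of x] by (simp add: p_def rip_commute)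
    have 2: "rip (- a *\<^sub>R p) (T q - a *\<^sub>R q) = 0"
      using R.proj_orth[OF w, of x] by (simp add: p_def[symmetric] rip_simps rip_commute[of p])
    have "T x - a *\<^sub>R x = - a *\<^sub>R p + (T q - a *\<^sub>R q)"
      by (simp add: x blinfun.add_right Tp algebra_simps)
    then have "(norm (T x - a *\<^sub>R x))\<^sup>2 = (\<bar>a\<bar> * norm p)\<^sup>2 + (norm (T q - a *\<^sub>R q))\<^sup>2"
      using norm_add_orthogonal[OF 2] by simp
    moreover have "(?\<mu> * norm p)\<^sup>2 \<le> (\<bar>a\<bar> * norm p)\<^sup>2"
      using a by (intro power_mono mult_right_mono) auto
    moreover have "(?\<mu> * norm q)\<^sup>2 \<le> (norm (T q - a *\<^sub>R q))\<^sup>2"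
    proof (intro power_mono)
      have "?\<mu> * norm q \<le> (\<delta> - \<bar>a\<bar>) * norm q" by (intro mult_right_mono) auto
      also have "\<dots> \<le> norm (T q) - norm (a *\<^sub>R q)"
        using \<delta>(2)[of q] q by (simp add: R_def left_diff_distrib)
      also have "\<dots> \<le> norm (T q - a *\<^sub>R q)" by (rule norm_triangle_ineq2)
      finally show "?\<mu> * norm q \<le> norm (T q - a *\<^sub>R q)" .
    qed (use a in simp)
    moreover have "(?\<mu> * norm x)\<^sup>2 = (?\<mu> * norm p)\<^sup>2 + (?\<mu> * norm q)\<^sup>2"
      unfolding x power_mult_distrib norm_add_orthogonal[OF 1] by (simp add: distrib_left)
    ultimately have "(?\<mu> * norm x)\<^sup>2 \<le> (norm (T x - a *\<^sub>R x))\<^sup>2" by linarith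
    then show "?\<mu> * norm x \<le> norm (T x - a *\<^sub>R x)" by (rule power2_le_imp_le) simp
  qed
  define a where "a = \<delta> / 2"
  have a: "a > 0" "a < \<delta>" using \<delta>(1) by (simp_all add: a_def)
  have "slab UNIV T (- a) a \<subseteq> {x. T x = 0}"
  proof
    fix x assume x: "x \<in> slab UNIV T (- a) a"
    have "T x \<in> slab UNIV T (- a) a" by (rule U.slab_invariant[OF x])
    then have "norm (T (T x)) \<le> a * norm (T x)"
      using U.slab_norm_le[of "- a" a "T x"] a(1) by simp
    moreover have "\<delta> * norm (T x) \<le> norm (T (T x))" by (rule \<delta>(2)) simp
    ultimately have "(\<delta> - a) * norm (T x) \<le> 0" by (simp add: left_diff_distrib)
    then show "x \<in> {x. T x = 0}" using a(2) by (simp add: mult_le_0_iff)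
  qed
  moreover have "finite_cdim {x. T x = 0}" using assms by (simp add: Fsa_def fredholm_def)
  ultimately have "finite_cdim (slab UNIV T (- a) a)"
    by (rule finite_cdim_subset[OF U.csubspace_slab])
  then show ?thesis using that[of a] gap[of a] gap[of "- a"] a by simp
qed


section \<open>The spectral flow is well defined\<close>

text \<open>The condition on a spectral bound in the definition of the spectral flow, in terms of lower
  bounds instead of the spectrum (\<open>admissible_iff\<close>).\<close>

definition admissible :: "'a::chilbert_space set \<Rightarrow> ('a \<Rightarrow>\<^sub>L 'a) \<Rightarrow> real \<Rightarrow> bool" where
  "admissible V T w \<longleftrightarrow> w > 0 \<and> bounded_below_at V T w \<and> bounded_below_at V T (- w) \<and>
    finite_cdim (slab V T (- w) w)"

context reduced_op
begin

lemma admissible_iff: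
  assumes "w > 0"
  shows "admissible V T w \<longleftrightarrow> complex_of_real w \<notin> op_spectrum V T \<and>
    complex_of_real (- w) \<notin> op_spectrum V T \<and> finite_cdim (spectral_subspace V T (- w) w)"
  using assms not_in_op_spectrum_iff spectral_subspace_eq_slab[of "- w" w]
  by (auto simp: admissible_def simp del: of_real_minus)

lemma slab_subset: "c \<le> c' \<Longrightarrow> d' \<le> d \<Longrightarrow> slab V T c' d' \<subseteq> slab V T c d"
proof
  fix x assume "c \<le> c'" "d' \<le> d" "x \<in> slab V T c' d'"
  then show "x \<in> slab V T c d"
    using spec_proj_mono2[of c c' x] spec_proj_mono1[of d' d x]
    by (simp add: slab_def spec_proj_linear_simps)
qed

lemma csubspace_spectral_subspace:
  assumes "c \<le> d"
  shows "csubspace (spectral_subspace V T c d)"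
  unfolding spectral_subspace_eq[OF assms] complex_vector.subspace_def
  by (auto simp: zero_mem add_mem scaleC_mem spec_proj_linear_simps spec_proj_scaleC)

lemma finite_cdim_low:
  assumes "admissible V T w"
  shows "finite_cdim (spectral_subspace V T 0 w)"
proof (rule finite_cdim_subset)
  show "finite_cdim (slab V T (- w) w)" "csubspace (spectral_subspace V T 0 w)"
    using assms csubspace_spectral_subspace by (auto simp: admissible_def)
  show "spectral_subspace V T 0 w \<subseteq> slab V T (- w) w"
    using assms by (subst spectral_subspace_eq) (auto simp: admissible_def slab_def)
qed

lemma cdim_low_increment:
  assumes w: "admissible V T w" and w': "admissible V T w'" and less: "w < w'"
  shows "cdim (spectral_subspace V T 0 w') = cdim (spectral_subspace V T 0 w) + cdim (slab V T w w')"
    and "finite_cdim (slab V T w w')"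
proof -
  have pos: "0 < w" "0 < w'" using w w' by (auto simp: admissible_def)
  show fin: "finite_cdim (slab V T w w')"
    by (rule finite_cdim_subset[OF csubspace_slab slab_subset[of "- w'" w w' w']])
       (use w' pos in \<open>auto simp: admissible_def\<close>)
  note low = spectral_subspace_eq[OF less_imp_le[OF pos(1)]] spectral_subspace_eq[OF less_imp_le[OF pos(2)]]
  have "spectral_subspace V T 0 w' =
      {a + b | a b. a \<in> spectral_subspace V T 0 w \<and> b \<in> slab V T w w'}"
  proof (intro set_eqI iffI)
    fix x assume x: "x \<in> spectral_subspace V T 0 w'"
    have "spec_proj T w x \<in> spectral_subspace V T 0 w"
      using x pos by (simp add: low spec_proj_mem_V spec_proj_mono2)
    moreover have "x - spec_proj T w x \<in> slab V T w w'"
      using x pos less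
      by (simp add: low slab_def diff_mem spec_proj_mem_V spec_proj_linear_simps spec_proj_mono1)
    moreover have "x = spec_proj T w x + (x - spec_proj T w x)" by simp
    ultimately show "x \<in> {a + b | a b. a \<in> spectral_subspace V T 0 w \<and> b \<in> slab V T w w'}" by blast
  next
    fix x assume "x \<in> {a + b | a b. a \<in> spectral_subspace V T 0 w \<and> b \<in> slab V T w w'}"
    then obtain a b where ab: "x = a + b" "a \<in> spectral_subspace V T 0 w" "b \<in> slab V T w w'"
      by blast
    have a: "a \<in> V" "spec_proj T w a = a" "\<And>l. l < 0 \<Longrightarrow> spec_proj T l a = 0"
      using ab(2) by (auto simp: low)
    have b: "b \<in> V" "spec_proj T w' b = b" "spec_proj T w b = 0"
      using ab(3) by (auto simp: slab_def)
    have "spec_proj T w' a = a" using spec_proj_mono1[of w w' a] a(2) less by simp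
    moreover have "spec_proj T l b = 0" if "l < 0" for l
      using spec_proj_mono2[of l w b] b(3) that pos by (simp add: spec_proj_linear_simps)
    ultimately show "x \<in> spectral_subspace V T 0 w'"
      using a b by (simp add: low ab(1) add_mem spec_proj_linear_simps)
  qed
  moreover have "x = 0" if "x \<in> spectral_subspace V T 0 w" "x \<in> slab V T w w'" for x
    using that by (simp add: low slab_def)
  ultimately show "cdim (spectral_subspace V T 0 w') =
      cdim (spectral_subspace V T 0 w) + cdim (slab V T w w')"
    using cdim_direct_sum[OF csubspace_spectral_subspace finite_cdim_low[OF w] csubspace_slab fin] pos
    by simp
qed

lemma admissible_stable:
  assumes "admissible V T w"
  obtains \<epsilon> where "\<epsilon> > 0" "\<And>T'. reduced_op T' V \<Longrightarrow> norm (T' - T) < \<epsilon> \<Longrightarrow> admissible V T' w"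
proof -
  have w: "w > 0" "bounded_below_at V T w" "bounded_below_at V T (- w)"
    "finite_cdim (slab V T (- w) w)" "- w < w"
    using assms by (auto simp: admissible_def)
  obtain \<epsilon>1 where 1: "\<epsilon>1 > 0" "\<And>T'. norm (T' - T) < \<epsilon>1 \<Longrightarrow> bounded_below_at V T' w"
    using bounded_below_at_stable[OF w(2)] by metis
  obtain \<epsilon>2 where 2: "\<epsilon>2 > 0" "\<And>T'. norm (T' - T) < \<epsilon>2 \<Longrightarrow> bounded_below_at V T' (- w)"
    using bounded_below_at_stable[OF w(3)] by metis
  obtain \<epsilon>3 where 3: "\<epsilon>3 > 0" "\<And>T'. reduced_op T' V \<Longrightarrow> norm (T' - T) < \<epsilon>3 \<Longrightarrow>
      finite_cdim (slab V T' (- w) w)"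
    using slab_dimension_stable[OF w(3,2,5,4)] by metis
  show ?thesis
    by (rule that[of "min \<epsilon>1 (min \<epsilon>2 \<epsilon>3)"]) (use 1 2 3 w(1) in \<open>auto simp: admissible_def\<close>)
qed

end

locale op_path = closed_csubspace V for V :: "'a::chilbert_space set" +
  fixes A :: "real \<Rightarrow> 'a \<Rightarrow>\<^sub>L 'a" and a b :: real
  assumes less: "a < b"
    and reduced: "s \<in> {a..b} \<Longrightarrow> reduced_op (A s) V"
    and continuous: "continuous_on {a..b} A"
begin

abbreviation low_dim :: "real \<Rightarrow> real \<Rightarrow> int" where
  "low_dim w s \<equiv> int (cdim (spectral_subspace V (A s) 0 w))"

lemma eventually_near:
  assumes "s \<in> {p..q}" "{p..q} \<subseteq> {a..b}" "\<epsilon> > 0"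
  shows "eventually (\<lambda>x. x \<in> {p..q} \<and> norm (A x - A s) < \<epsilon>) (at s within {p..q})"
proof -
  have "continuous_on {p..q} A" using continuous assms(2) by (rule continuous_on_subset)
  then have "(A \<longlongrightarrow> A s) (at s within {p..q})" using assms(1) by (simp add: continuous_on_def)
  from tendstoD[OF this assms(3)]
  have "eventually (\<lambda>x. norm (A x - A s) < \<epsilon>) (at s within {p..q})" by (simp add: dist_norm)
  moreover have "eventually (\<lambda>x. x \<in> {p..q}) (at s within {p..q})"
    by (simp add: eventually_at_filter)
  ultimately show ?thesis by (rule eventually_conj[rotated])
qed

lemma slab_dim_constant:
  assumes sub: "{p..q} \<subseteq> {a..b}" and "p \<le> q" and "c < d"
    and gap: "\<And>s. s \<in> {p..q} \<Longrightarrow> bounded_below_at V (A s) c"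
      "\<And>s. s \<in> {p..q} \<Longrightarrow> bounded_below_at V (A s) d"
    and fin: "\<And>s. s \<in> {p..q} \<Longrightarrow> finite_cdim (slab V (A s) c d)"
  shows "cdim (slab V (A p) c d) = cdim (slab V (A q) c d)"
proof (rule connected_local_const[of "{p..q}"])
  show "\<forall>s\<in>{p..q}. \<forall>\<^sub>F x in at s within {p..q}. cdim (slab V (A s) c d) = cdim (slab V (A x) c d)"
  proof
    fix s assume s: "s \<in> {p..q}"
    obtain \<epsilon> where "\<epsilon> > 0" and \<epsilon>: "\<And>T'. reduced_op T' V \<Longrightarrow> norm (T' - A s) < \<epsilon> \<Longrightarrow>
        finite_cdim (slab V T' c d) \<and> cdim (slab V T' c d) = cdim (slab V (A s) c d)"
      using reduced_op.slab_dimension_stable[OF reduced gap(1)[OF s] gap(2)[OF s] \<open>c < d\<close> fin[OF s]]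
        s sub by blast
    from eventually_near[OF s sub \<open>\<epsilon> > 0\<close>]
    show "\<forall>\<^sub>F x in at s within {p..q}. cdim (slab V (A s) c d) = cdim (slab V (A x) c d)"
    proof eventually_elim
      case (elim x)
      then show ?case using \<epsilon>[of "A x"] reduced sub by auto
    qed
  qed
qed (use \<open>p \<le> q\<close> in auto)

text \<open>The two dimensions differ by that of the spectral subspace between the two widths, whose end
  points stay in gaps, so that the difference is constant.\<close>

lemma low_dim_change_independent:
  assumes sub: "{p..q} \<subseteq> {a..b}" and "p \<le> q"
    and w: "\<And>s. s \<in> {p..q} \<Longrightarrow> admissible V (A s) w"
    and w': "\<And>s. s \<in> {p..q} \<Longrightarrow> admissible V (A s) w'"
  shows "low_dim w q - low_dim w p = low_dim w' q - low_dim w' p"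
proof -
  have *: "low_dim v q - low_dim v p = low_dim v' q - low_dim v' p"
    if v: "\<And>s. s \<in> {p..q} \<Longrightarrow> admissible V (A s) v"
      and v': "\<And>s. s \<in> {p..q} \<Longrightarrow> admissible V (A s) v'" and "v < v'" for v v'
  proof -
    have red: "reduced_op (A s) V" if "s \<in> {p..q}" for s using that sub reduced by blast
    have inc: "low_dim v' s = low_dim v s + int (cdim (slab V (A s) v v'))"
      "finite_cdim (slab V (A s) v v')" if "s \<in> {p..q}" for s
      using reduced_op.cdim_low_increment[OF red[OF that] v[OF that] v'[OF that] \<open>v < v'\<close>] by simp_all
    have "cdim (slab V (A p) v v') = cdim (slab V (A q) v v')"
      using v v' inc(2) by (intro slab_dim_constant sub \<open>p \<le> q\<close> \<open>v < v'\<close>) (auto simp: admissible_def)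
    then show ?thesis using inc(1)[of p] inc(1)[of q] \<open>p \<le> q\<close> by simp
  qed
  consider "w < w'" | "w = w'" | "w' < w" by linarith
  then show ?thesis
  proof cases
    case 1 then show ?thesis using *[OF w w'] by simp
  next
    case 3 then show ?thesis using *[OF w' w] by simp
  qed simp
qed

lemma partition_mono:
  fixes t :: "nat \<Rightarrow> real"
  assumes "\<forall>i\<in>{1..N}. t (i - 1) < t i" "i \<le> j" "j \<le> N"
  shows "t i \<le> t j"
  using assms(2,3)
proof (induction j rule: dec_induct)
  case (step j)
  have "t j < t (Suc j)" using assms(1) step.prems by (metis Suc_eq_plus1 atLeastAtMost_iff
    add_diff_cancel_right' le_add2)
  then show ?case using step by simp
qed simp

text \<open>The dimension of the spectral subspace for \<open>[-w, w]\<close> is automatically constant along each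
  piece of a partition, because it is locally constant.\<close>

lemma sf_partition_iff:
  "sf_partition V (\<lambda>s. blinfun_apply (A s)) a b N t w \<longleftrightarrow> t 0 = a \<and> t N = b \<and>
    (\<forall>i\<in>{1..N}. t (i - 1) < t i \<and> (\<forall>s\<in>{t (i - 1)..t i}. admissible V (A s) (w i)))"
  (is "?lhs \<longleftrightarrow> ?rhs")
proof -
  have piece: "{t (i - 1)..t i} \<subseteq> {a..b}"
    if "t 0 = a" "t N = b" "\<forall>i\<in>{1..N}. t (i - 1) < t i" "i \<in> {1..N}" for i
    using partition_mono[OF that(3), of 0 "i - 1"] partition_mono[OF that(3), of i N] that by auto
  show ?thesis
  proof
    assume L: ?lhs
    then have "\<forall>i\<in>{1..N}. t (i - 1) < t i" by (simp add: sf_partition_def)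
    with L have sub: "{t (i - 1)..t i} \<subseteq> {a..b}" if "i \<in> {1..N}" for i
      using piece that by (simp add: sf_partition_def)
    have "admissible V (A s) (w i)" if i: "i \<in> {1..N}" and s: "s \<in> {t (i - 1)..t i}" for i s
    proof -
      have "reduced_op (A s) V" using reduced sub[OF i] s by blast
      moreover have "w i > 0" using L i by (simp add: sf_partition_def)
      ultimately show ?thesis
        using L i s by (subst reduced_op.admissible_iff) (simp_all add: sf_partition_def)
    qed
    then show ?rhs using L by (simp add: sf_partition_def)
  next
    assume R: ?rhs
    have "w i > 0" "\<forall>s\<in>{t (i - 1)..t i}.
        complex_of_real (w i) \<notin> op_spectrum V (A s) \<and>
        complex_of_real (- w i) \<notin> op_spectrum V (A s) \<and>
        finite_cdim (spectral_subspace V (A s) (- w i) (w i))"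
      "\<exists>d. \<forall>s\<in>{t (i - 1)..t i}. cdim (spectral_subspace V (A s) (- w i) (w i)) = d"
      if i: "i \<in> {1..N}" for i
    proof -
      have sub: "{t (i - 1)..t i} \<subseteq> {a..b}" using piece R i by blast
      have lt: "t (i - 1) < t i" and adm: "\<And>s. s \<in> {t (i - 1)..t i} \<Longrightarrow> admissible V (A s) (w i)"
        using R i by auto
      show w: "w i > 0" using adm[of "t i"] lt by (simp add: admissible_def)
      have red: "reduced_op (A s) V" if "s \<in> {t (i - 1)..t i}" for s
        using reduced sub that by blast
      show "\<forall>s\<in>{t (i - 1)..t i}.
          complex_of_real (w i) \<notin> op_spectrum V (A s) \<and>
          complex_of_real (- w i) \<notin> op_spectrum V (A s) \<and>
          finite_cdim (spectral_subspace V (A s) (- w i) (w i))"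
        using adm red reduced_op.admissible_iff[OF _ w] by blast
      have "cdim (spectral_subspace V (A s) (- w i) (w i)) = cdim (slab V (A (t (i - 1))) (- w i) (w i))"
        if s: "s \<in> {t (i - 1)..t i}" for s
      proof -
        have "cdim (slab V (A (t (i - 1))) (- w i) (w i)) = cdim (slab V (A s) (- w i) (w i))"
          using adm s sub w by (intro slab_dim_constant) (auto simp: admissible_def)
        moreover have "spectral_subspace V (A s) (- w i) (w i) = slab V (A s) (- w i) (w i)"
          using adm[OF s] w
          by (intro reduced_op.spectral_subspace_eq_slab[OF red[OF s]]) (auto simp: admissible_def)
        ultimately show ?thesis by simp
      qed
      then show "\<exists>d. \<forall>s\<in>{t (i - 1)..t i}. cdim (spectral_subspace V (A s) (- w i) (w i)) = d" by blast
    qed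
    then show ?lhs using R by (simp add: sf_partition_def)
  qed
qed

text \<open>Refine each piece of one partition by the points of the other one, clamped to the piece. The
  two sums become double sums over the same pieces, and on a common piece both widths are
  admissible.\<close>

lemma partition_sum_unique:
  assumes P: "sf_partition V (\<lambda>s. blinfun_apply (A s)) a b N t w"
    and P': "sf_partition V (\<lambda>s. blinfun_apply (A s)) a b N' t' w'"
  shows "(\<Sum>i=1..N. low_dim (w i) (t i) - low_dim (w i) (t (i - 1))) =
    (\<Sum>j=1..N'. low_dim (w' j) (t' j) - low_dim (w' j) (t' (j - 1)))"
proof -
  define clamp where "clamp u v x = min (max x u) v" for u v x :: real
  have split: "(\<Sum>i=1..N. low_dim (w i) (t i) - low_dim (w i) (t (i - 1))) =
      (\<Sum>i=1..N. \<Sum>j=1..N'. low_dim (w i) (clamp (t (i - 1)) (t i) (t' j)) -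
        low_dim (w i) (clamp (t (i - 1)) (t i) (t' (j - 1))))"
    if P: "sf_partition V (\<lambda>s. blinfun_apply (A s)) a b N t w"
      and P': "sf_partition V (\<lambda>s. blinfun_apply (A s)) a b N' t' w'" for N N' t t' w w'
  proof (rule sum.cong[OF refl])
    fix i assume i: "i \<in> {1..N}"
    have t: "t 0 = a" "t N = b" "\<forall>i\<in>{1..N}. t (i - 1) < t i" and t': "t' 0 = a" "t' N' = b"
      using P P' by (auto simp: sf_partition_iff)
    have "a \<le> t (i - 1)" "t (i - 1) < t i" "t i \<le> b"
      using partition_mono[OF t(3), of 0 "i - 1"] partition_mono[OF t(3), of i N] t i by auto
    then have "clamp (t (i - 1)) (t i) (t' N') = t i" "clamp (t (i - 1)) (t i) (t' 0) = t (i - 1)"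
      by (auto simp: clamp_def t')
    then show "low_dim (w i) (t i) - low_dim (w i) (t (i - 1)) =
        (\<Sum>j=1..N'. low_dim (w i) (clamp (t (i - 1)) (t i) (t' j)) -
          low_dim (w i) (clamp (t (i - 1)) (t i) (t' (j - 1))))"
      using sum_telescope''[of 0 N' "\<lambda>j. low_dim (w i) (clamp (t (i - 1)) (t i) (t' j))"] by simp
  qed
  have "low_dim (w i) (clamp (t (i - 1)) (t i) (t' j)) -
      low_dim (w i) (clamp (t (i - 1)) (t i) (t' (j - 1))) =
      low_dim (w' j) (clamp (t' (j - 1)) (t' j) (t i)) -
      low_dim (w' j) (clamp (t' (j - 1)) (t' j) (t (i - 1)))"
    if i: "i \<in> {1..N}" and j: "j \<in> {1..N'}" for i j
  proof -
    define p q where "p = max (t (i - 1)) (t' (j - 1))" and "q = min (t i) (t' j)"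
    have lt: "t (i - 1) < t i" "t' (j - 1) < t' j"
      using P P' i j by (auto simp: sf_partition_iff)
    show ?thesis
    proof (cases "p \<le> q")
      case True
      have "clamp (t (i - 1)) (t i) (t' j) = q" "clamp (t (i - 1)) (t i) (t' (j - 1)) = p"
        "clamp (t' (j - 1)) (t' j) (t i) = q" "clamp (t' (j - 1)) (t' j) (t (i - 1)) = p"
        using True lt by (auto simp: clamp_def p_def q_def)
      moreover have "low_dim (w i) q - low_dim (w i) p = low_dim (w' j) q - low_dim (w' j) p"
      proof (rule low_dim_change_independent)
        have t: "t 0 = a" "t N = b" "\<forall>i\<in>{1..N}. t (i - 1) < t i"
          using P by (auto simp: sf_partition_iff)
        have "a \<le> t (i - 1)" "t i \<le> b"
          using partition_mono[OF t(3), of 0 "i - 1"] partition_mono[OF t(3), of i N] t i by auto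
        then show "{p..q} \<subseteq> {a..b}" by (auto simp: p_def q_def)
        show "admissible V (A s) (w i)" if "s \<in> {p..q}" for s
          using P i that by (auto simp: sf_partition_iff p_def q_def)
        show "admissible V (A s) (w' j)" if "s \<in> {p..q}" for s
          using P' j that by (auto simp: sf_partition_iff p_def q_def)
      qed (rule True)
      ultimately show ?thesis by simp
    next
      case False
      then have "t' j < t (i - 1) \<or> t i < t' (j - 1)" using lt by (auto simp: p_def q_def)
      then have "clamp (t (i - 1)) (t i) (t' j) = clamp (t (i - 1)) (t i) (t' (j - 1))"
        "clamp (t' (j - 1)) (t' j) (t i) = clamp (t' (j - 1)) (t' j) (t (i - 1))"
        using lt by (auto simp: clamp_def)
      then show ?thesis by simp
    qed
  qed
  then show ?thesis
    unfolding split[OF P P'] split[OF P' P]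
    by (subst (2) sum.swap) (intro sum.cong refl, blast)
qed

lemma sf_eq_partition_sum:
  assumes "sf_partition V (\<lambda>s. blinfun_apply (A s)) a b N t w"
  shows "sf V (\<lambda>s. blinfun_apply (A s)) a b =
    (\<Sum>i=1..N. low_dim (w i) (t i) - low_dim (w i) (t (i - 1)))"
  unfolding sf_def
proof (rule the_equality)
  show "\<exists>N' t' w'. sf_partition V (\<lambda>s. blinfun_apply (A s)) a b N' t' w' \<and>
      (\<Sum>i=1..N. low_dim (w i) (t i) - low_dim (w i) (t (i - 1))) =
      (\<Sum>i=1..N'. low_dim (w' i) (t' i) - low_dim (w' i) (t' (i - 1)))"
    by (intro exI[of _ N] exI[of _ t] exI[of _ w] conjI assms refl)
next
  fix s
  assume "\<exists>N' t' w'. sf_partition V (\<lambda>s. blinfun_apply (A s)) a b N' t' w' \<and>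
      s = (\<Sum>i=1..N'. low_dim (w' i) (t' i) - low_dim (w' i) (t' (i - 1)))"
  then obtain N' t' w' where P': "sf_partition V (\<lambda>s. blinfun_apply (A s)) a b N' t' w'"
    and s: "s = (\<Sum>i=1..N'. low_dim (w' i) (t' i) - low_dim (w' i) (t' (i - 1)))"
    by (elim exE conjE)
  show "s = (\<Sum>i=1..N. low_dim (w i) (t i) - low_dim (w i) (t (i - 1)))"
    unfolding s by (rule partition_sum_unique[OF P' assms])
qed

end

text \<open>By the spectral gap of a Fredholm operator and its stability, each parameter has a
  neighbourhood with a common admissible width; a Lebesgue number of this cover gives the mesh.\<close>

lemma sf_partition_exists:
  fixes A :: "real \<Rightarrow> 'a::chilbert_space \<Rightarrow>\<^sub>L 'a"
  assumes "a < b" and cont: "continuous_on {a..b} A" and Fsa: "\<And>s. s \<in> {a..b} \<Longrightarrow> A s \<in> Fsa"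
  obtains N :: nat and t w :: "nat \<Rightarrow> real" where "t 0 = a" "t N = b"
    "\<forall>i\<in>{1..N}. t (i - 1) < t i \<and> (\<forall>s\<in>{t (i - 1)..t i}. admissible UNIV (A s) (w i))"
proof -
  have red: "reduced_op (A s) UNIV" if "s \<in> {a..b}" for s
    by (rule sa_op.reduced_op_UNIV[OF Fsa_imp_sa_op[OF Fsa[OF that]]])
  have "\<exists>\<epsilon> w. \<epsilon> > 0 \<and> (\<forall>x\<in>{a..b}. dist s x < \<epsilon> \<longrightarrow> admissible UNIV (A x) w)"
    if s: "s \<in> {a..b}" for s
  proof -
    obtain w where "w > 0" "bounded_below_at UNIV (A s) w" "bounded_below_at UNIV (A s) (- w)"
      "finite_cdim (slab UNIV (A s) (- w) w)"
      using Fsa_gap[OF Fsa[OF s]] by blast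
    then have "admissible UNIV (A s) w" by (simp add: admissible_def)
    then obtain \<delta> where \<delta>: "\<delta> > 0" "\<And>T'. reduced_op T' UNIV \<Longrightarrow> norm (T' - A s) < \<delta> \<Longrightarrow> admissible UNIV T' w"
      using reduced_op.admissible_stable[OF red[OF s]] by blast
    obtain \<epsilon> where \<epsilon>: "\<epsilon> > 0" "\<And>x. x \<in> {a..b} \<Longrightarrow> dist x s < \<epsilon> \<Longrightarrow> dist (A x) (A s) < \<delta>"
      using cont s \<delta>(1) unfolding continuous_on_iff by metis
    have "admissible UNIV (A x) w" if "x \<in> {a..b}" "dist s x < \<epsilon>" for x
      using \<delta>(2)[OF red[OF that(1)]] \<epsilon>(2)[OF that(1)] that(2) by (simp add: dist_norm norm_minus_commute)
    then show ?thesis using \<epsilon>(1) by blast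
  qed
  then obtain \<epsilon> v where \<epsilon>: "\<And>s. s \<in> {a..b} \<Longrightarrow> \<epsilon> s > 0"
    and v: "\<And>s x. s \<in> {a..b} \<Longrightarrow> x \<in> {a..b} \<Longrightarrow> dist s x < \<epsilon> s \<Longrightarrow> admissible UNIV (A x) (v s)"
    by metis
  obtain e where e: "e > 0" "\<And>x. x \<in> {a..b} \<Longrightarrow> \<exists>B\<in>(\<lambda>s. ball s (\<epsilon> s)) ` {a..b}. ball x e \<subseteq> B"
  proof (rule Heine_Borel_lemma[of "{a..b}" "(\<lambda>s. ball s (\<epsilon> s)) ` {a..b}"])
    show "{a..b} \<subseteq> \<Union> ((\<lambda>s. ball s (\<epsilon> s)) ` {a..b})" using \<epsilon> by force
  qed auto
  obtain N :: nat where N: "(b - a) / e < real N" using reals_Archimedean2 by blast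
  then have Npos: "real N > 0" using e(1) \<open>a < b\<close> by (smt (verit) divide_pos_pos)
  define h where "h = (b - a) / real N"
  have h: "0 < h" "h < e" "real N * h = b - a"
    using N Npos e(1) \<open>a < b\<close> by (simp_all add: h_def field_simps)
  define t where "t i = a + real i * h" for i
  have step: "t i = t (i - 1) + h" if "i \<in> {1..N}" for i
    using that by (cases i) (simp_all add: t_def distrib_right)
  have tmem: "t i \<in> {a..b}" if "i \<le> N" for i
  proof -
    have "real i * h \<le> real N * h" using that h(1) by (intro mult_right_mono) auto
    then show ?thesis using h by (simp add: t_def)
  qed
  have "\<exists>w. \<forall>s\<in>{t (i - 1)..t i}. admissible UNIV (A s) w" if i: "i \<in> {1..N}" for i
  proof -
    have "i - 1 \<le> N" "i \<le> N" using i by auto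
    then have mem: "t (i - 1) \<in> {a..b}" "t i \<in> {a..b}" using tmem by blast+
    obtain s where s: "s \<in> {a..b}" "ball (t (i - 1)) e \<subseteq> ball s (\<epsilon> s)" using e(2)[OF mem(1)] by blast
    have "admissible UNIV (A x) (v s)" if x: "x \<in> {t (i - 1)..t i}" for x
    proof (rule v[OF s(1)])
      have "x \<in> ball (t (i - 1)) e" using x step[OF i] h by (simp add: dist_real_def)
      then show "dist s x < \<epsilon> s" using s(2) by auto
      show "x \<in> {a..b}" using x mem by auto
    qed
    then show ?thesis by blast
  qed
  then obtain w where "\<forall>i\<in>{1..N}. \<forall>s\<in>{t (i - 1)..t i}. admissible UNIV (A s) (w i)" by metis
  moreover have "\<forall>i\<in>{1..N}. t (i - 1) < t i" using step h(1) by force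
  moreover have "t 0 = a" "t N = b" by (simp_all add: t_def h(3))
  ultimately show ?thesis by (intro that[of t N w]) auto
qed

text \<open>This is why one partition can be used on all invariant subspaces.\<close>

lemma admissible_restrict:
  assumes "reduced_op T V" "admissible UNIV T w"
  shows "admissible V T w"
proof -
  interpret reduced_op T V by (rule assms)
  have "finite_cdim (slab V T (- w) w)"
    by (rule finite_cdim_subset[OF csubspace_slab, of _ _ "slab UNIV T (- w) w"])
       (use assms(2) in \<open>auto simp: slab_def admissible_def\<close>)
  then show ?thesis using assms(2) unfolding admissible_def bounded_below_at_def by blast
qed


section \<open>Additivity of the spectral flow\<close>

text \<open>Projections that commute with the spectral projections decompose every spectral subspace, so
  dimensions add up for a partition that is admissible on all the subspaces.\<close>

lemma sf_additive:
  fixes A :: "real \<Rightarrow> 'a::chilbert_space \<Rightarrow>\<^sub>L 'a" and Q :: "'i \<Rightarrow> 'a \<Rightarrow> 'a"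
  assumes "a < b" and cont: "continuous_on {a..b} A" and Fsa: "\<And>s. s \<in> {a..b} \<Longrightarrow> A s \<in> Fsa"
    and I: "finite I"
    and V: "\<And>s. s \<in> {a..b} \<Longrightarrow> reduced_op (A s) V"
    and W: "\<And>i s. i \<in> I \<Longrightarrow> s \<in> {a..b} \<Longrightarrow> reduced_op (A s) (W i)"
    and W_eq: "\<And>i. i \<in> I \<Longrightarrow> W i = {x\<in>V. Q i x = x}"
    and Q: "\<And>i. i \<in> I \<Longrightarrow> clinear (Q i)" "\<And>i x. i \<in> I \<Longrightarrow> x \<in> V \<Longrightarrow> Q i x \<in> V"
    and QQ: "\<And>i j x. i \<in> I \<Longrightarrow> j \<in> I \<Longrightarrow> x \<in> V \<Longrightarrow> Q i (Q j x) = (if i = j then Q j x else 0)"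
    and sum: "\<And>x. x \<in> V \<Longrightarrow> (\<Sum>i\<in>I. Q i x) = x"
    and comm: "\<And>i s l x. i \<in> I \<Longrightarrow> s \<in> {a..b} \<Longrightarrow> spec_proj (A s) l (Q i x) = Q i (spec_proj (A s) l x)"
  shows "sf V (\<lambda>s. blinfun_apply (A s)) a b = (\<Sum>i\<in>I. sf (W i) (\<lambda>s. blinfun_apply (A s)) a b)"
proof -
  have ab: "a \<in> {a..b}" using \<open>a < b\<close> by simp
  have path: "op_path U A a b" if "\<And>s. s \<in> {a..b} \<Longrightarrow> reduced_op (A s) U" for U
  proof (intro op_path.intro op_path_axioms.intro that cont \<open>a < b\<close>)
    show "closed_csubspace U" using that[OF ab] by (simp add: reduced_op_def)
  qed
  obtain N :: nat and t w :: "nat \<Rightarrow> real" where t: "t 0 = a" "t N = b"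
    and adm: "\<forall>i\<in>{1..N}. t (i - 1) < t i \<and> (\<forall>s\<in>{t (i - 1)..t i}. admissible UNIV (A s) (w i))"
    by (rule sf_partition_exists[OF \<open>a < b\<close> cont Fsa])
  have opV: "op_path V A a b" by (rule path) (rule V)
  have incr: "\<forall>i\<in>{1..N}. t (i - 1) < t i" using adm by blast
  have piece: "{t (i - 1)..t i} \<subseteq> {a..b}" if i: "i \<in> {1..N}" for i
    using op_path.partition_mono[OF opV incr, of 0 "i - 1"]
      op_path.partition_mono[OF opV incr, of i N] t i by auto
  have part: "sf_partition U (\<lambda>s. blinfun_apply (A s)) a b N t w"
    if U: "\<And>s. s \<in> {a..b} \<Longrightarrow> reduced_op (A s) U" for U
  proof -
    have "op_path U A a b" by (rule path) (rule U)
    moreover have "admissible U (A s) (w i)" if i: "i \<in> {1..N}" and s: "s \<in> {t (i - 1)..t i}" for i s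
    proof (rule admissible_restrict[OF U])
      show "s \<in> {a..b}" using s piece[OF i] by blast
      show "admissible UNIV (A s) (w i)" using adm i s by blast
    qed
    ultimately show ?thesis using adm t by (simp add: op_path.sf_partition_iff)
  qed
  define flow where "flow U k = int (cdim (spectral_subspace U (A (t k)) 0 (w k))) -
    int (cdim (spectral_subspace U (A (t (k - 1))) 0 (w k)))" for U k
  have dim: "cdim (spectral_subspace V (A s) 0 v) = (\<Sum>i\<in>I. cdim (spectral_subspace (W i) (A s) 0 v))"
    if s: "s \<in> {a..b}" and v: "admissible V (A s) v" for s v
  proof -
    interpret reduced_op "A s" V by (rule V[OF s])
    have v0: "0 \<le> v" using v by (simp add: admissible_def)
    note eq = spectral_subspace_eq[OF v0]
    have Q0: "Q i 0 = 0" if "i \<in> I" for i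
      using Q(1)[OF that] by (metis clinear_iff complex_vector.scale_zero_left)
    have "cdim (spectral_subspace V (A s) 0 v) =
        (\<Sum>i\<in>I. cdim {x\<in>spectral_subspace V (A s) 0 v. Q i x = x})"
    proof (rule cdim_projections[OF I csubspace_spectral_subspace[OF v0] finite_cdim_low[OF v] Q(1)])
      show "Q i x \<in> spectral_subspace V (A s) 0 v"
        if "i \<in> I" "x \<in> spectral_subspace V (A s) 0 v" for i x
        using that by (simp add: eq Q(2) comm[OF that(1) s] Q0)
      show "Q i (Q j x) = (if i = j then Q j x else 0)"
        if "i \<in> I" "j \<in> I" "x \<in> spectral_subspace V (A s) 0 v" for i j x
        using that by (intro QQ) (auto simp: eq)
      show "(\<Sum>i\<in>I. Q i x) = x" if "x \<in> spectral_subspace V (A s) 0 v" for x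
        using that by (intro sum) (simp add: eq)
    qed
    also have "\<dots> = (\<Sum>i\<in>I. cdim (spectral_subspace (W i) (A s) 0 v))"
    proof (rule sum.cong[OF refl])
      fix i assume i: "i \<in> I"
      have "{x\<in>spectral_subspace V (A s) 0 v. Q i x = x} = spectral_subspace (W i) (A s) 0 v"
        unfolding eq reduced_op.spectral_subspace_eq[OF W[OF i s] v0]
        using W_eq[OF i] by auto
      then show "cdim {x\<in>spectral_subspace V (A s) 0 v. Q i x = x} =
          cdim (spectral_subspace (W i) (A s) 0 v)" by simp
    qed
    finally show ?thesis .
  qed
  have "sf V (\<lambda>s. blinfun_apply (A s)) a b = (\<Sum>k=1..N. flow V k)"
    unfolding flow_def by (rule op_path.sf_eq_partition_sum[OF opV part[OF V]])
  also have "\<dots> = (\<Sum>k=1..N. \<Sum>i\<in>I. flow (W i) k)"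
  proof (rule sum.cong[OF refl])
    fix k assume k: "k \<in> {1..N}"
    have "t (k - 1) < t k" using incr k by blast
    then have mem: "t (k - 1) \<in> {t (k - 1)..t k}" "t k \<in> {t (k - 1)..t k}" by simp_all
    have "cdim (spectral_subspace V (A s) 0 (w k)) = (\<Sum>i\<in>I. cdim (spectral_subspace (W i) (A s) 0 (w k)))"
      if s: "s \<in> {t (k - 1)..t k}" for s
    proof -
      have sab: "s \<in> {a..b}" using s piece[OF k] by blast
      have "admissible UNIV (A s) (w k)" using adm k s by blast
      from dim[OF sab admissible_restrict[OF V[OF sab] this]] show ?thesis .
    qed
    from this[OF mem(1)] this[OF mem(2)]
    show "flow V k = (\<Sum>i\<in>I. flow (W i) k)" by (simp add: flow_def sum_subtractf)
  qed
  also have "\<dots> = (\<Sum>i\<in>I. \<Sum>k=1..N. flow (W i) k)" by (rule sum.swap)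
  also have "\<dots> = (\<Sum>i\<in>I. sf (W i) (\<lambda>s. blinfun_apply (A s)) a b)"
  proof (rule sum.cong[OF refl])
    fix i assume i: "i \<in> I"
    show "(\<Sum>k=1..N. flow (W i) k) = sf (W i) (\<lambda>s. blinfun_apply (A s)) a b"
      unfolding flow_def
      by (rule op_path.sf_eq_partition_sum[OF path[OF W[OF i]] part[OF W[OF i]], symmetric])
  qed
  finally show ?thesis .
qed

lemma closed_csubspace_eigenspace:
  assumes "closed_csubspace V" and Q: "clinear Q" "bounded_linear Q"
  shows "closed_csubspace {x\<in>V. Q x = r *\<^sub>R x}"
proof
  interpret closed_csubspace V by fact
  have Q': "Q (x + y) = Q x + Q y" "Q (a *\<^sub>C x) = a *\<^sub>C Q x" for x y a
    using Q(1) by (simp_all add: clinear_iff)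
  show "csubspace {x\<in>V. Q x = r *\<^sub>R x}"
    unfolding complex_vector.subspace_def
    by (auto simp: zero_mem add_mem scaleC_mem Q' linear_simps(3)[OF Q(2)] scaleC_add_right
        scaleR_scaleC scaleC_scaleC mult.commute)
  have "closed {x. Q x = r *\<^sub>R x}"
    by (intro closed_Collect_eq bounded_linear.continuous_on[OF Q(2)] continuous_intros)
  then have "closed (V \<inter> {x. Q x = r *\<^sub>R x})" using closed by (rule closed_Int[rotated])
  then show "closed {x\<in>V. Q x = r *\<^sub>R x}" by (simp add: Int_def)
qed


section \<open>The isotypic projections of the dihedral group\<close>

lemma zeta_power: "zeta n ^ j = exp (2 * of_real pi * \<i> * of_nat j / of_nat n)"
  unfolding zeta_def exp_of_nat_mult[symmetric] by (simp add: mult_ac)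

lemma zeta_power_n: "n \<ge> 1 \<Longrightarrow> zeta n ^ n = 1"
  by (simp add: zeta_power)

lemma zeta_nonzero [simp]: "zeta n \<noteq> 0"
  by (simp add: zeta_def)

lemma zeta_power_eq_iff: "n \<ge> 1 \<Longrightarrow> j < n \<Longrightarrow> k < n \<Longrightarrow> zeta n ^ j = zeta n ^ k \<longleftrightarrow> j = k"
  unfolding zeta_power using complex_root_unity_eq[of n j k] by simp

lemma zeta_orthogonality:
  assumes "n \<ge> 1" "j < n" "k < n"
  shows "(\<Sum>m<n. (inverse (zeta n) ^ k * zeta n ^ j) ^ m) = (if j = k then of_nat n else 0)"
proof (cases "j = k")
  case True
  have "inverse (zeta n) ^ k * zeta n ^ k = 1" by (simp add: power_inverse)
  then show ?thesis using True by simp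
next
  case False
  let ?q = "inverse (zeta n) ^ k * zeta n ^ j"
  have "?q \<noteq> 1"
  proof
    assume "?q = 1"
    then have "zeta n ^ j = zeta n ^ k" by (simp add: power_inverse field_simps)
    then show False using zeta_power_eq_iff assms False by blast
  qed
  moreover have "?q ^ n = 1"
    using zeta_power_n[OF assms(1)]
    by (simp add: power_mult_distrib power_inverse flip: power_mult) (simp add: mult.commute[of _ n] power_mult)
  ultimately show ?thesis using False by (simp add: geometric_sum)
qed

text \<open>The discrete Fourier average that projects onto the eigenspace of \<open>R\<close> for \<open>zeta n ^ j\<close>.\<close>

definition rot_proj :: "nat \<Rightarrow> ('a::complex_inner \<Rightarrow> 'a) \<Rightarrow> nat \<Rightarrow> 'a \<Rightarrow> 'a" where
  "rot_proj n R j x = (1 / of_nat n) *\<^sub>C (\<Sum>m<n. (inverse (zeta n) ^ j) ^ m *\<^sub>C (R ^^ m) x)"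

text \<open>Here \<open>j + k = n\<close> stands for \<open>j = - k\<close> modulo \<open>n\<close>. Over \<open>k \<le> n div 2\<close> these sets partition the
  residues modulo \<open>n\<close>, one for each pair of inverse eigenvalues of the rotation.\<close>

definition isotypic_residues :: "nat \<Rightarrow> nat \<Rightarrow> nat set" where
  "isotypic_residues n k = {j. j < n \<and> (j = k \<or> j + k = n)}"

definition isotypic_proj :: "nat \<Rightarrow> ('a::complex_inner \<Rightarrow> 'a) \<Rightarrow> nat \<Rightarrow> 'a \<Rightarrow> 'a" where
  "isotypic_proj n R k x = (\<Sum>j\<in>isotypic_residues n k. rot_proj n R j x)"

lemma finite_isotypic_residues [simp]: "finite (isotypic_residues n k)"
  by (rule finite_subset[of _ "{..<n}"]) (auto simp: isotypic_residues_def)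

locale dihedral_rep =
  fixes n :: nat and R S :: "'a::chilbert_space \<Rightarrow> 'a"
  assumes n: "n \<ge> 1" and rep: "unitary_dihedral_rep n R S"
begin

lemma unitary_R: "unitary R" and unitary_S: "unitary S"
  and R_n: "(R ^^ n) x = x" and S_S: "S (S x) = x" and SRSR: "S (R (S (R x))) = x"
  using rep by (auto simp: unitary_dihedral_rep_def fun_eq_iff numeral_2_eq_2)

lemma R_clinear: "clinear R" and S_clinear: "clinear S"
  and R_cinner: "cinner (R x) (R y) = cinner x y" and S_cinner: "cinner (S x) (S y) = cinner x y"
  using unitary_R unitary_S by (auto simp: unitary_def)

lemma R_add: "R (x + y) = R x + R y" and R_scaleC: "R (a *\<^sub>C x) = a *\<^sub>C R x"
  using R_clinear by (simp_all add: clinear_iff)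

lemma Rm_clinear: "clinear (R ^^ m)"
  unfolding clinear_iff by (induction m) (simp_all add: R_add R_scaleC)

lemma Rm_cinner: "cinner ((R ^^ m) x) ((R ^^ m) y) = cinner x y"
  by (induction m) (simp_all add: R_cinner)

lemma bounded_linear_if_isometry:
  fixes B :: "'a \<Rightarrow> 'a"
  assumes "clinear B" "\<And>x y. cinner (B x) (B y) = cinner x y"
  shows "bounded_linear B"
  using assms
  by (intro bounded_linear_intro[where K = 1]) (auto simp: clinear_iff scaleR_scaleC norm_eq_sqrt_cinner)

lemma Rm_bounded_linear: "bounded_linear (R ^^ m)"
  by (rule bounded_linear_if_isometry[OF Rm_clinear Rm_cinner])

lemma R_rip: "rip (R x) y = rip x ((R ^^ (n - 1)) y)"
proof -
  have "y = R ((R ^^ (n - 1)) y)"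
    using R_n[of y] n by (metis Suc_diff_1 funpow.simps(2) comp_apply less_eq_Suc_le One_nat_def)
  then have "rip (R x) y = rip (R x) (R ((R ^^ (n - 1)) y))" by simp
  then show ?thesis by (simp add: rip_def R_cinner)
qed

subsection \<open>Projections onto the eigenspaces of the rotation\<close>

abbreviation "P \<equiv> rot_proj n R"

lemma P_clinear: "clinear (P j)"
  using Rm_clinear unfolding clinear_iff rot_proj_def
  by (simp add: sum.distrib scaleC_add_right complex_vector.scale_sum_right scaleC_scaleC mult_ac)

lemma P_add: "P j (x + y) = P j x + P j y" and P_scaleC: "P j (a *\<^sub>C x) = a *\<^sub>C P j x"
  using P_clinear by (simp_all add: clinear_iff)


lemma P_bounded_linear: "bounded_linear (P j)"
  unfolding rot_proj_def[abs_def]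
  by (intro bounded_linear_compose[OF bounded_linear_scaleC] bounded_linear_sum Rm_bounded_linear)

text \<open>Shifting the summation index is allowed because the summand is \<open>n\<close>-periodic.\<close>

lemma R_P: "R (P j x) = zeta n ^ j *\<^sub>C P j x"
proof -
  define f where "f m = (inverse (zeta n) ^ j) ^ m *\<^sub>C (R ^^ m) x" for m
  have inv: "zeta n ^ j * inverse (zeta n) ^ j = 1" by (simp add: power_inverse)
  have "f n = f 0"
  proof -
    have "(inverse (zeta n) ^ j) ^ n = 1"
      using zeta_power_n[OF n] by (simp add: power_inverse flip: power_mult) (simp add: mult.commute[of j n] power_mult)
    then show ?thesis by (simp add: f_def R_n)
  qed
  have R_sum: "R (\<Sum>m\<in>I. g m) = (\<Sum>m\<in>I. R (g m))" for I and g :: "nat \<Rightarrow> 'a"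
    using R_scaleC[of 0 0] by (induction I rule: infinite_finite_induct) (simp_all add: R_add)
  have "R (f m) = zeta n ^ j *\<^sub>C f (Suc m)" for m
    using inv by (simp add: f_def R_scaleC scaleC_scaleC mult.assoc[symmetric])
  then have "R (\<Sum>m<n. f m) = zeta n ^ j *\<^sub>C (\<Sum>m<n. f (Suc m))"
    by (simp add: R_sum complex_vector.scale_sum_right)
  also have "(\<Sum>m<n. f (Suc m)) = (\<Sum>m<n. f m)"
    using sum.lessThan_Suc_shift[of f n] sum.lessThan_Suc[of f n] \<open>f n = f 0\<close> by simp
  finally show ?thesis
    unfolding rot_proj_def f_def[symmetric] by (simp add: R_scaleC scaleC_scaleC mult.commute)
qed

lemma P_eigenvector:
  assumes "R x = zeta n ^ j *\<^sub>C x" "j < n" "k < n"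
  shows "P k x = (if j = k then x else 0)"
proof -
  have Rm: "(R ^^ m) x = (zeta n ^ j) ^ m *\<^sub>C x" for m
    by (induction m) (simp_all add: R_scaleC assms(1) scaleC_scaleC mult.commute)
  have "P k x = ((1 / of_nat n) * (\<Sum>m<n. (inverse (zeta n) ^ k * zeta n ^ j) ^ m)) *\<^sub>C x"
    unfolding rot_proj_def Rm
    by (simp only: scaleC_scaleC[symmetric] complex_vector.scale_sum_left power_mult_distrib)
  then show ?thesis using n by (simp add: zeta_orthogonality[OF n assms(2,3)])
qed


lemma P_eq_self_iff: "j < n \<Longrightarrow> P j x = x \<longleftrightarrow> R x = zeta n ^ j *\<^sub>C x"
  using P_eigenvector[of x j j] R_P[of j x] by auto

text \<open>Summing over \<open>j\<close> first, the orthogonality relation leaves only the term with \<open>R ^^ 0\<close>.\<close>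

lemma sum_P: "(\<Sum>j<n. P j x) = x"
proof -
  have inner: "(\<Sum>j<n. (inverse (zeta n) ^ j) ^ m) = (if m = 0 then of_nat n else 0)" if "m < n" for m
  proof -
    have "(\<Sum>j<n. (inverse (zeta n) ^ j) ^ m) = (\<Sum>j<n. (inverse (zeta n) ^ m * zeta n ^ 0) ^ j)"
      by (intro sum.cong refl) (simp add: mult.commute flip: power_mult)
    then show ?thesis using zeta_orthogonality[OF n _ that, of 0] n by auto
  qed
  have "(\<Sum>j<n. P j x) = (1 / of_nat n) *\<^sub>C
      (\<Sum>m<n. (\<Sum>j<n. (inverse (zeta n) ^ j) ^ m) *\<^sub>C (R ^^ m) x)"
    unfolding rot_proj_def complex_vector.scale_sum_right[symmetric] complex_vector.scale_sum_left
    by (subst sum.swap) (rule refl)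
  also have "(\<Sum>m<n. (\<Sum>j<n. (inverse (zeta n) ^ j) ^ m) *\<^sub>C (R ^^ m) x) =
      (\<Sum>m<n. if m = 0 then of_nat n *\<^sub>C x else 0)"
    by (intro sum.cong refl) (simp add: inner)
  also have "\<dots> = of_nat n *\<^sub>C x" using n by (simp add: sum.delta)
  finally show ?thesis using n by (simp add: scaleC_scaleC)
qed

subsection \<open>Isotypic projections\<close>

abbreviation "J \<equiv> isotypic_residues n"
abbreviation "Iso \<equiv> isotypic_proj n R"

lemma J_less: "j \<in> J k \<Longrightarrow> j < n"
  by (simp add: isotypic_residues_def)

lemma J_disjoint: "k \<in> {0..n div 2} \<Longrightarrow> l \<in> {0..n div 2} \<Longrightarrow> k \<noteq> l \<Longrightarrow> J k \<inter> J l = {}"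
  by (auto simp: isotypic_residues_def)

lemma J_Union: "(\<Union>k\<in>{0..n div 2}. J k) = {..<n}"
proof
  show "{..<n} \<subseteq> (\<Union>k\<in>{0..n div 2}. J k)"
  proof
    fix j assume j: "j \<in> {..<n}"
    show "j \<in> (\<Union>k\<in>{0..n div 2}. J k)"
    proof (cases "j \<le> n div 2")
      case True
      then show ?thesis using j by (auto simp: isotypic_residues_def)
    next
      case False
      then have "n - j \<in> {0..n div 2}" "j \<in> J (n - j)" using j by (auto simp: isotypic_residues_def)
      then show ?thesis by blast
    qed
  qed
qed (auto simp: isotypic_residues_def)

lemma Iso_clinear: "clinear (Iso k)"
  unfolding clinear_iff isotypic_proj_def
  by (simp add: P_add P_scaleC sum.distrib complex_vector.scale_sum_right)

lemma Iso_bounded_linear: "bounded_linear (Iso k)"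
  unfolding isotypic_proj_def[abs_def] by (intro bounded_linear_sum P_bounded_linear)

lemma sum_Iso: "(\<Sum>k=0..n div 2. Iso k x) = x"
proof -
  have "(\<Sum>k=0..n div 2. Iso k x) = (\<Sum>j\<in>(\<Union>k\<in>{0..n div 2}. J k). P j x)"
    unfolding isotypic_proj_def by (rule sum.UNION_disjoint[symmetric]) (use J_disjoint in auto)
  then show ?thesis by (simp add: J_Union sum_P)
qed

lemma Iso_eigenvector:
  assumes "R x = zeta n ^ j *\<^sub>C x" "j < n"
  shows "Iso k x = (if j \<in> J k then x else 0)"
proof -
  have "Iso k x = (\<Sum>i\<in>J k. if j = i then x else 0)"
    unfolding isotypic_proj_def using P_eigenvector[OF assms] J_less by (intro sum.cong) auto
  then show ?thesis by (simp add: sum.delta')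
qed

lemma Iso_add: "Iso k (x + y) = Iso k x + Iso k y" and Iso_scaleC: "Iso k (a *\<^sub>C x) = a *\<^sub>C Iso k x"
  using Iso_clinear by (simp_all add: clinear_iff)

lemma Iso_sum: "Iso k (\<Sum>i\<in>I. f i) = (\<Sum>i\<in>I. Iso k (f i))"
proof (induction I rule: infinite_finite_induct)
qed (use Iso_scaleC[of k 0 0] in \<open>simp_all add: Iso_add\<close>)

lemma Iso_Iso:
  assumes "k \<in> {0..n div 2}" "l \<in> {0..n div 2}"
  shows "Iso k (Iso l x) = (if k = l then Iso l x else 0)"
proof -
  have "Iso k (Iso l x) = (\<Sum>j\<in>J l. if j \<in> J k then P j x else 0)"
    unfolding isotypic_proj_def[of _ _ l] Iso_sum
    by (intro sum.cong refl Iso_eigenvector[OF R_P]) (simp add: J_less)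
  also have "\<dots> = (if k = l then Iso l x else 0)"
  proof (cases "k = l")
    case True
    then show ?thesis by (simp add: isotypic_proj_def)
  next
    case False
    then have "j \<notin> J k" if "j \<in> J l" for j using J_disjoint[OF assms False] that by blast
    then show ?thesis using False by simp
  qed
  finally show ?thesis .
qed

lemma rot_eigenspace_nat: "rot_eigenspace n R (int j) = {x. R x = zeta n ^ j *\<^sub>C x}"
  by (simp add: rot_eigenspace_def)

lemma rot_eigenspace_minus:
  assumes "j \<le> n"
  shows "rot_eigenspace n R (- int j) = {x. R x = zeta n ^ (n - j) *\<^sub>C x}"
proof -
  have "zeta n ^ (n - j) * zeta n ^ j = 1"
    using assms zeta_power_n[OF n] by (simp flip: power_add)
  then have "zeta n powi (- int j) = zeta n ^ (n - j)"
    by (simp add: power_int_minus field_simps)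
  then show ?thesis by (simp add: rot_eigenspace_def)
qed

text \<open>For \<open>k = 0\<close>, and for \<open>k = n div 2\<close> with \<open>n\<close> even, \<open>k\<close> is its own inverse and there is a single
  eigenspace; otherwise there are two different ones, for \<open>k\<close> and \<open>n - k\<close>.\<close>

lemma isotypic_space_eq:
  assumes "k \<in> {0..n div 2}"
  shows "isotypic_space n R k = {x. Iso k x = x}"
proof -
  have single: "{x. R x = zeta n ^ k *\<^sub>C x} = {x. Iso k x = x}" if "J k = {k}"
  proof -
    have "k < n" using J_less that by blast
    then show ?thesis unfolding isotypic_proj_def that by (simp add: P_eq_self_iff)
  qed
  consider "k = 0" | "0 < k" "k \<le> (n - 1) div 2" | "0 < k" "\<not> k \<le> (n - 1) div 2" by linarith
  then show ?thesis
  proof cases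
    case 1
    have "J k = {k}" using n 1 by (auto simp: isotypic_residues_def)
    then show ?thesis
      using single rot_eigenspace_nat[of 0] 1 by (simp add: isotypic_space_def)
  next
    case 2
    have J: "J k = {k, n - k}" and ne: "k \<noteq> n - k" and lt: "k < n" "n - k < n"
      using 2 by (auto simp: isotypic_residues_def)
    have space: "isotypic_space n R k =
        {x + y | x y. R x = zeta n ^ k *\<^sub>C x \<and> R y = zeta n ^ (n - k) *\<^sub>C y}"
      unfolding isotypic_space_def using 2 lt by (simp add: rot_eigenspace_nat rot_eigenspace_minus)
    show ?thesis
    proof (intro set_eqI iffI)
      fix z assume "z \<in> isotypic_space n R k"
      then obtain x y where "z = x + y" "R x = zeta n ^ k *\<^sub>C x" "R y = zeta n ^ (n - k) *\<^sub>C y"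
        unfolding space by blast
      then show "z \<in> {x. Iso k x = x}"
        using Iso_eigenvector[of x k k] Iso_eigenvector[of y "n - k" k] lt by (simp add: Iso_add J)
    next
      fix z assume "z \<in> {x. Iso k x = x}"
      then have "z = P k z + P (n - k) z" using ne by (simp add: isotypic_proj_def J)
      then show "z \<in> isotypic_space n R k" unfolding space using R_P by blast
    qed
  next
    case 3
    then have k: "even n" "k = n div 2" using assms by presburger+
    then have "J k = {k}" using 3 n by (auto simp: isotypic_residues_def)
    then show ?thesis
      using single 3 k by (simp add: isotypic_space_def rot_eigenspace_nat)
  qed
qed

subsection \<open>Reflections\<close>

context
  fixes h :: nat
begin

definition U :: "'a \<Rightarrow> 'a" where "U x = S ((R ^^ h) x)"

lemma U_clinear: "clinear U"
  using S_clinear Rm_clinear[of h] unfolding clinear_iff U_def by simp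

lemma U_cinner: "cinner (U x) (U y) = cinner x y"
  by (simp add: U_def S_cinner Rm_cinner)

lemma U_bounded_linear: "bounded_linear U"
  by (rule bounded_linear_if_isometry[OF U_clinear U_cinner])

lemma R_S_R: "R (S (R x)) = S x"
  using SRSR[of x] S_S by metis

lemma U_U: "U (U x) = x"
proof -
  have "(R ^^ m) (S ((R ^^ m) x)) = S x" for m x
  proof (induction m arbitrary: x)
    case (Suc m)
    have "(R ^^ Suc m) (S ((R ^^ Suc m) x)) = R ((R ^^ m) (S ((R ^^ m) (R x))))"
      by (simp add: funpow_swap1)
    then show ?case by (simp add: Suc R_S_R)
  qed simp
  then show ?thesis by (simp add: U_def S_S)
qed

lemma R_U_R: "R (U (R x)) = U x"
proof -
  have "(R ^^ h) (R x) = R ((R ^^ h) x)" by (rule funpow_swap1[symmetric])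
  then show ?thesis by (simp only: U_def R_S_R)
qed

lemma U_rip: "rip (U x) y = rip x (U y)"
  using U_cinner[of x "U y"] by (simp add: U_U rip_def)

text \<open>A reflection maps the eigenspace for \<open>\<zeta>\<^sup>j\<close> onto the one for its inverse, so it preserves the
  isotypic spaces.\<close>

lemma Iso_U:
  assumes k: "k \<in> {0..n div 2}"
  shows "Iso k (U x) = U (Iso k x)"
proof -
  have U_add: "U (x + y) = U x + U y" and U_scaleC: "U (a *\<^sub>C x) = a *\<^sub>C U x" for x y a
    using U_clinear by (simp_all add: clinear_iff)
  have U_zero: "U 0 = 0" using U_scaleC[of 0 0] by simp
  have U_sum: "U (\<Sum>i\<in>I. f i) = (\<Sum>i\<in>I. U (f i))" for I :: "nat set" and f
    by (induction I rule: infinite_finite_induct) (simp_all add: U_add U_zero)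
  have fixed: "Iso l (U (Iso l x)) = U (Iso l x)" if l: "l \<in> {0..n div 2}" for l
  proof -
    have "Iso l (U (P j x)) = U (P j x)" if j: "j \<in> J l" for j
    proof -
      define i where "i = (if j = 0 then 0 else n - j)"
      have jn: "j < n" by (rule J_less[OF j])
      have i: "i < n" "i \<in> J l"
        using j l n by (auto simp: i_def isotypic_residues_def)
      have "zeta n ^ i * zeta n ^ j = 1"
        using zeta_power_n[OF n] jn by (simp add: i_def flip: power_add)
      moreover have "zeta n ^ j *\<^sub>C R (U (P j x)) = U (P j x)"
        using R_U_R[of "P j x"] by (simp add: R_P U_scaleC R_scaleC)
      ultimately have "R (U (P j x)) = zeta n ^ i *\<^sub>C U (P j x)"
        by (metis complex_vector.scale_one scaleC_scaleC)
      from Iso_eigenvector[OF this i(1)] i(2) show ?thesis by simp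
    qed
    then show ?thesis
      unfolding isotypic_proj_def[of _ _ l x] U_sum Iso_sum by (intro sum.cong refl)
  qed
  have "Iso k (U x) = Iso k (U (\<Sum>l=0..n div 2. Iso l x))" by (simp add: sum_Iso)
  also have "\<dots> = (\<Sum>l=0..n div 2. Iso k (Iso l (U (Iso l x))))"
    unfolding U_sum Iso_sum by (intro sum.cong refl) (simp add: fixed)
  also have "\<dots> = (\<Sum>l=0..n div 2. if k = l then Iso l (U (Iso l x)) else 0)"
    using k by (intro sum.cong refl Iso_Iso)
  also have "\<dots> = U (Iso k x)" using k fixed[OF k] by (simp add: sum.delta')
  finally show ?thesis .
qed

end

end


section \<open>Equivariant paths\<close>

locale equivariant_op = dihedral_rep n R S + sa_op T
  for n :: nat and R S :: "'a::chilbert_space \<Rightarrow> 'a" and T :: "'a \<Rightarrow>\<^sub>L 'a" +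
  assumes T_R: "T (R x) = R (T x)" and T_S: "T (S x) = S (T x)"
begin

lemma T_Rm: "T ((R ^^ m) x) = (R ^^ m) (T x)"
  by (induction m) (simp_all add: T_R)

lemma T_U: "T (U h x) = U h (T x)"
  by (simp add: U_def T_S T_Rm)

lemma T_P: "T (P j x) = P j (T x)"
  by (simp add: rot_proj_def scaleC blinfun.sum_right T_Rm)

lemma T_Iso: "T (Iso k x) = Iso k (T x)"
  by (simp add: isotypic_proj_def blinfun.sum_right T_P)

text \<open>The rotation is not selfadjoint, but its adjoint is its power \<open>R ^^ (n - 1)\<close>, which commutes with
  \<open>T\<close> as well.\<close>

lemma spec_proj_Rm: "spec_proj T l ((R ^^ m) x) = (R ^^ m) (spec_proj T l x)"
proof -
  have "spec_proj T l (R y) = R (spec_proj T l y)" for y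
    using Rm_bounded_linear[of 1]
    by (intro spec_proj_commute[where B' = "R ^^ (n - 1)"] Rm_bounded_linear)
       (simp_all add: T_R T_Rm R_rip)
  then show ?thesis by (induction m) simp_all
qed

lemma spec_proj_U: "spec_proj T l (U h x) = U h (spec_proj T l x)"
  by (rule spec_proj_commute[OF U_bounded_linear U_bounded_linear]) (rule T_U[symmetric] U_rip)+

lemma spec_proj_P: "spec_proj T l (P j x) = P j (spec_proj T l x)"
proof -
  interpret sp: bounded_linear "spec_proj T l" by (rule spec_proj_bounded_linear)
  show ?thesis by (simp add: rot_proj_def spec_proj_scaleC sp.sum spec_proj_Rm)
qed

lemma spec_proj_Iso: "spec_proj T l (Iso k x) = Iso k (spec_proj T l x)"
proof -
  interpret sp: bounded_linear "spec_proj T l" by (rule spec_proj_bounded_linear)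
  show ?thesis by (simp add: isotypic_proj_def sp.sum spec_proj_P)
qed

lemma E_refl_eq: "E_refl R S h \<epsilon> = {x\<in>UNIV. U h x = \<epsilon> *\<^sub>R x}"
  by (simp add: E_refl_def U_def)

lemma F_refl_eq:
  "k \<in> {0..n div 2} \<Longrightarrow> F_refl n R S k h \<epsilon> = {x\<in>E_refl R S h \<epsilon>. Iso k x = 1 *\<^sub>R x}"
  by (auto simp: F_refl_def E_refl_def isotypic_space_eq)

lemma reduced_op_E_refl: "reduced_op T (E_refl R S h \<epsilon>)"
proof (intro reduced_op.intro reduced_op_axioms.intro sa_op_axioms)
  show "closed_csubspace (E_refl R S h \<epsilon>)"
    unfolding E_refl_eq
    by (intro closed_csubspace_eigenspace U_clinear U_bounded_linear reduced_op.axioms(2)[OF reduced_op_UNIV])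
  show "T x \<in> E_refl R S h \<epsilon>" if "x \<in> E_refl R S h \<epsilon>" for x
    using that by (simp add: E_refl_eq T_U[symmetric] blinfun.scaleR_right)
qed

lemma reduced_op_F_refl:
  assumes "k \<in> {0..n div 2}"
  shows "reduced_op T (F_refl n R S k h \<epsilon>)"
proof (intro reduced_op.intro reduced_op_axioms.intro sa_op_axioms)
  interpret E: reduced_op T "E_refl R S h \<epsilon>" by (rule reduced_op_E_refl)
  show "closed_csubspace (F_refl n R S k h \<epsilon>)"
    unfolding F_refl_eq[OF assms]
    by (intro closed_csubspace_eigenspace Iso_clinear Iso_bounded_linear E.closed_csubspace_axioms)
  show "T x \<in> F_refl n R S k h \<epsilon>" if "x \<in> F_refl n R S k h \<epsilon>" for x
    using that E.invariant by (simp add: F_refl_eq[OF assms] T_Iso[symmetric])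
qed

end

theorem proposition3:
  fixes n h :: nat
    and R S :: "'a::chilbert_space \<Rightarrow> 'a"
    and A :: "real \<Rightarrow> 'a \<Rightarrow>\<^sub>L 'a"
  assumes "n \<ge> 1"
    and "separable_space (euclidean :: 'a topology)"
    and "unitary_dihedral_rep n R S"
    and "continuous_on {0..1} A"
    and "\<forall>t\<in>{0..1}. A t \<in> Fsa"
    and "\<forall>t\<in>{0..1}. blinfun_apply (A t) \<circ> R = R \<circ> blinfun_apply (A t)"
    and "\<forall>t\<in>{0..1}. blinfun_apply (A t) \<circ> S = S \<circ> blinfun_apply (A t)"
    and "h \<in> {0..n - 1}"
  shows "sf UNIV (\<lambda>t. blinfun_apply (A t)) 0 1 =
           sf (E_refl R S h 1) (\<lambda>t. blinfun_apply (A t)) 0 1 +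
           sf (E_refl R S h (- 1)) (\<lambda>t. blinfun_apply (A t)) 0 1 \<and>
         (\<forall>\<epsilon>\<in>{1, - 1}.
           sf (E_refl R S h \<epsilon>) (\<lambda>t. blinfun_apply (A t)) 0 1 =
             (\<Sum>k=0..n div 2. sf (F_refl n R S k h \<epsilon>) (\<lambda>t. blinfun_apply (A t)) 0 1))"
proof -
  interpret dihedral_rep n R S by (rule dihedral_rep.intro[OF assms(1,3)])
  have Fsa: "A t \<in> Fsa" if "t \<in> {0..1}" for t using assms(5) that by blast
  have eqv: "equivariant_op n R S (A t)" if t: "t \<in> {0..1}" for t
  proof (intro equivariant_op.intro equivariant_op_axioms.intro dihedral_rep_axioms
      Fsa_imp_sa_op[OF Fsa[OF t]])
    show "A t (R x) = R (A t x)" for x using assms(6) t by (metis comp_apply)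
    show "A t (S x) = S (A t x)" for x using assms(7) t by (metis comp_apply)
  qed
  have U_add: "U h (x + y) = U h x + U h y" and U_scaleC: "U h (c *\<^sub>C x) = c *\<^sub>C U h x" for x y c
    using U_clinear by (simp_all add: clinear_iff)
  note U_simps = U_add U_scaleC U_U linear_simps(5)[OF U_bounded_linear]
  have refl: "sf UNIV (\<lambda>t. blinfun_apply (A t)) 0 1 =
      (\<Sum>\<epsilon>\<in>{1, - 1}. sf (E_refl R S h \<epsilon>) (\<lambda>t. blinfun_apply (A t)) 0 1)"
  proof (rule sf_additive[where Q = "\<lambda>\<epsilon> x. (1/2) *\<^sub>R (x + \<epsilon> *\<^sub>R U h x)"])
    show "reduced_op (A s) UNIV" if "s \<in> {0..1}" for s
      by (rule sa_op.reduced_op_UNIV[OF Fsa_imp_sa_op[OF Fsa[OF that]]])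
    show "reduced_op (A s) (E_refl R S h \<epsilon>)" if "s \<in> {0..1}" for s \<epsilon>
      by (rule equivariant_op.reduced_op_E_refl[OF eqv[OF that]])
    show "E_refl R S h \<epsilon> = {x \<in> UNIV. (1/2) *\<^sub>R (x + \<epsilon> *\<^sub>R U h x) = x}" if "\<epsilon> \<in> {1, - 1}" for \<epsilon>
    proof -
      have "(1/2) *\<^sub>R (x + \<epsilon> *\<^sub>R U h x) = x \<longleftrightarrow> U h x = \<epsilon> *\<^sub>R x" for x
      proof -
        have "(1/2) *\<^sub>R (x + \<epsilon> *\<^sub>R U h x) = x \<longleftrightarrow> x + \<epsilon> *\<^sub>R U h x = 2 *\<^sub>R x"
          by (metis (no_types) divide_self_if scaleR_one scaleR_scaleR times_divide_eq_left
              mult_1 zero_neq_numeral times_divide_eq_right mult.right_neutral)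
        also have "\<dots> \<longleftrightarrow> \<epsilon> *\<^sub>R U h x = x" by (simp add: scaleR_2)
        also have "\<dots> \<longleftrightarrow> U h x = \<epsilon> *\<^sub>R x"
          using that by (elim insertE emptyE; simp; metis minus_minus)
        finally show ?thesis .
      qed
      then show ?thesis by (simp add: E_refl_def U_def)
    qed
    show "clinear (\<lambda>x. (1/2) *\<^sub>R (x + \<epsilon> *\<^sub>R U h x))" for \<epsilon>
      unfolding clinear_iff
      by (simp add: U_simps scaleR_add_right algebra_simps) (simp add: scaleR_scaleC scaleC_add_right scaleC_scaleC mult_ac)
    show "(1/2) *\<^sub>R ((1/2) *\<^sub>R (x + \<epsilon>' *\<^sub>R U h x) + \<epsilon> *\<^sub>R U h ((1/2) *\<^sub>R (x + \<epsilon>' *\<^sub>R U h x))) =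
        (if \<epsilon> = \<epsilon>' then (1/2) *\<^sub>R (x + \<epsilon>' *\<^sub>R U h x) else 0)"
      if "\<epsilon> \<in> {1, - 1}" "\<epsilon>' \<in> {1, - 1}" for \<epsilon> \<epsilon>' x
    proof -
      \<comment> \<open>\<open>y\<close> is an eigenvector of the reflection, so the outer projection multiplies it by a number.\<close>
      define y where "y = x + \<epsilon>' *\<^sub>R U h x"
      have "U h y = \<epsilon>' *\<^sub>R y" using that(2) by (auto simp: y_def U_simps)
      then have "(1/2) *\<^sub>R ((1/2) *\<^sub>R y + \<epsilon> *\<^sub>R U h ((1/2) *\<^sub>R y)) = ((1 + \<epsilon> * \<epsilon>') / 4) *\<^sub>R y"
        by (simp add: U_simps scaleR_add_right scaleR_add_left add_divide_distrib)
      then show ?thesis using that by (auto simp flip: y_def)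
    qed
    show "(\<Sum>\<epsilon>\<in>{1, - 1}. (1/2) *\<^sub>R (x + \<epsilon> *\<^sub>R U h x)) = x" for x
      by (simp add: scaleR_add_right flip: scaleR_add_left)
    show "spec_proj (A s) l ((1/2) *\<^sub>R (x + \<epsilon> *\<^sub>R U h x)) =
        (1/2) *\<^sub>R (spec_proj (A s) l x + \<epsilon> *\<^sub>R U h (spec_proj (A s) l x))"
      if s: "s \<in> {0..1}" for \<epsilon> s l x
    proof -
      interpret equivariant_op n R S "A s" by (rule eqv[OF s])
      show ?thesis by (simp add: spec_proj_linear_simps spec_proj_U)
    qed
  qed (use assms(4) Fsa in auto)
  have "sf (E_refl R S h \<epsilon>) (\<lambda>t. blinfun_apply (A t)) 0 1 =
      (\<Sum>k=0..n div 2. sf (F_refl n R S k h \<epsilon>) (\<lambda>t. blinfun_apply (A t)) 0 1)" for \<epsilon>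
  proof (rule sf_additive[where Q = Iso])
    show "reduced_op (A s) (E_refl R S h \<epsilon>)" if "s \<in> {0..1}" for s
      by (rule equivariant_op.reduced_op_E_refl[OF eqv[OF that]])
    show "reduced_op (A s) (F_refl n R S k h \<epsilon>)" if "k \<in> {0..n div 2}" "s \<in> {0..1}" for s k
      by (rule equivariant_op.reduced_op_F_refl[OF eqv[OF that(2)] that(1)])
    show "F_refl n R S k h \<epsilon> = {x \<in> E_refl R S h \<epsilon>. Iso k x = x}" if "k \<in> {0..n div 2}" for k
      using that by (auto simp: F_refl_def E_refl_def isotypic_space_eq)
    show "Iso k x \<in> E_refl R S h \<epsilon>" if "k \<in> {0..n div 2}" "x \<in> E_refl R S h \<epsilon>" for k x
    proof -
      have "U h x = \<epsilon> *\<^sub>R x" using that(2) by (simp add: E_refl_def U_def)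
      then have "U h (Iso k x) = \<epsilon> *\<^sub>R Iso k x"
        using Iso_U[OF that(1), of h x] linear_simps(5)[OF Iso_bounded_linear] by metis
      then show ?thesis by (simp add: E_refl_def U_def)
    qed
    show "spec_proj (A s) l (Iso k x) = Iso k (spec_proj (A s) l x)" if s: "s \<in> {0..1}" for k s l x
    proof -
      interpret equivariant_op n R S "A s" by (rule eqv[OF s])
      show ?thesis by (rule spec_proj_Iso)
    qed
  qed (use assms(4) Fsa Iso_clinear Iso_Iso sum_Iso in auto)
  with refl show ?thesis by simp
qed

end
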